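(* Let $\sigma:\mathbb{R}\to\mathbb{R}$ be smooth with $\sigma'(\eta)>0$ for all $\eta\in\mathbb{R}$, let $\gamma>0$, and set $a=\sqrt{\sigma'(0)}>0$; assume $a\neq 1$. For $U_0\in B^{3/2}_{2,1}(\mathbb{R})\cap L^1(\mathbb{R})$ set $\widetilde{I}_0:=\|U_0\|_{B^{3/2}_{2,1}(\mathbb{R})\cap L^1(\mathbb{R})}$. There exist constants $\delta>0$ and $C>0$ such that, if $\widetilde{I}_0\le\delta$, then the small-data global classical solution $U=(v,u,z,y)^{\top}$ (in the sense given in the context) of $$U_t+A(U)U_x+LU=0,\qquad U(0,x)=U_0(x),$$ satisfies $$\|U(t)\|_{L^2(\mathbb{R})}\le C\,\widetilde{I}_0\,(1+t)^{-\frac14}\qquad\text{for all }t\ge0.$$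
   Context: The matrices are $$A(U)=-\begin{pmatrix}0&1&0&0\\1&0&0&0\\0&0&0&a\\0&0&\frac{\sigma'(z/a)}{a}&0\end{pmatrix},\qquad L=\begin{pmatrix}0&0&0&1\\0&0&0&0\\0&0&0&0\\-1&0&0&\gamma\end{pmatrix},$$ with $U=(v,u,z,y)^{\top}(t,x)\in\mathbb{R}^4$, $t\ge0$, $x\in\mathbb{R}$. Littlewood–Paley decomposition: fix smooth functions $\varphi,\chi$ with values in $[0,1]$, $\varphi$ supported in $\{\frac34\le|\xi|\le\frac83\}$, $\chi$ supported in $\{|\xi|\le\frac43\}$, with $\chi(\xi)+\sum_{q\ge0}\varphi(2^{-q}\xi)=1$ for all $\xi$ and $\sum_{q\in\mathbb{Z}}\varphi(2^{-q}\xi)=1$ for all $\xi\ne0$. Set $\Delta_{-1}f=\mathcal{F}^{-1}(\chi\mathcal{F}f)$, $\Delta_qf=\mathcal{F}^{-1}(\varphi(2^{-q}\cdot)\mathcal{F}f)$ for $q\ge0$. For $s\in\mathbb{R}$, $1\le p,r,\theta\le\infty$, $T>0$: $\|f\|_{B^s_{p,r}}=\big\|(2^{qs}\|\Delta_qf\|_{L^p})_{q\ge-1}\big\|_{\ell^r}$ and $\|f\|_{\widetilde{L}^\theta_T(B^s_{p,r})}=\big\|(2^{qs}\|\Delta_qf\|_{L^\theta(0,T;L^p)})_{q\ge-1}\big\|_{\ell^r}$. $\widetilde{\mathcal{C}}_T(B^s_{p,r})=\widetilde{L}^\infty_T(B^s_{p,r})\cap\mathcal{C}([0,T],B^s_{p,r})$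 and $\widetilde{\mathcal{C}}^1_T(B^s_{p,r})=\{f\in\mathcal{C}^1([0,T],B^s_{p,r}):\partial_tf\in\widetilde{L}^\infty_T(B^s_{p,r})\}$; $T$ is omitted when $T=+\infty$. The norm in $X\cap Y$ is $\|\cdot\|_X+\|\cdot\|_Y$, and norms of vectors are sums of the norms of components. Small-data global classical solution: there are constants $\delta_0,C_0>0$ such that for every $U_0\in B^{3/2}_{2,1}(\mathbb{R})$ with $\|U_0\|_{B^{3/2}_{2,1}}\le\delta_0$ the Cauchy problem has a unique global classical solution $U\in\mathcal{C}^1(\mathbb{R}^+\times\mathbb{R})$ with $U\in\widetilde{\mathcal{C}}(B^{3/2}_{2,1})\cap\widetilde{\mathcal{C}}^1(B^{1/2}_{2,1})$, and it satisfies, for all $T>0$, $\|U\|_{\widetilde{L}^\infty(B^{3/2}_{2,1})}+\|y\|_{\widetilde{L}^2_T(B^{3/2}_{2,1})}+\|(v,z_x)\|_{\widetilde{L}^2_T(B^{1/2}_{2,1})}+\|u_x\|_{\widetilde{L}^2_T(B^{-1/2}_{2,1})}\le C_0\|U_0\|_{B^{3/2}_{2,1}}$. The solution referred to in the claim is this one (the smallness $\delta$ includes $\delta\le\delta_0$). *)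

theory Defs
  imports "HOL-Analysis.Analysis" "HOL-Probability.Essential_Supremum"
begin

subsection \<open>Smooth and Schwartz functions\<close>

definition nderiv :: "nat \<Rightarrow> (real \<Rightarrow> 'a::real_normed_vector) \<Rightarrow> real \<Rightarrow> 'a" where
  "nderiv n = (\<lambda>f x. vector_derivative f (at x)) ^^ n"

definition smooth :: "(real \<Rightarrow> 'a::real_normed_vector) \<Rightarrow> bool" where
  "smooth f \<longleftrightarrow> (\<forall>n x. nderiv n f differentiable (at x))"

definition schwartz :: "(real \<Rightarrow> complex) set" where
  "schwartz = {\<psi>. smooth \<psi> \<and> (\<forall>j k. bounded (range (\<lambda>x. x ^ j *\<^sub>R nderiv k \<psi> x)))}"

definition schwartz_seminorm :: "nat \<Rightarrow> (real \<Rightarrow> complex) \<Rightarrow> real" where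
  "schwartz_seminorm N \<psi> = (\<Sum>j\<le>N. \<Sum>k\<le>N. SUP x. norm (x ^ j *\<^sub>R nderiv k \<psi> x))"


subsection \<open>Tempered distributions and the Fourier transform\<close>

text \<open>A distribution is a functional on test functions; its values outside \<open>schwartz\<close> are irrelevant.\<close>

type_synonym distr = "(real \<Rightarrow> complex) \<Rightarrow> complex"

definition tempered :: "distr \<Rightarrow> bool" where
  "tempered F \<longleftrightarrow>
     (\<forall>\<psi>\<in>schwartz. \<forall>\<eta>\<in>schwartz. \<forall>c d. F (\<lambda>x. c * \<psi> x + d * \<eta> x) = c * F \<psi> + d * F \<eta>) \<and>
     (\<exists>C N. \<forall>\<psi>\<in>schwartz. norm (F \<psi>) \<le> C * schwartz_seminorm N \<psi>)"

definition dist_of :: "(real \<Rightarrow> complex) \<Rightarrow> distr" where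
  "dist_of f \<psi> = (LINT x|lborel. f x * \<psi> x)"

text \<open>The pairing in \<open>dist_of f\<close> is a convergent integral for every test function, so that
  \<open>dist_of f\<close> is not affected by the convention that divergent integrals are 0.\<close>

definition regular :: "(real \<Rightarrow> complex) \<Rightarrow> bool" where
  "regular f \<longleftrightarrow> f \<in> borel_measurable lborel \<and>
     (\<forall>\<psi>\<in>schwartz. integrable lborel (\<lambda>x. f x * \<psi> x))"

text \<open>Normalisation: \<open>F f(\<xi>) = \<integral> e\<^sup>-\<^sup>i\<^sup>x\<^sup>\<xi> f(x) dx\<close>.\<close>

definition fourier :: "(real \<Rightarrow> complex) \<Rightarrow> real \<Rightarrow> complex" where
  "fourier \<psi> \<xi> = (LINT x|lborel. cis (- (x * \<xi>)) * \<psi> x)"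

definition inv_fourier :: "(real \<Rightarrow> complex) \<Rightarrow> real \<Rightarrow> complex" where
  "inv_fourier \<psi> x = (LINT \<xi>|lborel. cis (x * \<xi>) * \<psi> \<xi>) / of_real (2 * pi)"

definition dist_fourier :: "distr \<Rightarrow> distr" where
  "dist_fourier F \<psi> = F (fourier \<psi>)"

definition dist_inv_fourier :: "distr \<Rightarrow> distr" where
  "dist_inv_fourier F \<psi> = F (inv_fourier \<psi>)"

definition dist_mult :: "(real \<Rightarrow> real) \<Rightarrow> distr \<Rightarrow> distr" where
  "dist_mult m F \<psi> = F (\<lambda>\<xi>. of_real (m \<xi>) * \<psi> \<xi>)"


subsection \<open>Lebesgue norms\<close>

definition enn_powr :: "ennreal \<Rightarrow> real \<Rightarrow> ennreal" where
  "enn_powr x b = (if x = \<infinity> then \<infinity> else ennreal (enn2real x powr b))"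

text \<open>The norm of \<open>L\<^sup>p(M)\<close> for \<open>1 \<le> p \<le> \<infinity>\<close>, applied to the modulus of a function.\<close>

definition Lp_norm :: "ennreal \<Rightarrow> 'a measure \<Rightarrow> ('a \<Rightarrow> ennreal) \<Rightarrow> ennreal" where
  "Lp_norm p M f =
     (if f \<notin> borel_measurable M then \<infinity>
      else if p = \<infinity> then esssup M f
      else enn_powr (\<integral>\<^sup>+x. enn_powr (f x) (enn2real p) \<partial>M) (1 / enn2real p))"

text \<open>A representing function is unique almost everywhere, so the infimum is the norm of that
  function, and it is \<open>\<infinity>\<close> if the distribution is not in \<open>L\<^sup>p\<close>.\<close>

definition dist_Lp_norm :: "ennreal \<Rightarrow> distr \<Rightarrow> ennreal" where
  "dist_Lp_norm p F =
     Inf {Lp_norm p lborel (\<lambda>x. ennreal (norm (g x))) | g.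
            g \<in> borel_measurable lborel \<and> Lp_norm p lborel (\<lambda>x. ennreal (norm (g x))) < \<infinity> \<and>
            (\<forall>\<psi>\<in>schwartz. F \<psi> = dist_of g \<psi>)}"


subsection \<open>Littlewood-Paley decomposition, Besov and Chemin-Lerner spaces\<close>

definition littlewood_paley :: "(real \<Rightarrow> real) \<Rightarrow> (real \<Rightarrow> real) \<Rightarrow> bool" where
  "littlewood_paley phi chi \<longleftrightarrow>
     smooth phi \<and> smooth chi \<and> range phi \<subseteq> {0..1} \<and> range chi \<subseteq> {0..1} \<and>
     {\<xi>. phi \<xi> \<noteq> 0} \<subseteq> {\<xi>. 3/4 \<le> \<bar>\<xi>\<bar> \<and> \<bar>\<xi>\<bar> \<le> 8/3} \<and>
     {\<xi>. chi \<xi> \<noteq> 0} \<subseteq> {\<xi>. \<bar>\<xi>\<bar> \<le> 4/3} \<and>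
     (\<forall>\<xi>. ((\<lambda>q::int. phi (2 powi (- q) * \<xi>)) has_sum (1 - chi \<xi>)) {0..}) \<and>
     (\<forall>\<xi>. \<xi> \<noteq> 0 \<longrightarrow> ((\<lambda>q::int. phi (2 powi (- q) * \<xi>)) has_sum 1) UNIV)"

text \<open>The dyadic blocks are used for \<open>q \<ge> -1\<close> only. In what follows \<open>lp\<close> is the pair \<open>(phi, chi)\<close>.\<close>

definition block :: "(real \<Rightarrow> real) \<times> (real \<Rightarrow> real) \<Rightarrow> int \<Rightarrow> distr \<Rightarrow> distr" where
  "block lp q F =
     dist_inv_fourier
       (dist_mult (if q = -1 then snd lp else (\<lambda>\<xi>. fst lp (2 powi (- q) * \<xi>))) (dist_fourier F))"

definition besov_norm ::
  "(real \<Rightarrow> real) \<times> (real \<Rightarrow> real) \<Rightarrow> real \<Rightarrow> ennreal \<Rightarrow> ennreal \<Rightarrow> distr \<Rightarrow> ennreal" where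
  "besov_norm lp s p r F =
     Lp_norm r (count_space {-1..})
       (\<lambda>q. ennreal (2 powr (of_int q * s)) * dist_Lp_norm p (block lp q F))"

definition besov ::
  "(real \<Rightarrow> real) \<times> (real \<Rightarrow> real) \<Rightarrow> real \<Rightarrow> ennreal \<Rightarrow> ennreal \<Rightarrow> distr set" where
  "besov lp s p r = {F. tempered F \<and> besov_norm lp s p r F < \<infinity>}"

text \<open>The norm of the Chemin-Lerner space \<open>L~\<^sup>\<theta>\<^sub>T(B\<^sup>s\<^sub>p\<^sub>,\<^sub>r)\<close>, with \<open>T \<le> \<infinity>\<close>.\<close>

definition cl_norm ::
  "(real \<Rightarrow> real) \<times> (real \<Rightarrow> real) \<Rightarrow> ennreal \<Rightarrow> ereal \<Rightarrow> real \<Rightarrow> ennreal \<Rightarrow> ennreal \<Rightarrow>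
    (real \<Rightarrow> distr) \<Rightarrow> ennreal" where
  "cl_norm lp \<theta> T s p r F =
     Lp_norm r (count_space {-1..})
       (\<lambda>q. ennreal (2 powr (of_int q * s)) *
            Lp_norm \<theta> (restrict_space lborel {t. 0 < t \<and> ereal t < T})
              (\<lambda>t. dist_Lp_norm p (block lp q (F t))))"

text \<open>\<open>[0,T]\<close>, to be read as \<open>[0,\<infinity>)\<close> if \<open>T = \<infinity>\<close>.\<close>

definition time_ivl :: "ereal \<Rightarrow> real set" where
  "time_ivl T = {t. 0 \<le> t \<and> ereal t \<le> T}"

definition C_besov ::
  "(real \<Rightarrow> real) \<times> (real \<Rightarrow> real) \<Rightarrow> ereal \<Rightarrow> real \<Rightarrow> ennreal \<Rightarrow> ennreal \<Rightarrow> (real \<Rightarrow> distr) set" where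
  "C_besov lp T s p r =
     {F. \<forall>t\<in>time_ivl T. F t \<in> besov lp s p r \<and>
           ((\<lambda>t'. besov_norm lp s p r (\<lambda>\<psi>. F t' \<psi> - F t \<psi>)) \<longlongrightarrow> 0) (at t within time_ivl T)}"

definition besov_derivative ::
  "(real \<Rightarrow> real) \<times> (real \<Rightarrow> real) \<Rightarrow> ereal \<Rightarrow> real \<Rightarrow> ennreal \<Rightarrow> ennreal \<Rightarrow>
    (real \<Rightarrow> distr) \<Rightarrow> (real \<Rightarrow> distr) \<Rightarrow> bool" where
  "besov_derivative lp T s p r F G \<longleftrightarrow>
     (\<forall>t\<in>time_ivl T.
        ((\<lambda>t'. besov_norm lp s p r (\<lambda>\<psi>. (F t' \<psi> - F t \<psi>) / of_real (t' - t) - G t \<psi>))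
           \<longlongrightarrow> 0) (at t within time_ivl T))"

definition tilde_C ::
  "(real \<Rightarrow> real) \<times> (real \<Rightarrow> real) \<Rightarrow> ereal \<Rightarrow> real \<Rightarrow> ennreal \<Rightarrow> ennreal \<Rightarrow> (real \<Rightarrow> distr) set" where
  "tilde_C lp T s p r = {F \<in> C_besov lp T s p r. cl_norm lp \<infinity> T s p r F < \<infinity>}"

definition tilde_C1 ::
  "(real \<Rightarrow> real) \<times> (real \<Rightarrow> real) \<Rightarrow> ereal \<Rightarrow> real \<Rightarrow> ennreal \<Rightarrow> ennreal \<Rightarrow> (real \<Rightarrow> distr) set" where
  "tilde_C1 lp T s p r =
     {F \<in> C_besov lp T s p r.
        \<exists>G\<in>C_besov lp T s p r.
          besov_derivative lp T s p r F G \<and> cl_norm lp \<infinity> T s p r G < \<infinity>}"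


subsection \<open>Vector-valued functions\<close>

definition coord :: "(real \<Rightarrow> real ^ 'n) \<Rightarrow> 'n \<Rightarrow> real \<Rightarrow> complex" where
  "coord f i x = of_real (f x $ i)"

definition in_besov_vec ::
  "(real \<Rightarrow> real) \<times> (real \<Rightarrow> real) \<Rightarrow> real \<Rightarrow> ennreal \<Rightarrow> ennreal \<Rightarrow> (real \<Rightarrow> real ^ 'n) \<Rightarrow> bool" where
  "in_besov_vec lp s p r f \<longleftrightarrow> (\<forall>i. regular (coord f i) \<and> dist_of (coord f i) \<in> besov lp s p r)"

definition besov_norm_vec ::
  "(real \<Rightarrow> real) \<times> (real \<Rightarrow> real) \<Rightarrow> real \<Rightarrow> ennreal \<Rightarrow> ennreal \<Rightarrow> (real \<Rightarrow> real ^ 'n) \<Rightarrow> ennreal" where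
  "besov_norm_vec lp s p r f = (\<Sum>i\<in>UNIV. besov_norm lp s p r (dist_of (coord f i)))"

definition Lp_norm_vec :: "ennreal \<Rightarrow> (real \<Rightarrow> real ^ 'n) \<Rightarrow> ennreal" where
  "Lp_norm_vec p f = (\<Sum>i\<in>UNIV. Lp_norm p lborel (\<lambda>x. ennreal \<bar>f x $ i\<bar>))"


subsection \<open>The system and its solutions\<close>

text \<open>The components of \<open>U\<close> are \<open>v = U $ 1\<close>, \<open>u = U $ 2\<close>, \<open>z = U $ 3\<close>, \<open>y = U $ 4\<close>.\<close>

definition matA :: "(real \<Rightarrow> real) \<Rightarrow> real \<Rightarrow> real ^ 4 \<Rightarrow> real ^ 4 ^ 4" where
  "matA \<sigma> a U =
     - vector [vector [0, 1, 0, 0],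
               vector [1, 0, 0, 0],
               vector [0, 0, 0, a],
               vector [0, 0, deriv \<sigma> (U $ 3 / a) / a, 0]]"

definition matL :: "real \<Rightarrow> real ^ 4 ^ 4" where
  "matL \<gamma> =
     vector [vector [0, 0, 0, 1],
             vector [0, 0, 0, 0],
             vector [0, 0, 0, 0],
             vector [-1, 0, 0, \<gamma>]]"

text \<open>Functions of \<open>(t,x)\<close> are only considered for \<open>t \<ge> 0\<close>; at \<open>t = 0\<close> the time derivative is
  one-sided.\<close>

definition dt :: "(real \<Rightarrow> real \<Rightarrow> 'a::real_normed_vector) \<Rightarrow> real \<Rightarrow> real \<Rightarrow> 'a" where
  "dt U t x = vector_derivative (\<lambda>s. U s x) (at t within {0..})"

definition dx :: "(real \<Rightarrow> real \<Rightarrow> 'a::real_normed_vector) \<Rightarrow> real \<Rightarrow> real \<Rightarrow> 'a" where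
  "dx U t x = vector_derivative (U t) (at x)"

definition C1_halfplane :: "(real \<Rightarrow> real \<Rightarrow> 'a::real_normed_vector) \<Rightarrow> bool" where
  "C1_halfplane U \<longleftrightarrow>
     (\<forall>t\<ge>0. \<forall>x. (\<lambda>s. U s x) differentiable (at t within {0..}) \<and> U t differentiable (at x)) \<and>
     continuous_on ({0..} \<times> UNIV) (\<lambda>(t, x). U t x) \<and>
     continuous_on ({0..} \<times> UNIV) (\<lambda>(t, x). dt U t x) \<and>
     continuous_on ({0..} \<times> UNIV) (\<lambda>(t, x). dx U t x)"

definition classical_solution ::
  "(real \<Rightarrow> real) \<Rightarrow> real \<Rightarrow> real \<Rightarrow> (real \<Rightarrow> real ^ 4) \<Rightarrow> (real \<Rightarrow> real \<Rightarrow> real ^ 4) \<Rightarrow> bool" where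
  "classical_solution \<sigma> a \<gamma> U0 U \<longleftrightarrow>
     C1_halfplane U \<and>
     (\<forall>t\<ge>0. \<forall>x. dt U t x + matA \<sigma> a (U t x) *v dx U t x + matL \<gamma> *v U t x = 0) \<and>
     (\<forall>x. U 0 x = U0 x)"

definition solution_class ::
  "(real \<Rightarrow> real) \<times> (real \<Rightarrow> real) \<Rightarrow> (real \<Rightarrow> real \<Rightarrow> real ^ 4) \<Rightarrow> bool" where
  "solution_class lp U \<longleftrightarrow>
     (\<forall>i. (\<forall>t\<ge>0. regular (coord (U t) i)) \<and>
          (\<lambda>t. dist_of (coord (U t) i)) \<in> tilde_C lp \<infinity> (3/2) 2 1 \<inter> tilde_C1 lp \<infinity> (1/2) 2 1)"

definition solution_estimate ::
  "(real \<Rightarrow> real) \<times> (real \<Rightarrow> real) \<Rightarrow> real \<Rightarrow> (real \<Rightarrow> real ^ 4) \<Rightarrow> (real \<Rightarrow> real \<Rightarrow> real ^ 4) \<Rightarrow> bool" where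
  "solution_estimate lp C0 U0 U \<longleftrightarrow>
     (\<forall>T>0::real.
        (\<Sum>i\<in>UNIV. cl_norm lp \<infinity> \<infinity> (3/2) 2 1 (\<lambda>t. dist_of (coord (U t) i)))
        + cl_norm lp 2 T (3/2) 2 1 (\<lambda>t. dist_of (coord (U t) 4))
        + (cl_norm lp 2 T (1/2) 2 1 (\<lambda>t. dist_of (coord (U t) 1))
           + cl_norm lp 2 T (1/2) 2 1 (\<lambda>t. dist_of (coord (dx U t) 3)))
        + cl_norm lp 2 T (-1/2) 2 1 (\<lambda>t. dist_of (coord (dx U t) 2))
        \<le> ennreal C0 * besov_norm_vec lp (3/2) 2 1 U0)"

text \<open>The global solution furnished by the small-data theory, \<open>\<delta>0\<close> and \<open>C0\<close> being the threshold and the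
  constant there. It is unique, so that a statement about all such \<open>U\<close> is one about that solution.\<close>

definition small_data_solution ::
  "(real \<Rightarrow> real) \<times> (real \<Rightarrow> real) \<Rightarrow> (real \<Rightarrow> real) \<Rightarrow> real \<Rightarrow> real \<Rightarrow> real \<Rightarrow> real \<Rightarrow>
    (real \<Rightarrow> real ^ 4) \<Rightarrow> (real \<Rightarrow> real \<Rightarrow> real ^ 4) \<Rightarrow> bool" where
  "small_data_solution lp \<sigma> a \<gamma> \<delta>0 C0 U0 U \<longleftrightarrow>
     in_besov_vec lp (3/2) 2 1 U0 \<and> besov_norm_vec lp (3/2) 2 1 U0 \<le> ennreal \<delta>0 \<and>
     classical_solution \<sigma> a \<gamma> U0 U \<and> solution_class lp U \<and> solution_estimate lp C0 U0 U"

definition I0_norm ::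
  "(real \<Rightarrow> real) \<times> (real \<Rightarrow> real) \<Rightarrow> (real \<Rightarrow> real ^ 4) \<Rightarrow> ennreal" where
  "I0_norm lp U0 = besov_norm_vec lp (3/2) 2 1 U0 + Lp_norm_vec 1 U0"

end

theory Submission
  imports Defs "HOL-Probability.Sinc_Integral" "HOL-Probability.Characteristic_Functions"
begin

text \<open>
Linearized at rest, the system is symmetric hyperbolic and damps only the component \<open>y\<close>. The other
components are dissipated through the coupling, and at frequency \<open>\<xi>\<close> the rate at which this happens is
of order \<open>\<xi>\<^sup>2 / (1 + \<xi>\<^sup>2)\<^sup>2\<close>: it degenerates at low frequencies, as for the heat equation, and also at
high ones, where a derivative is lost. The rate \<open>(1 + t) powr (-1/4)\<close> is that of the heat equation with
integrable data. The high frequencies are harmless because the solution stays bounded in \<open>H\<^sup>1\<close>.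

The argument runs in physical space. The operator \<open>res s = (1 - s \<partial>\<^sub>x\<^sup>2)\<^sup>-\<^sup>1\<close> replaces the cutoff to the
frequencies below \<open>1 / sqrt s\<close>, and \<open>dres s = \<partial>\<^sub>x res s\<close>. Three estimates are combined.

  \<^item> A compensated energy \<open>E\<close>, equivalent to the square \<open>N2\<close> of the \<open>L\<^sup>2\<close> norm, satisfies \<open>E' \<le> - c D\<close>,
  where \<open>D\<close> is the square of the norm of \<open>dres 1 U\<close> (\<open>dissipation_identities\<close>, \<open>lyapunov_constants\<close>).
  The energy proper contains the potential energy of the nonlinear system, so that it decays exactly by the
  damping of \<open>y\<close>; in the compensating terms the nonlinearity is small in \<open>H\<^sup>-\<^sup>1\<close> and is absorbed
  (\<open>G_H1_dual_bound\<close>).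
  \<^item> Up to constants, the low frequencies \<open>res s U\<close> are bounded by \<open>s powr (-1/4)\<close> times the \<open>L\<^sup>1\<close> norm of the data plus the
  time integral of \<open>s powr (-3/4)\<close> times the \<open>L\<^sup>1\<close> norm of the quadratic flux (\<open>res_L1\<close>, \<open>low_bound\<close>).
  \<^item> For \<open>s \<ge> 1\<close> every function satisfies \<open>\<parallel>f\<parallel>\<^sup>2 \<le> 6 (\<parallel>res s f\<parallel>\<^sup>2 + s \<parallel>dres 1 f\<parallel>\<^sup>2 + \<parallel>f'\<parallel>\<^sup>2 / s)\<close>
  (\<open>interpolation\<close>), a splitting into low, medium and high frequencies.

With \<open>s = 1 + k t\<close>, these show that \<open>E\<close> cannot cross a barrier \<open>K / sqrt (1 + k t)\<close>: at a first crossing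
the low and high frequencies are too small to carry \<open>N2\<close>, hence \<open>s D\<close> is large, and \<open>E\<close> decreases faster
than the barrier (\<open>flow.decay\<close>).

It remains to see that the solution is such a flow: \<open>U(t)\<close> is bounded in \<open>H\<^sup>1\<close> by a multiple of the data,
and \<open>U\<close> is differentiable in time as a curve in \<open>L\<^sup>2\<close>. Both are extracted from the Besov norms by duality.
A tempered distribution is the sum of its dyadic blocks, by Fourier inversion on Schwartz functions, so
that a Besov norm bounds its pairing with test functions by their \<open>L\<^sup>2\<close> norms; for a continuous function
this bounds the \<open>L\<^sup>2\<close> norm (\<open>dual_L2_bound\<close>). The bounds pass to limits in time by Fatou's lemma
(\<open>H1_bound_of_cl_norm\<close>, \<open>L2_time_derivative\<close>).
\<close>

section \<open>Continuous square-integrable functions as an inner product space\<close>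

lemma le_of_square_le:
  fixes x y :: real
  assumes "x * x \<le> x * y" "0 \<le> x" "0 \<le> y"
  shows "x \<le> y"
  using assms by (cases "x = 0") auto

lemma integrable_small_at_top:
  fixes f :: "real \<Rightarrow> 'a::{banach, second_countable_topology}"
  assumes f: "integrable lborel f" and e: "e > 0"
  shows "\<exists>x\<ge>c. norm (f x) < e"
proof (rule ccontr)
  assume "\<not> ?thesis"
  then have ge: "\<And>x. x \<ge> c \<Longrightarrow> norm (f x) \<ge> e" by force
  have "integrable lborel (\<lambda>x. indicator {c..} x :: real)"
    by (rule Bochner_Integration.integrable_bound[OF integrable_scaleR_right[OF integrable_norm[OF f], of "inverse e"]])
      (use ge e in \<open>auto simp: indicator_def field_simps\<close>)
  moreover have "emeasure lborel {c..} = \<infinity>"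
  proof (rule ccontr)
    assume "emeasure lborel {c..} \<noteq> \<infinity>"
    then have fin: "emeasure lborel {c..} < \<infinity>" by (simp add: less_top)
    define r where "r = enn2real (emeasure lborel {c..})"
    have "emeasure lborel {c..c + (r+1)} \<le> emeasure lborel {c..}"
      by (intro emeasure_mono) auto
    then have "ennreal (r+1) \<le> emeasure lborel {c..}" by (simp add: r_def)
    also have "\<dots> = ennreal r" using fin by (simp add: r_def)
    finally show False by (simp add: r_def)
  qed
  ultimately show False
    by (simp add: integrable_indicator_iff)
qed

text \<open>An integrable function need not tend to \<open>0\<close> at infinity, but it is small at some points arbitrarily far
out on either side. The fundamental theorem of calculus between such points suffices.\<close>

lemma integral_derivative_eq_0:
  fixes h h' :: "real \<Rightarrow> 'a::euclidean_space"
  assumes d: "\<And>x. (h has_vector_derivative h' x) (at x)"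
    and c: "continuous_on UNIV h'" and i: "integrable lborel h" and i': "integrable lborel h'"
  shows "(LINT x|lborel. h' x) = 0"
proof -
  have "\<forall>n::nat. \<exists>x\<ge>real n. norm (h x) < inverse (real (Suc n))"
    by (intro allI integrable_small_at_top[OF i]) auto
  then obtain b where b: "\<And>n. b n \<ge> real n" "\<And>n. norm (h (b n)) < inverse (real (Suc n))"
    by metis
  have i2: "integrable lborel (\<lambda>x. h (- x))"
    using lborel_integrable_real_affine[OF i, of "-1" 0] by simp
  have "\<forall>n::nat. \<exists>x\<ge>real n. norm (h (-x)) < inverse (real (Suc n))"
    by (intro allI integrable_small_at_top[OF i2]) auto
  then obtain a where a: "\<And>n. a n \<ge> real n" "\<And>n. norm (h (- a n)) < inverse (real (Suc n))"
    by metis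
  have ftc: "(LINT x|lborel. indicator {- a n..b n} x *\<^sub>R h' x) = h (b n) - h (- a n)" for n
    using integral_FTC_Icc[of "- a n" "b n" h h'] a(1)[of n] b(1)[of n] d c
    by (simp add: has_vector_derivative_at_within continuous_on_subset)
  have "(\<lambda>n. LINT x|lborel. indicator {- a n..b n} x *\<^sub>R h' x) \<longlonglongrightarrow> (LINT x|lborel. h' x)"
  proof (rule integral_dominated_convergence[where w = "\<lambda>x. norm (h' x)"])
    show "AE x in lborel. (\<lambda>n. indicator {- a n..b n} x *\<^sub>R h' x) \<longlonglongrightarrow> h' x"
    proof (intro AE_I2 tendsto_eventually)
      fix x :: real
      obtain N :: nat where N: "\<bar>x\<bar> \<le> real N" using real_arch_simple by blast
      show "\<forall>\<^sub>F n in sequentially. indicator {- a n..b n} x *\<^sub>R h' x = h' x"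
      proof (rule eventually_sequentiallyI[of N])
        fix n assume "N \<le> n"
        then have "\<bar>x\<bar> \<le> a n" "\<bar>x\<bar> \<le> b n" using N a(1)[of n] b(1)[of n] by linarith+
        then show "indicator {- a n..b n} x *\<^sub>R h' x = h' x" by (auto simp: indicator_def)
      qed
    qed
  qed (use i' in \<open>auto simp: indicator_def\<close>)
  moreover have "(\<lambda>n. LINT x|lborel. indicator {- a n..b n} x *\<^sub>R h' x) \<longlonglongrightarrow> 0 - 0"
    unfolding ftc
  proof (intro tendsto_diff)
    show "(\<lambda>n. h (b n)) \<longlonglongrightarrow> 0"
      by (rule Lim_null_comparison[OF _ LIMSEQ_inverse_real_of_nat]) (use less_imp_le[OF b(2)] in \<open>auto intro!: always_eventually\<close>)
    show "(\<lambda>n. h (- a n)) \<longlonglongrightarrow> 0"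
      by (rule Lim_null_comparison[OF _ LIMSEQ_inverse_real_of_nat]) (use less_imp_le[OF a(2)] in \<open>auto intro!: always_eventually\<close>)
  qed
  ultimately show ?thesis using LIMSEQ_unique by fastforce
qed

lemma integrable_mult_of_squares:
  fixes f g :: "'a \<Rightarrow> real"
  assumes "integrable M (\<lambda>x. (f x)\<^sup>2)" "integrable M (\<lambda>x. (g x)\<^sup>2)"
    and [measurable]: "f \<in> borel_measurable M" "g \<in> borel_measurable M"
  shows "integrable M (\<lambda>x. f x * g x)"
proof (rule Bochner_Integration.integrable_bound)
  show "integrable M (\<lambda>x. (f x)\<^sup>2 + (g x)\<^sup>2)" using assms by simp
  show "AE x in M. norm (f x * g x) \<le> norm ((f x)\<^sup>2 + (g x)\<^sup>2)"
  proof (intro AE_I2)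
    fix x
    have "2 * \<bar>f x\<bar> * \<bar>g x\<bar> \<le> \<bar>f x\<bar>\<^sup>2 + \<bar>g x\<bar>\<^sup>2" by (rule sum_squares_bound)
    moreover have "0 \<le> \<bar>f x\<bar> * \<bar>g x\<bar>" by (intro mult_nonneg_nonneg) auto
    ultimately have "\<bar>f x\<bar> * \<bar>g x\<bar> \<le> (f x)\<^sup>2 + (g x)\<^sup>2"
      unfolding power2_abs mult.assoc by linarith
    then show "norm (f x * g x) \<le> norm ((f x)\<^sup>2 + (g x)\<^sup>2)" by (simp add: abs_mult)
  qed
qed simp

definition cL2 :: "(real \<Rightarrow> real) set" where
  "cL2 = {f. continuous_on UNIV f \<and> integrable lborel (\<lambda>x. (f x)\<^sup>2)}"

lemma cL2_measurable: "f \<in> cL2 \<Longrightarrow> f \<in> borel_measurable lborel"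
  by (auto simp: cL2_def intro: borel_measurable_continuous_onI)

lemma cL2_mult: "f \<in> cL2 \<Longrightarrow> g \<in> cL2 \<Longrightarrow> integrable lborel (\<lambda>x. f x * g x)"
  unfolding cL2_def
  by (rule integrable_mult_of_squares) (auto intro: borel_measurable_continuous_onI)

lemma cL2_add: assumes f: "f \<in> cL2" and g: "g \<in> cL2" shows "(\<lambda>x. f x + g x) \<in> cL2"
proof -
  have "integrable lborel (\<lambda>x. (f x)\<^sup>2 + (g x)\<^sup>2 + 2 * (f x * g x))"
    using cL2_mult[OF f g] f g by (auto simp: cL2_def)
  then show ?thesis using f g
    by (auto simp: cL2_def power2_sum mult.assoc intro: continuous_intros)
qed

lemma cL2_scale: "f \<in> cL2 \<Longrightarrow> (\<lambda>x. c * f x) \<in> cL2"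
  by (auto simp: cL2_def power_mult_distrib intro: continuous_intros)

lemma cL2_zero: "(\<lambda>x. 0) \<in> cL2" by (simp add: cL2_def)

lemma cL2_minus: "f \<in> cL2 \<Longrightarrow> (\<lambda>x. - f x) \<in> cL2"
  using cL2_scale[of f "-1"] by simp

lemma cL2_diff: "f \<in> cL2 \<Longrightarrow> g \<in> cL2 \<Longrightarrow> (\<lambda>x. f x - g x) \<in> cL2"
  using cL2_add[OF _ cL2_minus, of f g] by simp

lemma cL2_bound:
  assumes f: "f \<in> cL2" and c: "continuous_on UNIV g" and b: "\<And>x. \<bar>g x\<bar> \<le> C * \<bar>f x\<bar>"
  shows "g \<in> cL2"
proof -
  have gm: "g \<in> borel_measurable lborel" using c borel_measurable_continuous_onI by auto
  have "integrable lborel (\<lambda>x. (C * f x)\<^sup>2)" using cL2_scale[OF f] by (simp add: cL2_def)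
  then have "integrable lborel (\<lambda>x. (g x)\<^sup>2)"
  proof (rule Bochner_Integration.integrable_bound)
    show "AE x in lborel. norm ((g x)\<^sup>2) \<le> norm ((C * f x)\<^sup>2)"
    proof (intro AE_I2)
      fix x
      have "\<bar>g x\<bar> \<le> \<bar>C * f x\<bar>" using order_trans[OF b[of x] mult_right_mono[OF abs_ge_self[of C]]]
        by (simp add: abs_mult)
      then show "norm ((g x)\<^sup>2) \<le> norm ((C * f x)\<^sup>2)" by (simp add: abs_le_square_iff)
    qed
  qed (use gm in measurable)
  then show ?thesis using c by (simp add: cL2_def)
qed

lemma continuous_square_integral_0:
  fixes f :: "real \<Rightarrow> real"
  assumes c: "continuous_on UNIV f" and i: "integrable lborel (\<lambda>x. (f x)\<^sup>2)"
    and z: "(LINT x|lborel. (f x)\<^sup>2) = 0"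
  shows "f x = 0"
proof -
  have "AE x in lborel. (f x)\<^sup>2 = 0"
    using z i by (subst (asm) integral_nonneg_eq_0_iff_AE) auto
  then have "AE x in lborel. x \<notin> {x. f x \<noteq> 0}" by (auto elim: eventually_mono)
  then have "AE x in lebesgue. x \<notin> {x. f x \<noteq> 0}" by (rule AE_completion)
  moreover have op: "open {x. f x \<noteq> 0}"
    using c by (auto intro!: open_Collect_neq continuous_intros)
  ultimately have "{x. f x \<noteq> 0} \<in> null_sets lebesgue"
    by (subst AE_iff_null_sets) (auto intro!: sets_completionI_sets)
  then have "negligible {x. f x \<noteq> 0}" by (simp add: negligible_iff_null_sets)
  then have "{x. f x \<noteq> 0} = {}" using open_not_negligible[OF op] by auto
  then show ?thesis by auto
qed

text \<open>A dense subspace of \<open>L\<^sup>2\<close> whose elements have pointwise values: norms vanish only for the zero function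
without passing to equivalence classes, and the derivative is the classical one. The space is not complete;
completeness is replaced by explicit solution formulas.\<close>

typedef l2fun = cL2 morphisms app L2fun
  using cL2_zero by auto

setup_lifting type_definition_l2fun

lemma app_cL2[simp]: "app f \<in> cL2" by (rule app)

lemma continuous_app: "continuous_on UNIV (app f)" using app_cL2[of f] by (auto simp: cL2_def)

lemma measurable_app[measurable]: "app f \<in> borel_measurable borel"
  using cL2_measurable[OF app_cL2] by simp

lemma integrable_app: "integrable lborel (\<lambda>x. app f x * app g x)"
  by (simp add: cL2_mult)

instantiation l2fun :: real_inner
begin

lift_definition zero_l2fun :: l2fun is "\<lambda>x. 0" by (rule cL2_zero)
lift_definition plus_l2fun :: "l2fun \<Rightarrow> l2fun \<Rightarrow> l2fun" is "\<lambda>f g x. f x + g x" by (rule cL2_add)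
lift_definition minus_l2fun :: "l2fun \<Rightarrow> l2fun \<Rightarrow> l2fun" is "\<lambda>f g x. f x - g x" by (rule cL2_diff)
lift_definition uminus_l2fun :: "l2fun \<Rightarrow> l2fun" is "\<lambda>f x. - f x" by (rule cL2_minus)
lift_definition scaleR_l2fun :: "real \<Rightarrow> l2fun \<Rightarrow> l2fun" is "\<lambda>c f x. c * f x" by (rule cL2_scale)
definition inner_l2fun :: "l2fun \<Rightarrow> l2fun \<Rightarrow> real" where
  "inner_l2fun f g = (LINT x|lborel. app f x * app g x)"
definition norm_l2fun :: "l2fun \<Rightarrow> real" where "norm_l2fun f = sqrt (inner f f)"
definition dist_l2fun :: "l2fun \<Rightarrow> l2fun \<Rightarrow> real" where "dist_l2fun f g = norm (f - g)"
definition sgn_l2fun :: "l2fun \<Rightarrow> l2fun" where "sgn_l2fun f = inverse (norm f) *\<^sub>R f"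
definition uniformity_l2fun :: "(l2fun \<times> l2fun) filter" where
  "uniformity_l2fun = (INF e\<in>{0<..}. principal {(x, y). dist x y < e})"
definition open_l2fun :: "l2fun set \<Rightarrow> bool" where
  "open_l2fun S = (\<forall>x\<in>S. \<forall>\<^sub>F (x', y) in uniformity. x' = x \<longrightarrow> y \<in> S)"

instance
proof
  fix f g h :: l2fun and a b :: real
  show "f + g + h = f + (g + h)" by transfer (simp add: add.assoc)
  show "f + g = g + f" by transfer (simp add: add.commute)
  show "0 + f = f" by transfer simp
  show "- f + f = 0" by transfer simp
  show "f - g = f + - g" by transfer simp
  show "a *\<^sub>R (f + g) = a *\<^sub>R f + a *\<^sub>R g" by transfer (simp add: algebra_simps)
  show "(a + b) *\<^sub>R f = a *\<^sub>R f + b *\<^sub>R f" by transfer (simp add: algebra_simps)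
  show "a *\<^sub>R b *\<^sub>R f = (a * b) *\<^sub>R f" by transfer (simp add: algebra_simps)
  show "1 *\<^sub>R f = f" by transfer simp
  show "dist f g = norm (f - g)" by (simp add: dist_l2fun_def)
  show "sgn f = inverse (norm f) *\<^sub>R f" by (simp add: sgn_l2fun_def)
  show "(uniformity :: (l2fun \<times> l2fun) filter) = (INF e\<in>{0<..}. principal {(x, y). dist x y < e})"
    by (simp add: uniformity_l2fun_def)
  show "open U = (\<forall>x\<in>U. \<forall>\<^sub>F (x', y) in uniformity. x' = x \<longrightarrow> y \<in> U)" for U :: "l2fun set"
    by (simp add: open_l2fun_def)
  show "inner f g = inner g f" by (simp add: inner_l2fun_def mult.commute)
  show "inner (f + g) h = inner f h + inner g h"
    using integrable_app[of f h] integrable_app[of g h]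
    by (simp add: inner_l2fun_def plus_l2fun.rep_eq distrib_right)
  show "inner (a *\<^sub>R f) g = a * inner f g"
    by (simp add: inner_l2fun_def scaleR_l2fun.rep_eq mult.assoc)
  show "0 \<le> inner f f" by (simp add: inner_l2fun_def)
  show "(inner f f = 0) = (f = 0)"
  proof
    assume "inner f f = 0"
    then have "(LINT x|lborel. (app f x)\<^sup>2) = 0" by (simp add: inner_l2fun_def power2_eq_square)
    then have "app f x = 0" for x
      using app_cL2[of f] continuous_square_integral_0 by (auto simp: cL2_def)
    then show "f = 0" by transfer auto
  next
    assume "f = 0"
    then show "inner f f = 0" by (simp add: inner_l2fun_def zero_l2fun.rep_eq)
  qed
  show "norm f = sqrt (inner f f)" by (rule norm_l2fun_def)
qed

end

lemmas app_simps = plus_l2fun.rep_eq minus_l2fun.rep_eq uminus_l2fun.rep_eq scaleR_l2fun.rep_eq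
  zero_l2fun.rep_eq

lemma norm_l2fun_sq: "(norm f)\<^sup>2 = (LINT x|lborel. (app f x)\<^sup>2)"
  by (simp only: power2_norm_eq_inner inner_l2fun_def) (simp add: power2_eq_square)

lemma app_eqI: "(\<And>x. app f x = app g x) \<Longrightarrow> f = g"
  by (simp add: app_inject[symmetric] fun_eq_iff)

definition derives :: "l2fun \<Rightarrow> l2fun \<Rightarrow> bool" where
  "derives f g \<longleftrightarrow> (\<forall>x. (app f has_real_derivative app g x) (at x))"

lemma derives_unique: "derives f g \<Longrightarrow> derives f h \<Longrightarrow> g = h"
  unfolding derives_def by (metis DERIV_unique app_eqI)

lemma derives_add: "derives f f' \<Longrightarrow> derives g g' \<Longrightarrow> derives (f + g) (f' + g')"
  unfolding derives_def by (auto simp: app_simps[abs_def] intro!: derivative_eq_intros)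

lemma derives_diff: "derives f f' \<Longrightarrow> derives g g' \<Longrightarrow> derives (f - g) (f' - g')"
  unfolding derives_def by (auto simp: app_simps[abs_def] intro!: derivative_eq_intros)

lemma derives_scaleR: "derives f f' \<Longrightarrow> derives (c *\<^sub>R f) (c *\<^sub>R f')"
  unfolding derives_def by (auto simp: app_simps[abs_def] intro!: derivative_eq_intros)

text \<open>Integration by parts on the whole line; there are no boundary terms because products of two elements are
integrable.\<close>

lemma inner_derives:
  assumes f: "derives f f'" and g: "derives g g'"
  shows "inner f' g = - inner f g'"
proof -
  have "(LINT x|lborel. app f' x * app g x + app f x * app g' x) = 0"
  proof (rule integral_derivative_eq_0)
    show "((\<lambda>x. app f x * app g x) has_vector_derivative app f' x * app g x + app f x * app g' x) (at x)" for x
      using f g unfolding derives_def has_real_derivative_iff_has_vector_derivative[symmetric]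
      by (auto intro!: derivative_eq_intros)
    show "continuous_on UNIV (\<lambda>x. app f' x * app g x + app f x * app g' x)"
      by (intro continuous_intros continuous_app)
  qed (use integrable_app in auto)
  then show ?thesis
    by (simp add: inner_l2fun_def Bochner_Integration.integral_add[OF integrable_app integrable_app] mult.commute)
qed

text \<open>The one-dimensional Sobolev inequality: \<open>f\<^sup>2\<close> is small somewhere to the right of \<open>x\<close>, and its increment up
to that point is the integral of \<open>2 f f'\<close>.\<close>

lemma sup_bound:
  assumes f: "derives f f'"
  shows "(app f x)\<^sup>2 \<le> 2 * norm f * norm f'"
proof -
  have le: "(app f x)\<^sup>2 - (app f y)\<^sup>2 \<le> 2 * norm f * norm f'" if "x \<le> y" for y
  proof -
    have "(LINT t|lborel. indicator {x..y} t *\<^sub>R (2 * (app f t * app f' t))) = (app f y)\<^sup>2 - (app f x)\<^sup>2"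
    proof (rule integral_FTC_Icc[OF that])
      show "((\<lambda>t. (app f t)\<^sup>2) has_vector_derivative 2 * (app f t * app f' t)) (at t within {x..y})" for t
        unfolding has_real_derivative_iff_has_vector_derivative[symmetric]
        by (rule has_field_derivative_at_within)
          (use f in \<open>auto simp: derives_def intro!: derivative_eq_intros\<close>)
      show "continuous_on {x..y} (\<lambda>t. 2 * (app f t * app f' t))"
        by (rule continuous_on_subset[of UNIV]) (intro continuous_intros continuous_app, auto)
    qed
    then have "(app f x)\<^sup>2 - (app f y)\<^sup>2 = - (LINT t|lborel. indicator {x..y} t * (2 * (app f t * app f' t)))"
      by simp
    also have "\<dots> \<le> (LINT t|lborel. 2 * (\<bar>app f t\<bar> * \<bar>app f' t\<bar>))"
    proof -
      have int: "integrable lborel (\<lambda>t. 2 * (\<bar>app f t\<bar> * \<bar>app f' t\<bar>))"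
        using integrable_abs[OF integrable_app[of f f']] by (simp add: abs_mult)
      have "norm (LINT t|lborel. indicator {x..y} t * (2 * (app f t * app f' t))) \<le> (LINT t|lborel. 2 * (\<bar>app f t\<bar> * \<bar>app f' t\<bar>))"
        by (rule order_trans[OF integral_norm_bound integral_mono_AE'])
          (use int in \<open>auto simp: indicator_def abs_mult\<close>)
      then show ?thesis unfolding real_norm_def by linarith
    qed
    also have "\<dots> \<le> 2 * (norm f * norm f')"
    proof -
      have a: "(\<lambda>x. \<bar>app h x\<bar>) \<in> cL2" for h
        by (rule cL2_bound[OF app_cL2[of h], where C=1]) (auto intro: continuous_intros continuous_app)
      have "(LINT t|lborel. \<bar>app f t\<bar> * \<bar>app f' t\<bar>) = inner (L2fun (\<lambda>x. \<bar>app f x\<bar>)) (L2fun (\<lambda>x. \<bar>app f' x\<bar>))"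
        using a by (simp add: inner_l2fun_def L2fun_inverse)
      also have "\<dots> \<le> norm (L2fun (\<lambda>x. \<bar>app f x\<bar>)) * norm (L2fun (\<lambda>x. \<bar>app f' x\<bar>))"
        by (rule norm_cauchy_schwarz)
      also have "\<dots> = norm f * norm f'"
        using a by (simp add: norm_l2fun_def inner_l2fun_def L2fun_inverse)
      finally show ?thesis by simp
    qed
    finally show ?thesis by simp
  qed
  show ?thesis
  proof (rule field_le_epsilon)
    fix e :: real assume e: "0 < e"
    have "integrable lborel (\<lambda>x. (app f x)\<^sup>2)" using app_cL2[of f] by (simp add: cL2_def)
    from integrable_small_at_top[OF this e, of x] obtain y where y: "y \<ge> x" "(app f y)\<^sup>2 < e" by auto
    show "(app f x)\<^sup>2 \<le> 2 * norm f * norm f' + e" using le[OF y(1)] y(2) by linarith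
  qed
qed

section \<open>The resolvent of the second derivative\<close>

text \<open>Fatou's lemma in the form used below to pass integral bounds to pointwise limits.\<close>

lemma fatou_real:
  fixes f :: "'a \<Rightarrow> real" and g :: "nat \<Rightarrow> 'a \<Rightarrow> real"
  assumes lim: "\<And>x. (\<lambda>n. g n x) \<longlonglongrightarrow> f x" and nn: "\<And>n x. 0 \<le> g n x"
    and int: "\<And>n. integrable M (g n)" and le: "\<And>n. (LINT x|M. g n x) \<le> C n" and C: "C \<longlonglongrightarrow> c"
  shows "integrable M f" "(LINT x|M. f x) \<le> c"
proof -
  have [measurable]: "g n \<in> borel_measurable M" for n using int by auto
  have fm[measurable]: "f \<in> borel_measurable M"
    by (rule borel_measurable_LIMSEQ_real[of _ g]) (use lim in auto)
  have fnn: "0 \<le> f x" for x by (rule LIMSEQ_le_const[OF lim]) (use nn in auto)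
  have Cnn: "0 \<le> C n" for n using order_trans[OF integral_nonneg_AE le[of n]] nn by auto
  have cnn: "0 \<le> c" by (rule LIMSEQ_le_const[OF C]) (use Cnn in auto)
  have "(\<integral>\<^sup>+x. ennreal (f x) \<partial>M) = (\<integral>\<^sup>+x. liminf (\<lambda>n. ennreal (g n x)) \<partial>M)"
  proof (rule nn_integral_cong)
    fix x
    show "ennreal (f x) = liminf (\<lambda>n. ennreal (g n x))"
      using lim_imp_Liminf[OF _ tendsto_ennrealI[OF lim[of x]]] by simp
  qed
  also have "\<dots> \<le> liminf (\<lambda>n. \<integral>\<^sup>+x. ennreal (g n x) \<partial>M)"
    by (rule nn_integral_liminf) simp
  also have "\<dots> \<le> liminf (\<lambda>n. ennreal (C n))"
    using nn_integral_eq_integral[OF int] nn le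
    by (intro Liminf_mono always_eventually) (auto simp: ennreal_leI)
  also have "\<dots> = ennreal c"
    using lim_imp_Liminf[OF _ tendsto_ennrealI[OF C]] by simp
  finally have *: "(\<integral>\<^sup>+x. ennreal (f x) \<partial>M) \<le> ennreal c" .
  show i: "integrable M f"
    by (rule integrableI_nonneg) (use fnn * le_less_trans[OF *] in auto)
  show "(LINT x|M. f x) \<le> c"
    using * nn_integral_eq_integral[OF i] fnn cnn by (simp add: ennreal_le_iff)
qed

lemma integrable_of_bounded_Icc:
  fixes h :: "real \<Rightarrow> real"
  assumes c: "continuous_on UNIV h" and nn: "\<And>x. 0 \<le> h x"
    and le: "\<And>n. (LINT x|lborel. indicator {- real n..real n} x * h x) \<le> C"
  shows "integrable lborel h" "(LINT x|lborel. h x) \<le> C"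
proof -
  have a: "(\<lambda>n. indicator {- real n..real n} x * h x) \<longlonglongrightarrow> h x" for x
  proof (rule tendsto_eventually)
    obtain N :: nat where N: "\<bar>x\<bar> \<le> real N" using real_arch_simple by blast
    show "\<forall>\<^sub>F n in sequentially. indicator {- real n..real n} x * h x = h x"
      by (rule eventually_sequentiallyI[of N]) (use N in \<open>auto simp: indicator_def\<close>)
  qed
  have b: "integrable lborel (\<lambda>x. indicator {- real n..real n} x * h x)" for n
    using borel_integrable_atLeastAtMost'[OF continuous_on_subset[OF c], of "- real n" "real n"]
    by (simp add: set_integrable_def)
  show "integrable lborel h" "(LINT x|lborel. h x) \<le> C"
    by (rule fatou_real[OF a _ b le tendsto_const]; use nn in simp)+
qed

text \<open>The solution is \<open>Q x = \<integral>\<^sub>x\<^sup>\<infinity> exp (m (x - y)) f y dy\<close>. It is bounded by the Cauchy-Schwarz inequality, and it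
is square integrable by the energy identity \<open>(Q\<^sup>2)' = 2 m Q\<^sup>2 - 2 f Q\<close> on growing intervals.\<close>

lemma decaying_solution_exists:
  assumes f: "f \<in> cL2" and m: "0 < m"
  shows "\<exists>Q\<in>cL2. \<forall>x. (Q has_real_derivative (m * Q x - f x)) (at x)"
proof -
  have fc: "continuous_on UNIV f" and f2: "integrable lborel (\<lambda>x. (f x)\<^sup>2)"
    using f by (auto simp: cL2_def)
  have fm[measurable]: "f \<in> borel_measurable borel" using cL2_measurable[OF f] by simp
  define h where "h = (\<lambda>y. exp (- m * y) * f y)"
  have hc: "continuous_on UNIV h" unfolding h_def by (intro continuous_intros fc)
  have "\<exists>H. \<forall>x. (H has_vector_derivative h x) (at x)"
    using einterval_antiderivative[of "-\<infinity>" "\<infinity>" h] hc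
    by (auto simp: continuous_on_eq_continuous_at)
  then obtain H where H: "\<And>x. (H has_vector_derivative h x) (at x)" by blast
  have exp_int: "integrable lborel (\<lambda>y. indicator {x..} y * exp (2 * m * (x - y)))"
    "(LINT y|lborel. indicator {x..} y * exp (2 * m * (x - y))) = 1 / (2 * m)" for x
  proof -
    have "(\<integral>\<^sup>+y. ennreal (exp (2 * m * (x - y))) * indicator {x..} y \<partial>lborel)
        = ennreal (0 - (- exp (2 * m * (x - x)) / (2 * m)))"
    proof (rule nn_integral_FTC_atLeast[where F = "\<lambda>y. - exp (2 * m * (x - y)) / (2 * m)"])
      show "((\<lambda>y. - exp (2 * m * (x - y)) / (2 * m)) has_real_derivative exp (2 * m * (x - y))) (at y)" for y
        using m by (auto intro!: derivative_eq_intros simp: field_simps)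
      show "((\<lambda>y. - exp (2 * m * (x - y)) / (2 * m)) \<longlongrightarrow> 0) at_top"
        using m by real_asymp
    qed auto
    then have *: "(\<integral>\<^sup>+y. ennreal (indicator {x..} y * exp (2 * m * (x - y))) \<partial>lborel) = ennreal (1 / (2 * m))"
      by (simp add: ennreal_mult' ennreal_indicator mult.commute)
    show i: "integrable lborel (\<lambda>y. indicator {x..} y * exp (2 * m * (x - y)))"
      by (rule integrableI_nonneg) (auto simp: *)
    show "(LINT y|lborel. indicator {x..} y * exp (2 * m * (x - y))) = 1 / (2 * m)"
      using * nn_integral_eq_integral[OF i] m by simp
  qed
  have bd: "\<bar>indicator {x..} y * (exp (m * (x - y)) * f y)\<bar>
      \<le> (indicator {x..} y * exp (2 * m * (x - y)) + (f y)\<^sup>2) / 2" for x y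
  proof -
    have "2 * exp (m * (x - y)) * \<bar>f y\<bar> \<le> (exp (m * (x - y)))\<^sup>2 + \<bar>f y\<bar>\<^sup>2"
      by (rule sum_squares_bound)
    moreover have "(exp (m * (x - y)))\<^sup>2 = exp (2 * m * (x - y))"
      by (simp add: power2_eq_square exp_add[symmetric] algebra_simps)
    ultimately show ?thesis by (auto simp: indicator_def abs_mult)
  qed
  have int1: "integrable lborel (\<lambda>y. indicator {x..} y * (exp (m * (x - y)) * f y))" for x
    by (rule Bochner_Integration.integrable_bound[of _ "\<lambda>y. (indicator {x..} y * exp (2 * m * (x - y)) + (f y)\<^sup>2) / 2"])
      (use bd exp_int(1) f2 in \<open>auto intro: order_trans[OF bd abs_ge_self]\<close>)
  \<comment> \<open>The kernel depends on \<open>x\<close>; factoring out \<open>exp (m x)\<close> leaves the tail integral \<open>B\<close> of the fixed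
    function \<open>h\<close>, which is differentiated by means of an antiderivative \<open>H\<close> of \<open>h\<close>.\<close>
  define Q where "Q = (\<lambda>x. LINT y|lborel. indicator {x..} y * (exp (m * (x - y)) * f y))"
  define M where "M = (1 / (2 * m) + (LINT y|lborel. (f y)\<^sup>2)) / 2"
  have Qb: "\<bar>Q x\<bar> \<le> M" for x
  proof -
    have "norm (Q x) \<le> (LINT y|lborel. (indicator {x..} y * exp (2 * m * (x - y)) + (f y)\<^sup>2) / 2)"
      unfolding Q_def
      by (rule order_trans[OF integral_norm_bound integral_mono_AE'])
        (use bd exp_int(1) f2 in auto)
    also have "\<dots> = M" unfolding M_def using exp_int f2 by simp
    finally show ?thesis by simp
  qed
  have ex: "exp (- m * x) * exp (m * (x - y)) = exp (- m * y)"
    "exp (m * x) * exp (- m * y) = exp (m * (x - y))" for x y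
    by (simp_all add: exp_add[symmetric] algebra_simps)
  have int2: "integrable lborel (\<lambda>y. indicator {x..} y * h y)" for x
  proof -
    have "(\<lambda>y. indicator {x..} y * h y) = (\<lambda>y. exp (- m * x) * (indicator {x..} y * (exp (m * (x - y)) * f y)))"
      unfolding h_def by (rule ext) (metis (no_types) ex(1) mult.assoc mult.left_commute)
    then show ?thesis using int1 by simp
  qed
  define B where "B = (\<lambda>x. LINT y|lborel. indicator {x..} y * h y)"
  have QB: "Q x = exp (m * x) * B x" for x
    unfolding Q_def B_def integral_mult_right_zero[symmetric]
    unfolding h_def
    by (rule Bochner_Integration.integral_cong) (auto, metis (no_types) ex(2) mult.assoc mult.left_commute mult_minus_left)
  have Blim: "(\<lambda>n. H (real n) - H x) \<longlonglongrightarrow> B x" for x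
  proof -
    have "(\<lambda>n. LINT y|lborel. indicator {x..real n} y * h y) \<longlonglongrightarrow> B x"
      unfolding B_def
    proof (rule integral_dominated_convergence[where w = "\<lambda>y. \<bar>indicator {x..} y * h y\<bar>"])
      show "AE y in lborel. (\<lambda>n. indicator {x..real n} y * h y) \<longlonglongrightarrow> indicator {x..} y * h y"
      proof (intro AE_I2 tendsto_eventually)
        fix y :: real
        obtain N :: nat where N: "\<bar>y\<bar> \<le> real N" using real_arch_simple by blast
        show "\<forall>\<^sub>F n in sequentially. indicator {x..real n} y * h y = indicator {x..} y * h y"
          by (rule eventually_sequentiallyI[of N]) (use N in \<open>auto simp: indicator_def\<close>)
      qed
    next
      show "integrable lborel (\<lambda>y. \<bar>indicator {x..} y * h y\<bar>)" using int2[of x] by simp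
      show "(\<lambda>y. indicator {x..real n} y * h y) \<in> borel_measurable lborel" for n
        using borel_measurable_continuous_onI[OF hc] by measurable
      show "(\<lambda>y. indicator {x..} y * h y) \<in> borel_measurable lborel"
        using borel_measurable_continuous_onI[OF hc] by measurable
      show "AE y in lborel. norm (indicator {x..real n} y * h y) \<le> \<bar>indicator {x..} y * h y\<bar>" for n
        by (auto simp: indicator_def)
    qed
    moreover have "\<forall>\<^sub>F n in sequentially. (LINT y|lborel. indicator {x..real n} y * h y) = H (real n) - H x"
    proof -
      obtain N :: nat where N: "x \<le> real N" using real_arch_simple by blast
      show ?thesis
      proof (rule eventually_sequentiallyI[of N])
        fix n assume "N \<le> n"
        then have "x \<le> real n" using N by linarith
        from integral_FTC_Icc[OF this, of H h] show "(LINT y|lborel. indicator {x..real n} y * h y) = H (real n) - H x"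
          using H hc by (auto intro: has_vector_derivative_at_within continuous_on_subset)
      qed
    qed
    ultimately show ?thesis using tendsto_cong by fastforce
  qed
  have "B x = B 0 + H 0 - H x" for x
  proof -
    have "(\<lambda>n. (H (real n) - H x) - (H (real n) - H 0)) \<longlonglongrightarrow> B x - B 0"
      by (intro tendsto_diff Blim)
    then show ?thesis using LIMSEQ_unique[OF _ tendsto_const] by fastforce
  qed
  then have Beq: "B = (\<lambda>x. B 0 + H 0 - H x)" by (rule ext)
  have "((\<lambda>x. B 0 + H 0 - H x) has_real_derivative - h x) (at x)" for x
    using H[of x, folded has_real_derivative_iff_has_vector_derivative]
    by (auto intro!: derivative_eq_intros)
  then have Bd: "(B has_real_derivative - h x) (at x)" for x
    by (subst Beq)
  have Qd: "(Q has_real_derivative (m * Q x - f x)) (at x)" for x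
  proof -
    have "((\<lambda>x. exp (m * x) * B x) has_real_derivative (m * exp (m * x) * B x + exp (m * x) * (- h x))) (at x)"
      by (auto intro!: derivative_eq_intros Bd)
    moreover have "exp (m * x) * h x = f x" unfolding h_def by (simp add: exp_minus field_simps)
    ultimately show ?thesis unfolding QB[abs_def] by (simp add: QB mult.assoc)
  qed
  have Qc: "continuous_on UNIV Q"
    using Qd by (auto intro!: continuous_at_imp_continuous_on DERIV_isCont)
  have "Q \<in> cL2"
  proof -
    have le: "(LINT x|lborel. indicator {- real n..real n} x * (Q x)\<^sup>2)
        \<le> (M\<^sup>2 + (LINT y|lborel. (f y)\<^sup>2) / m) / m" for n
    proof -
      have ic: "integrable lborel (\<lambda>x. indicator {- real n..real n} x * g x)" if "continuous_on UNIV g" for g :: "real \<Rightarrow> real"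
        using borel_integrable_atLeastAtMost'[OF continuous_on_subset[OF that], of "- real n" "real n"]
        by (simp add: set_integrable_def)
      define q where "q = (\<lambda>x. 2 * Q x * (m * Q x - f x))"
      have qc: "continuous_on UNIV q" unfolding q_def by (intro continuous_intros Qc fc)
      have "(LINT x|lborel. indicator {- real n..real n} x *\<^sub>R q x) = (Q n)\<^sup>2 - (Q (- real n))\<^sup>2"
      proof (rule integral_FTC_Icc)
        show "((\<lambda>x. (Q x)\<^sup>2) has_vector_derivative q x) (at x within {- real n..real n})" for x
          unfolding has_real_derivative_iff_has_vector_derivative[symmetric] q_def
          by (rule has_field_derivative_at_within) (auto intro!: derivative_eq_intros Qd)
      qed (use qc continuous_on_subset in auto)
      also have "\<dots> \<le> (Q n)\<^sup>2" by simp
      also have "\<dots> \<le> M\<^sup>2" using Qb[of n] by (simp add: abs_le_square_iff[symmetric])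
      finally have q1: "(LINT x|lborel. indicator {- real n..real n} x * q x) \<le> M\<^sup>2" by simp
      have "(LINT x|lborel. indicator {- real n..real n} x * (m * (Q x)\<^sup>2))
          \<le> (LINT x|lborel. indicator {- real n..real n} x * q x + (f x)\<^sup>2 / m)"
      proof (rule integral_mono)
        show "integrable lborel (\<lambda>x. indicator {- real n..real n} x * (m * (Q x)\<^sup>2))"
          by (rule ic) (intro continuous_intros Qc)
        show "integrable lborel (\<lambda>x. indicator {- real n..real n} x * q x + (f x)\<^sup>2 / m)"
          using ic[OF qc] f2 by simp
        show "indicator {- real n..real n} x * (m * (Q x)\<^sup>2)
          \<le> indicator {- real n..real n} x * q x + (f x)\<^sup>2 / m" for x
        proof -
          have "0 \<le> (m * Q x - f x)\<^sup>2 / m" using m by simp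
          also have "(m * Q x - f x)\<^sup>2 = m * (m * (Q x)\<^sup>2 - 2 * Q x * f x) + (f x)\<^sup>2"
            by algebra
          also have "\<dots> / m = m * (Q x)\<^sup>2 - 2 * Q x * f x + (f x)\<^sup>2 / m"
            using m by (simp add: add_divide_distrib)
          finally have "m * (Q x)\<^sup>2 \<le> q x + (f x)\<^sup>2 / m"
            unfolding q_def by (simp add: algebra_simps power2_eq_square)
          then show ?thesis using m by (auto simp: indicator_def)
        qed
      qed
      also have "\<dots> = (LINT x|lborel. indicator {- real n..real n} x * q x) + (LINT y|lborel. (f y)\<^sup>2) / m"
        using ic[OF qc] f2 by simp
      also have "\<dots> \<le> M\<^sup>2 + (LINT y|lborel. (f y)\<^sup>2) / m" using q1 by simp
      finally have "m * (LINT x|lborel. indicator {- real n..real n} x * (Q x)\<^sup>2) \<le> M\<^sup>2 + (LINT y|lborel. (f y)\<^sup>2) / m"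
        by (simp only: mult.left_commute[of _ m "_\<^sup>2"] integral_mult_right_zero)
      then show ?thesis using m by (simp add: field_simps)
    qed
    then show ?thesis
      using integrable_of_bounded_Icc(1)[OF continuous_on_power[OF Qc] _ le] Qc
      by (simp add: cL2_def)
  qed
  then show ?thesis using Qd by blast
qed

lemma cL2_reflect: "f \<in> cL2 \<Longrightarrow> (\<lambda>x. f (- x)) \<in> cL2"
  using lborel_integrable_real_affine[of "\<lambda>x. (f x)\<^sup>2" "-1" 0]
  by (auto simp: cL2_def intro!: continuous_on_compose2[of UNIV f] continuous_intros)

text \<open>The equation \<open>w - s w'' = f\<close> factors into first-order equations: with \<open>m = 1 / sqrt s\<close>, a half of \<open>m\<close> times
the sum of the solutions of \<open>Q' = m Q - f\<close> and of its mirror image \<open>P' = f - m P\<close> solves it.\<close>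

lemma resolvent_exists:
  assumes s: "0 < s"
  shows "\<exists>w w'. derives w w' \<and> derives w' ((1/s) *\<^sub>R (w - f))"
proof -
  define m where "m = 1 / sqrt s"
  have m: "m > 0" "m\<^sup>2 = 1 / s" using s by (auto simp: m_def power_divide)
  obtain Q where Q: "Q \<in> cL2" "\<And>x. (Q has_real_derivative (m * Q x - app f x)) (at x)"
    using decaying_solution_exists[OF app_cL2 m(1)] by blast
  obtain R where R: "R \<in> cL2" "\<And>x. (R has_real_derivative (m * R x - app f (- x))) (at x)"
    using decaying_solution_exists[OF cL2_reflect[OF app_cL2] m(1)] by blast
  have P: "(\<lambda>x. R (- x)) \<in> cL2" by (rule cL2_reflect[OF R(1)])
  have Pd: "((\<lambda>x. R (- x)) has_real_derivative (app f x - m * R (- x))) (at x)" for x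
  proof -
    have "((\<lambda>x. R (- x)) has_real_derivative (m * R (- x) - app f (- (- x))) * -1) (at x)"
      by (rule DERIV_chain2[where f = R and g = uminus]) (rule R(2), auto intro!: derivative_eq_intros)
    then show ?thesis by simp
  qed
  define w where "w = L2fun (\<lambda>x. m / 2 * (R (- x) + Q x))"
  define w' where "w' = L2fun (\<lambda>x. m\<^sup>2 / 2 * (Q x - R (- x)))"
  have w: "app w = (\<lambda>x. m / 2 * (R (- x) + Q x))"
    unfolding w_def by (rule L2fun_inverse) (intro cL2_scale cL2_add P Q)
  have w': "app w' = (\<lambda>x. m\<^sup>2 / 2 * (Q x - R (- x)))"
    unfolding w'_def by (rule L2fun_inverse) (intro cL2_scale cL2_diff P Q)
  have "derives w w'"
    unfolding derives_def w w'
    by (auto intro!: derivative_eq_intros Pd Q simp: field_simps power2_eq_square)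
  moreover have "derives w' ((1/s) *\<^sub>R (w - f))"
    unfolding derives_def w w' app_simps m(2)[symmetric]
    by (auto intro!: derivative_eq_intros Pd Q simp: field_simps power2_eq_square)
  ultimately show ?thesis by blast
qed

text \<open>The resolvent \<open>(1 - s \<partial>\<^sub>x\<^sup>2)\<^sup>-\<^sup>1\<close>, with Fourier multiplier \<open>1 / (1 + s \<xi>\<^sup>2)\<close>, and its derivative. The
equation is stated through two first-order relations, since the second derivative is determined by \<open>w\<close>.\<close>

definition res :: "real \<Rightarrow> l2fun \<Rightarrow> l2fun" where
  "res s f = (SOME w. \<exists>w'. derives w w' \<and> derives w' ((1/s) *\<^sub>R (w - f)))"

definition dres :: "real \<Rightarrow> l2fun \<Rightarrow> l2fun" where
  "dres s f = (SOME w'. derives (res s f) w')"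

lemma derives_res: assumes "0 < s"
  shows "derives (res s f) (dres s f)" "derives (dres s f) ((1/s) *\<^sub>R (res s f - f))"
proof -
  have "\<exists>w'. derives (res s f) w' \<and> derives w' ((1/s) *\<^sub>R (res s f - f))"
    unfolding res_def by (rule someI_ex) (rule resolvent_exists[OF assms])
  then obtain w' where w': "derives (res s f) w'" "derives w' ((1/s) *\<^sub>R (res s f - f))" by blast
  have "derives (res s f) (dres s f)" unfolding dres_def using w'(1) by (rule someI)
  moreover from this w' have "dres s f = w'" by (auto intro: derives_unique)
  ultimately show "derives (res s f) (dres s f)" "derives (dres s f) ((1/s) *\<^sub>R (res s f - f))"
    using w' by auto
qed

text \<open>The difference \<open>d\<close> of two solutions satisfies \<open>s d'' = d\<close>, and pairing this with \<open>d\<close> makes \<open>d\<close> and \<open>d'\<close> vanish.\<close>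

lemma res_unique:
  assumes s: "0 < s" and w: "derives w w'" "derives w' ((1/s) *\<^sub>R (w - f))"
  shows "res s f = w" "dres s f = w'"
proof -
  let ?d = "res s f - w" and ?d' = "dres s f - w'"
  have d: "derives ?d ?d'" by (intro derives_diff derives_res w s)
  have d': "derives ?d' ((1/s) *\<^sub>R ?d)"
    using derives_diff[OF derives_res(2)[OF s, of f] w(2)] by (simp add: algebra_simps)
  have "inner ?d' ?d' = - inner ?d ((1/s) *\<^sub>R ?d)" by (rule inner_derives[OF d d'])
  then have "inner ?d' ?d' = - (1/s) * inner ?d ?d" by simp
  moreover have "0 \<le> (1/s) * inner ?d ?d" using s by simp
  moreover have "0 \<le> inner ?d' ?d'" by simp
  ultimately have "(1/s) * inner ?d ?d = 0" "inner ?d' ?d' = 0" by linarith+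
  then show "res s f = w" "dres s f = w'" using s by auto
qed

lemma res_add: assumes s: "0 < s"
  shows "res s (f + g) = res s f + res s g" "dres s (f + g) = dres s f + dres s g"
proof -
  have a: "derives (res s f + res s g) (dres s f + dres s g)"
    by (intro derives_add derives_res s)
  have "derives (dres s f + dres s g) ((1/s) *\<^sub>R ((res s f + res s g) - (f + g)))"
    using derives_add[OF derives_res(2)[OF s, of f] derives_res(2)[OF s, of g]] by (simp add: algebra_simps)
  from res_unique[OF s a this]
  show "res s (f + g) = res s f + res s g" "dres s (f + g) = dres s f + dres s g" .
qed

lemma res_scaleR: assumes s: "0 < s"
  shows "res s (c *\<^sub>R f) = c *\<^sub>R res s f" "dres s (c *\<^sub>R f) = c *\<^sub>R dres s f"
proof -
  have a: "derives (c *\<^sub>R res s f) (c *\<^sub>R dres s f)"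
    by (intro derives_scaleR derives_res s)
  have "derives (c *\<^sub>R dres s f) ((1/s) *\<^sub>R (c *\<^sub>R res s f - c *\<^sub>R f))"
    using derives_scaleR[OF derives_res(2)[OF s, of f], of c] by (simp add: algebra_simps)
  from res_unique[OF s a this]
  show "res s (c *\<^sub>R f) = c *\<^sub>R res s f" "dres s (c *\<^sub>R f) = c *\<^sub>R dres s f" .
qed

lemma res_deriv: assumes s: "0 < s" and f: "derives f f'"
  shows "res s f' = dres s f"
  by (rule res_unique(1)[OF s derives_res(2)[OF s]])
    (rule derives_scaleR[OF derives_diff[OF derives_res(1)[OF s] f]])

lemma inner_res: assumes s: "0 < s"
  shows "inner (res s f) g = inner (res s f) (res s g) + s * inner (dres s f) (dres s g)"
proof -
  have "inner (dres s f) (dres s g) = - inner (res s f) ((1/s) *\<^sub>R (res s g - g))"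
    by (rule inner_derives) (intro derives_res s)+
  then show ?thesis using s by (simp add: inner_diff_right field_simps)
qed

lemma inner_res_commute: "0 < s \<Longrightarrow> inner (res s f) g = inner f (res s g)"
  using inner_res[of s f g] inner_res[of s g f] by (simp add: inner_commute)

lemma inner_dres: assumes s: "0 < s" shows "inner (dres s f) g = - inner f (dres s g)"
proof -
  have 1: "inner (dres s f) (res s g) = - inner (res s f) (dres s g)"
    by (rule inner_derives) (intro derives_res s)+
  have 2: "inner ((1/s) *\<^sub>R (res s f - f)) (dres s g) = - inner (dres s f) ((1/s) *\<^sub>R (res s g - g))"
    by (rule inner_derives) (intro derives_res s)+
  from 2 have "inner (res s f) (dres s g) - inner f (dres s g) = - inner (dres s f) (res s g) + inner (dres s f) g"
    using s by (simp add: inner_diff_left inner_diff_right divide_simps)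
  then show ?thesis using 1 by simp
qed

text \<open>Expand the square of the norm of \<open>f = w - s w''\<close> for \<open>w = res s f\<close> and integrate the mixed term by parts.\<close>

lemma res_energy: assumes s: "0 < s"
  shows "(norm f)\<^sup>2 = (norm (res s f))\<^sup>2 + 2 * s * (norm (dres s f))\<^sup>2 + (norm (res s f - f))\<^sup>2"
proof -
  have "inner (dres s f) (dres s f) = - inner (res s f) ((1/s) *\<^sub>R (res s f - f))"
    by (rule inner_derives) (intro derives_res s)+
  then have "s * inner (dres s f) (dres s f) = - inner (res s f) (res s f - f)"
    using s by simp
  then show ?thesis
    unfolding power2_norm_eq_inner by (simp add: inner_diff_left inner_diff_right inner_commute)
qed

lemma norm_res_le: assumes s: "0 < s"
  shows "norm (res s f) \<le> norm f" "norm (res s f - f) \<le> norm f" "2 * s * (norm (dres s f))\<^sup>2 \<le> (norm f)\<^sup>2"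
proof -
  have nn: "0 \<le> 2 * s * (norm (dres s f))\<^sup>2" using s by simp
  show "2 * s * (norm (dres s f))\<^sup>2 \<le> (norm f)\<^sup>2" using res_energy[OF s, of f] by simp
  have "(norm (res s f))\<^sup>2 \<le> (norm f)\<^sup>2" "(norm (res s f - f))\<^sup>2 \<le> (norm f)\<^sup>2"
    using res_energy[OF s, of f] nn zero_le_power2[of "norm (res s f)"] zero_le_power2[of "norm (res s f - f)"]
    by linarith+
  then show "norm (res s f) \<le> norm f" "norm (res s f - f) \<le> norm f"
    by (auto intro: power2_le_imp_le)
qed

lemma norm_dres_le: "norm (dres 1 f) \<le> norm f"
proof (rule power2_le_imp_le)
  have "2 * (norm (dres 1 f))\<^sup>2 \<le> (norm f)\<^sup>2" using norm_res_le(3)[of 1 f] by simp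
  then show "(norm (dres 1 f))\<^sup>2 \<le> (norm f)\<^sup>2" using zero_le_power2[of "norm (dres 1 f)"] by linarith
qed simp

text \<open>The candidate \<open>r\<close> for \<open>res s f\<close> is \<open>(1 - \<partial>\<^sub>x\<^sup>2)\<close> applied to \<open>res s (res 1 f)\<close>, written without second
derivatives.\<close>

lemma res_commute: assumes s: "0 < s" shows "res s (res 1 f) = res 1 (res s f)"
proof -
  let ?w = "res 1 f" let ?p = "res s ?w"
  define r where "r = ?p - (1/s) *\<^sub>R (?p - ?w)"
  have w: "derives ?w (dres 1 f)" "derives (dres 1 f) (?w - f)"
    using derives_res[of 1 f] by auto
  have p: "derives ?p (dres s ?w)" "derives (dres s ?w) ((1/s) *\<^sub>R (?p - ?w))"
    using derives_res[OF s, of ?w] by auto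
  have "res s f = r"
  proof (rule res_unique(1)[OF s])
    show "derives r (dres s ?w - (1/s) *\<^sub>R (dres s ?w - dres 1 f))"
      unfolding r_def by (intro derives_diff derives_scaleR p w)
    have "derives (dres s ?w - (1/s) *\<^sub>R (dres s ?w - dres 1 f))
      ((1/s) *\<^sub>R (?p - ?w) - (1/s) *\<^sub>R ((1/s) *\<^sub>R (?p - ?w) - (?w - f)))"
      by (intro derives_diff derives_scaleR p w)
    also have "((1/s) *\<^sub>R (?p - ?w) - (1/s) *\<^sub>R ((1/s) *\<^sub>R (?p - ?w) - (?w - f))) = (1/s) *\<^sub>R (r - f)"
      unfolding r_def by (simp add: algebra_simps)
    finally show "derives (dres s ?w - (1/s) *\<^sub>R (dres s ?w - dres 1 f)) ((1/s) *\<^sub>R (r - f))" .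
  qed
  moreover have "res 1 r = ?p"
    by (rule res_unique(1)[OF _ p(1)]) (use p(2) in \<open>auto simp: r_def\<close>)
  ultimately show ?thesis by simp
qed

text \<open>On the Fourier side, the three terms dominate the frequencies below \<open>1 / sqrt s\<close>, those between
\<open>1 / sqrt s\<close> and \<open>sqrt s\<close>, and those above \<open>sqrt s\<close>. The proof uses \<open>res_energy\<close> with parameter \<open>1\<close> for
\<open>f\<close>, and then with parameter \<open>s\<close> for \<open>res 1 f\<close>; the high frequencies appear as \<open>res 1 f - f\<close>, the second
derivative of \<open>res 1 f\<close>.\<close>

lemma interpolation:
  assumes s: "1 \<le> s" and f: "derives f f'"
  shows "(norm f)\<^sup>2 \<le> 6 * ((norm (res s f))\<^sup>2 + s * (norm (dres 1 f))\<^sup>2 + (norm f')\<^sup>2 / s)"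
proof -
  have s0: "0 < s" using s by simp
  let ?w = "res 1 f" and ?w' = "dres 1 f"
  have w: "derives ?w ?w'" "derives ?w' (?w - f)" "derives (?w - f) (?w' - f')"
    using derives_res[of 1 f] derives_diff[OF derives_res(1)[of 1 f] f] by auto
  have n3: "norm (?w' - f') \<le> norm f'"
    using norm_res_le(2)[of 1 f'] res_deriv[OF _ f, of 1] by simp
  have "(norm (?w - f))\<^sup>2 = - inner ?w' (?w' - f')"
    using inner_derives[OF w(2,3)] by (simp add: power2_norm_eq_inner)
  also have "\<dots> \<le> norm ?w' * norm f'"
    using Cauchy_Schwarz_ineq2[of ?w' "?w' - f'"] mult_left_mono[OF n3 norm_ge_zero[of ?w']] by linarith
  also have "\<dots> \<le> (s * (norm ?w')\<^sup>2 + (norm f')\<^sup>2 / s) / 2"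
  proof -
    have "0 \<le> (s * norm ?w' - norm f')\<^sup>2 / s" using s0 by simp
    also have "\<dots> = s * (norm ?w')\<^sup>2 - 2 * (norm ?w' * norm f') + (norm f')\<^sup>2 / s"
      using s0 by (simp add: power2_eq_square field_simps)
    finally show ?thesis by simp
  qed
  finally have e1: "(norm (?w - f))\<^sup>2 \<le> (s * (norm ?w')\<^sup>2 + (norm f')\<^sup>2 / s) / 2" .
  have e2: "(norm f)\<^sup>2 = (norm ?w)\<^sup>2 + 2 * (norm ?w')\<^sup>2 + (norm (?w - f))\<^sup>2"
    using res_energy[of 1 f] by simp
  have e3: "(norm ?w)\<^sup>2 = (norm (res s ?w))\<^sup>2 + 2 * s * (norm (dres s ?w))\<^sup>2 + (norm (res s ?w - ?w))\<^sup>2"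
    by (rule res_energy[OF s0])
  have e4: "norm (res s ?w) \<le> norm (res s f)"
    unfolding res_commute[OF s0] by (rule norm_res_le) simp
  have pw: "dres s ?w = res s ?w'" using res_deriv[OF s0 w(1)] by simp
  have e5: "norm (dres s ?w) \<le> norm ?w'" unfolding pw by (rule norm_res_le(1)[OF s0])
  have "(1/s) *\<^sub>R (res s ?w - ?w) = dres s ?w'"
    using derives_unique[OF derives_res(2)[OF s0, of ?w]] derives_res(1)[OF s0, of ?w'] pw by simp
  then have "res s ?w - ?w = s *\<^sub>R dres s ?w'" using s0 by (metis (no_types) scaleR_scaleR nonzero_mult_div_cancel_left times_divide_eq_right mult_1_right scaleR_one less_numeral_extra(3))
  then have "(norm (res s ?w - ?w))\<^sup>2 = s\<^sup>2 * (norm (dres s ?w'))\<^sup>2" by (simp add: power_mult_distrib)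
  also have "\<dots> = (s / 2) * (2 * s * (norm (dres s ?w'))\<^sup>2)" by (simp add: power2_eq_square)
  also have "\<dots> \<le> (s / 2) * (norm ?w')\<^sup>2"
    by (rule mult_left_mono[OF norm_res_le(3)[OF s0]]) (use s0 in simp)
  finally have e6: "(norm (res s ?w - ?w))\<^sup>2 \<le> (s / 2) * (norm ?w')\<^sup>2" .
  have e7: "(norm (res s ?w))\<^sup>2 \<le> (norm (res s f))\<^sup>2" using e4 by (intro power_mono) auto
  have e8: "s * (norm (dres s ?w))\<^sup>2 \<le> s * (norm ?w')\<^sup>2"
    using e5 s0 by (intro mult_left_mono power_mono) auto
  have e9: "(norm ?w')\<^sup>2 \<le> s * (norm ?w')\<^sup>2" using s mult_right_mono[of 1 s "(norm ?w')\<^sup>2"] by simp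
  have e10: "0 \<le> (norm f')\<^sup>2 / s" "0 \<le> (norm (res s f))\<^sup>2" "0 \<le> (norm ?w')\<^sup>2" using s0 by auto
  have "6 * (A + B + C) \<ge> N" if "X \<le> (B + C) / 2" "N = W + 2 * D + X" "W = P + 2 * E + Y"
    "Y \<le> B / 2" "P \<le> A" "E \<le> B" "D \<le> B" "0 \<le> C" "0 \<le> A" "0 \<le> D" for A B C D E N P W X Y :: real
  proof -
    have "0 \<le> B" using that by linarith
    then show ?thesis using that by simp
  qed
  from this[OF e1 e2 _ _ e7 e8 e9 e10] show ?thesis using e3 e6 by (simp add: mult.assoc)
qed

text \<open>By the Sobolev inequality \<open>res s f\<close> is bounded by a multiple of the square root of the left-hand side \<open>E\<close>,
while \<open>E\<close> itself is the integral of \<open>f\<close> against \<open>res s f\<close>.\<close>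

lemma res_L1:
  assumes s: "0 < s" and F: "integrable lborel (\<lambda>x. \<bar>app f x\<bar>)" "(LINT x|lborel. \<bar>app f x\<bar>) \<le> F"
  shows "(norm (res s f))\<^sup>2 + s * (norm (dres s f))\<^sup>2 \<le> F\<^sup>2 / sqrt s"
proof -
  define E where "E = (norm (res s f))\<^sup>2 + s * (norm (dres s f))\<^sup>2"
  have E0: "0 \<le> E" unfolding E_def using s by simp
  have F0: "0 \<le> F" using order_trans[OF integral_nonneg_AE F(2)] by auto
  have sup: "\<bar>app (res s f) x\<bar> \<le> sqrt (E / sqrt s)" for x
  proof -
    have "0 \<le> (norm (res s f) - sqrt s * norm (dres s f))\<^sup>2" by simp
    also have "\<dots> = E - 2 * sqrt s * (norm (res s f) * norm (dres s f))"
      unfolding E_def using s by (simp add: power2_diff power_mult_distrib)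
    finally have "2 * norm (res s f) * norm (dres s f) \<le> E / sqrt s"
      using s by (simp add: field_simps)
    with sup_bound[OF derives_res(1)[OF s], of f x] have "(app (res s f) x)\<^sup>2 \<le> E / sqrt s" by simp
    then show ?thesis by (simp add: real_le_rsqrt abs_le_square_iff)
  qed
  have "E = inner (res s f) f" using inner_res[OF s, of f f] unfolding E_def power2_norm_eq_inner by simp
  also have "\<dots> \<le> (LINT x|lborel. sqrt (E / sqrt s) * \<bar>app f x\<bar>)"
    unfolding inner_l2fun_def
  proof (rule integral_mono)
    show "app (res s f) x * app f x \<le> sqrt (E / sqrt s) * \<bar>app f x\<bar>" for x
      using mult_right_mono[OF sup[of x] abs_ge_zero[of "app f x"]] abs_ge_self[of "app (res s f) x * app f x"]
      by (simp add: abs_mult)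
  qed (use F integrable_app in auto)
  also have "\<dots> \<le> sqrt (E / sqrt s) * F"
    using F(2) E0 s by (simp add: mult_left_mono)
  finally have "E \<le> sqrt (E / sqrt s) * F" .
  then have "E\<^sup>2 \<le> (sqrt (E / sqrt s) * F)\<^sup>2" using E0 by (intro power_mono) auto
  also have "\<dots> = E / sqrt s * F\<^sup>2" using E0 s by (simp add: power_mult_distrib)
  finally have "E * E \<le> E * (F\<^sup>2 / sqrt s)" by (simp add: power2_eq_square field_simps)
  then have "E \<le> F\<^sup>2 / sqrt s" by (rule le_of_square_le[OF _ E0]) (use s in simp)
  then show ?thesis unfolding E_def .
qed

section \<open>The norm of order minus one and the compensated energy\<close>

lemma bounded_linear_res: assumes "0 < s" shows "bounded_linear (res s)"
  by (rule bounded_linear_intro[where K = 1]) (use norm_res_le(1)[OF assms] res_add[OF assms] res_scaleR[OF assms] in auto)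

lemma bounded_linear_dres: "bounded_linear (dres 1)"
  by (rule bounded_linear_intro[where K = 1]) (use norm_dres_le res_add[of 1] res_scaleR[of 1] in auto)

text \<open>The map \<open>J\<close> embeds the space isometrically when the latter carries the \<open>H\<^sup>-\<^sup>1\<close> norm, whose square is
\<open>\<langle>(1 - \<partial>\<^sub>x\<^sup>2)\<^sup>-\<^sup>1 f, f\<rangle>\<close>; see \<open>inner_J\<close>. So \<open>norm (J f)\<close> is the \<open>H\<^sup>-\<^sup>1\<close> norm of \<open>f\<close>.\<close>

definition J :: "l2fun \<Rightarrow> l2fun \<times> l2fun" where "J f = (res 1 f, dres 1 f)"

lemma J_add: "J (f + g) = J f + J g" and J_scaleR: "J (c *\<^sub>R f) = c *\<^sub>R J f"
  by (simp_all add: J_def res_add res_scaleR)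

lemma J_diff: "J (f - g) = J f - J g"
  using J_add[of f "(-1) *\<^sub>R g"] J_scaleR[of "-1" g] by simp

lemma inner_J: "inner (J f) (J g) = inner (res 1 f) g"
  using inner_res[of 1 f g] by (simp add: J_def)

lemma norm_J_le: "norm (J f) \<le> norm f"
proof (rule power2_le_imp_le)
  have "(norm (J f))\<^sup>2 = inner (res 1 f) f" unfolding power2_norm_eq_inner by (rule inner_J)
  also have "\<dots> \<le> norm (res 1 f) * norm f" by (rule norm_cauchy_schwarz)
  also have "\<dots> \<le> norm f * norm f" by (intro mult_right_mono norm_res_le) auto
  finally show "(norm (J f))\<^sup>2 \<le> (norm f)\<^sup>2" by (simp add: power2_eq_square)
qed simp

lemma norm_res_le_J: "norm (res 1 f) \<le> norm (J f)" and norm_dres_le_J: "norm (dres 1 f) \<le> norm (J f)"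
  unfolding J_def norm_Pair by (simp_all add: real_le_rsqrt)

lemma bounded_linear_J: "bounded_linear J"
  by (rule bounded_linear_intro[where K = 1]) (use norm_J_le J_add J_scaleR in auto)

lemma inner_curve:
  fixes f g :: "real \<Rightarrow> 'a::real_inner"
  assumes "(f has_vector_derivative f') (at t within S)" "(g has_vector_derivative g') (at t within S)"
  shows "((\<lambda>t. inner (f t) (g t)) has_real_derivative inner (f t) g' + inner f' (g t)) (at t within S)"
  unfolding has_real_derivative_iff_has_vector_derivative
  by (rule bounded_bilinear.has_vector_derivative[OF bounded_bilinear_inner assms])

lemma young_weighted: fixes p q r :: real assumes "0 < r" shows "p * q \<le> r * p\<^sup>2 + q\<^sup>2 / (4 * r)"
proof -
  have "0 \<le> (2 * r * p - q)\<^sup>2 / (4 * r)" using assms by simp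
  also have "(2 * r * p - q)\<^sup>2 = 4 * r * (r * p\<^sup>2 - p * q) + q\<^sup>2" by algebra
  also have "\<dots> / (4 * r) = r * p\<^sup>2 - p * q + q\<^sup>2 / (4 * r)"
    using assms by (simp add: add_divide_distrib)
  finally show ?thesis by simp
qed

text \<open>The variables stand for \<open>X = \<parallel>y\<parallel>\<close>, \<open>V = \<parallel>v\<parallel>\<close> and \<open>Z = \<parallel>z\<^sub>x\<parallel>\<close> in \<open>H\<^sup>-\<^sup>1\<close>, and \<open>W = \<parallel>res 1 u\<^sub>x\<parallel>\<close>; \<open>P\<close> and \<open>Q\<close> are
the derivatives of the compensating terms. Each of \<open>P\<close> and \<open>Q\<close> gains some squares and pays with others:
\<open>Q\<close> pays \<open>V\<^sup>2\<close>, which \<open>P\<close> gains, and both pay \<open>X\<^sup>2\<close>, which the damping \<open>\<gamma> X\<^sup>2\<close> covers if \<open>l\<close> is small. The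
condition on \<open>l (2 + 3 a)\<close> keeps the compensated energy comparable with the \<open>L\<^sup>2\<close> norm.\<close>

lemma lyapunov_constants:
  fixes a \<gamma> :: real
  assumes a: "0 < a" and g: "0 < \<gamma>"
  shows "\<exists>l>0. \<exists>e>0. \<exists>c>0. c \<le> 1 \<and> l * (2 + 3 * a) \<le> 1 / 8 \<and>
    (\<forall>X V Z W P Q. 0 \<le> X \<longrightarrow> 0 \<le> V \<longrightarrow> 0 \<le> Z \<longrightarrow> 0 \<le> W \<longrightarrow>
       P \<ge> a\<^sup>2 * Z\<^sup>2 + V\<^sup>2 - \<bar>1 - 2 * a\<^sup>2\<bar> * (W * X) - e * Z * (V + a * Z) - \<gamma> * X * (V + a * Z) - (1 + a\<^sup>2) * X\<^sup>2 \<longrightarrow>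
       Q \<ge> W\<^sup>2 - X * W - V\<^sup>2 \<longrightarrow>
       - \<gamma> * X\<^sup>2 - l * P - l / 4 * Q \<le> - c * (X\<^sup>2 + V\<^sup>2 + Z\<^sup>2 + W\<^sup>2))"
proof -
  define k where "k = \<bar>1 - 2 * a\<^sup>2\<bar>"
  define K where "K = 4 * k\<^sup>2 + 4 * \<gamma>\<^sup>2 + 1 + a\<^sup>2 + 1 / 4"
  have K: "0 < K" unfolding K_def using zero_le_power2[of k] zero_le_power2[of \<gamma>] zero_le_power2[of a] by linarith
  define l where "l = min (\<gamma> / (2 * K)) (1 / (8 * (2 + 3 * a)))"
  have l: "0 < l" "l * K \<le> \<gamma> / 2" "l * (2 + 3 * a) \<le> 1 / 8"
  proof -
    show "0 < l" using a g K by (simp add: l_def)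
    have "l * K \<le> (\<gamma> / (2 * K)) * K" by (rule mult_right_mono) (use K in \<open>auto simp: l_def\<close>)
    then show "l * K \<le> \<gamma> / 2" using K by simp
    have "l * (2 + 3 * a) \<le> (1 / (8 * (2 + 3 * a))) * (2 + 3 * a)"
      by (rule mult_right_mono) (use a in \<open>auto simp: l_def\<close>)
    moreover have "(1 / (8 * q)) * q = 1 / 8" if "0 < q" for q :: real using that by simp
    ultimately show "l * (2 + 3 * a) \<le> 1 / 8" using a by (metis add_pos_pos mult_pos_pos zero_less_numeral)
  qed
  define e where "e = (min (a\<^sup>2) 1 / 8) / (1 + a)"
  have e: "0 < e" "e * (1 + a) \<le> a\<^sup>2 / 8" "e * (1 + a) \<le> 1 / 8"
  proof -
    show "0 < e" using a by (simp add: e_def)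
    have "e * (1 + a) = min (a\<^sup>2) 1 / 8"
      unfolding e_def by (rule nonzero_eq_divide_eq[THEN iffD1, OF _ refl]) (use a in simp)
    then show "e * (1 + a) \<le> a\<^sup>2 / 8" "e * (1 + a) \<le> 1 / 8" by auto
  qed
  define c where "c = Min {\<gamma> / 2, l * a\<^sup>2 / 2, l / 8, 1}"
  have c: "0 < c" "c \<le> \<gamma> / 2" "c \<le> l * a\<^sup>2 / 2" "c \<le> l / 8" "c \<le> 1"
    unfolding c_def using a g l by (auto simp: Min_gr_iff)
  have "- \<gamma> * X\<^sup>2 - l * P - l / 4 * Q \<le> - c * (X\<^sup>2 + V\<^sup>2 + Z\<^sup>2 + W\<^sup>2)"
    if nn: "0 \<le> X" "0 \<le> V" "0 \<le> Z" "0 \<le> W"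
      and P: "P \<ge> a\<^sup>2 * Z\<^sup>2 + V\<^sup>2 - k * (W * X) - e * Z * (V + a * Z) - \<gamma> * X * (V + a * Z) - (1 + a\<^sup>2) * X\<^sup>2"
      and Q: "Q \<ge> W\<^sup>2 - X * W - V\<^sup>2" for X V Z W P Q
  proof -
    have y1: "k * (W * X) \<le> W\<^sup>2 / 16 + 4 * (k\<^sup>2 * X\<^sup>2)"
      using young_weighted[of "1/16" W "k * X"] by (simp add: power_mult_distrib algebra_simps)
    have y2: "e * Z * (V + a * Z) \<le> a\<^sup>2 * Z\<^sup>2 / 8 + V\<^sup>2 / 8"
    proof -
      have "Z * V \<le> Z\<^sup>2 + V\<^sup>2"
        using sum_squares_bound[of Z V] mult_nonneg_nonneg[OF nn(3,2)] unfolding mult.assoc by linarith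
      moreover have "0 \<le> a * V\<^sup>2" using a by simp
      ultimately have "Z * (V + a * Z) \<le> (1 + a) * Z\<^sup>2 + (1 + a) * V\<^sup>2"
        unfolding power2_eq_square distrib_left distrib_right mult.left_commute[of Z a] by linarith
      then have "e * (Z * (V + a * Z)) \<le> e * ((1 + a) * Z\<^sup>2 + (1 + a) * V\<^sup>2)"
        using e by (intro mult_left_mono) auto
      also have "\<dots> = (e * (1 + a)) * Z\<^sup>2 + (e * (1 + a)) * V\<^sup>2" by algebra
      also have "\<dots> \<le> (a\<^sup>2 / 8) * Z\<^sup>2 + (1 / 8) * V\<^sup>2"
        using e by (intro add_mono mult_right_mono) auto
      finally show ?thesis by (simp add: mult.assoc)
    qed
    have y3: "\<gamma> * X * V \<le> V\<^sup>2 / 8 + 2 * (\<gamma>\<^sup>2 * X\<^sup>2)"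
      using young_weighted[of "1/8" V "\<gamma> * X"] by (simp add: power_mult_distrib algebra_simps)
    have y4: "\<gamma> * X * (a * Z) \<le> a\<^sup>2 * Z\<^sup>2 / 8 + 2 * (\<gamma>\<^sup>2 * X\<^sup>2)"
      using young_weighted[of "1/8" "a * Z" "\<gamma> * X"] by (simp add: power_mult_distrib algebra_simps)
    have y5: "X * W / 4 \<le> W\<^sup>2 / 16 + X\<^sup>2 / 4"
      using young_weighted[of "1/4" W X] by (simp add: algebra_simps)
    have "P + Q / 4 \<ge> a\<^sup>2 * Z\<^sup>2 / 2 + V\<^sup>2 / 2 + W\<^sup>2 / 8 - K * X\<^sup>2"
    proof -
      have "K * X\<^sup>2 = 4 * (k\<^sup>2 * X\<^sup>2) + 4 * (\<gamma>\<^sup>2 * X\<^sup>2) + (1 + a\<^sup>2) * X\<^sup>2 + X\<^sup>2 / 4"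
        unfolding K_def by (simp add: algebra_simps)
      moreover have "\<gamma> * X * (V + a * Z) = \<gamma> * X * V + \<gamma> * X * (a * Z)" by (simp add: algebra_simps)
      moreover have "0 \<le> a\<^sup>2 * Z\<^sup>2" by simp
      ultimately show ?thesis using P Q y1 y2 y3 y4 y5 by linarith
    qed
    then have "l * (P + Q / 4) \<ge> l * (a\<^sup>2 * Z\<^sup>2 / 2 + V\<^sup>2 / 2 + W\<^sup>2 / 8 - K * X\<^sup>2)"
      using l by (intro mult_left_mono) auto
    moreover have "l * (a\<^sup>2 * Z\<^sup>2 / 2 + V\<^sup>2 / 2 + W\<^sup>2 / 8 - K * X\<^sup>2)
      = (l * a\<^sup>2 / 2) * Z\<^sup>2 + (l / 2) * V\<^sup>2 + (l / 8) * W\<^sup>2 - (l * K) * X\<^sup>2" by (simp add: algebra_simps)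
    moreover have "(l * K) * X\<^sup>2 \<le> (\<gamma> / 2) * X\<^sup>2" using l by (intro mult_right_mono) auto
    moreover have "c * X\<^sup>2 \<le> (\<gamma> / 2) * X\<^sup>2" using c by (intro mult_right_mono) auto
    moreover have "c * Z\<^sup>2 \<le> (l * a\<^sup>2 / 2) * Z\<^sup>2" using c by (intro mult_right_mono) auto
    moreover have "c * V\<^sup>2 \<le> (l / 2) * V\<^sup>2" using c l by (intro mult_right_mono) auto
    moreover have "c * W\<^sup>2 \<le> (l / 8) * W\<^sup>2" using c by (intro mult_right_mono) auto
    ultimately show ?thesis by (simp add: algebra_simps)
  qed
  then show ?thesis using l e c unfolding k_def by blast
qed

text \<open>\<open>P\<close> is the time derivative of \<open>\<langle>y, v\<rangle> - a \<langle>y\<^sub>x, z\<rangle> + 2 a \<langle>u, z\<rangle>\<close> in \<open>H\<^sup>-\<^sup>1\<close>, and \<open>Q\<close> that of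
\<open>\<langle>res 1 v, dres 1 u\<rangle>\<close>. The first two terms of \<open>P\<close> pair \<open>y\<^sub>t\<close> with \<open>R = v + a z\<^sub>x\<close>, the main part of
\<open>y\<^sub>t\<close> itself, and so produce the square of \<open>R\<close>. The factor \<open>2 a\<close> of the third term cancels the indefinite
product \<open>2 a \<langle>v, z\<^sub>x\<rangle>\<close> in that square, which leaves \<open>a\<^sup>2 \<parallel>z\<^sub>x\<parallel>\<^sup>2 + \<parallel>v\<parallel>\<^sup>2\<close>; \<open>Q\<close> produces \<open>\<parallel>res 1 u\<^sub>x\<parallel>\<^sup>2\<close>.\<close>

lemma dissipation_identities:
  assumes d: "derives v vx" "derives u ux" "derives z zx" "derives y yx"
    and yt: "yt = a *\<^sub>R zx + v - \<gamma> *\<^sub>R y + G"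
    and G: "norm (J G) \<le> e * norm (J zx)" and a: "0 < a" and g: "0 < \<gamma>" and e: "0 \<le> e"
  defines "P \<equiv> (inner (J y) (J (ux - y)) + inner (J yt) (J v) - a * (inner (dres 1 y) (a *\<^sub>R yx) + inner (dres 1 yt) z))
      + 2 * a * (inner (J u) (J (a *\<^sub>R yx)) + inner (J vx) (J z))"
    and "Q \<equiv> inner (res 1 v) (dres 1 vx) + inner (res 1 (ux - y)) (dres 1 u)"
    and "X \<equiv> norm y" and "V \<equiv> norm (J v)" and "Z \<equiv> norm (J zx)" and "W \<equiv> norm (res 1 ux)"
  shows "P \<ge> a\<^sup>2 * Z\<^sup>2 + V\<^sup>2 - \<bar>1 - 2 * a\<^sup>2\<bar> * (W * X) - e * Z * (V + a * Z) - \<gamma> * X * (V + a * Z) - (1 + a\<^sup>2) * X\<^sup>2"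
    and "Q \<ge> W\<^sup>2 - X * W - V\<^sup>2"
proof -
  have r: "res 1 vx = dres 1 v" "res 1 ux = dres 1 u" "res 1 zx = dres 1 z" "res 1 yx = dres 1 y"
    using d by (auto intro: res_deriv)
  define R where "R = a *\<^sub>R zx + v"
  have JR: "J R = a *\<^sub>R J zx + J v" by (simp add: R_def J_add J_scaleR)
  have normR: "norm (J R) \<le> a * Z + V"
    unfolding JR Z_def V_def using norm_triangle_ineq[of "a *\<^sub>R J zx" "J v"] a by simp
  have i1: "inner (dres 1 yt) z = - inner (J yt) (J zx)"
    using inner_dres[of 1 yt z] inner_res_commute[of 1 yt zx] r by (simp add: inner_J)
  have i2: "inner (dres 1 y) yx = inner (J yx) (J yx)" using r by (simp add: inner_J)
  have i3: "inner (J y) (J ux) = inner (res 1 ux) y"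
    using inner_res_commute[of 1 y ux] by (simp add: inner_J inner_commute)
  have i4: "inner (J vx) (J z) = - inner (J v) (J zx)"
    using inner_dres[of 1 v z] inner_res_commute[of 1 v zx] r by (simp add: inner_J)
  have i5: "inner (J u) (J yx) = - inner (res 1 ux) y"
    using inner_dres[of 1 u y] inner_res_commute[of 1 u yx] r by (simp add: inner_J)
  have JRR: "inner (J R) (J R) = a\<^sup>2 * Z\<^sup>2 + V\<^sup>2 + 2 * a * inner (J v) (J zx)"
    unfolding JR Z_def V_def power2_norm_eq_inner
    by (simp add: inner_add_left inner_add_right inner_commute power2_eq_square algebra_simps)
  have Jyt: "J yt = J R - \<gamma> *\<^sub>R J y + J G" unfolding yt R_def by (simp add: J_add J_diff J_scaleR)
  have Pe: "P = inner (res 1 ux) y - inner (J y) (J y) + inner (J yt) (J R) - a\<^sup>2 * inner (J yx) (J yx)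
      - 2 * a * (a * inner (res 1 ux) y + inner (J v) (J zx))"
    unfolding P_def i1 i4 JR
    by (simp add: J_diff J_scaleR inner_diff_right inner_add_right i2 i3 i5 algebra_simps power2_eq_square)
  have Pe2: "P = a\<^sup>2 * Z\<^sup>2 + V\<^sup>2 + (1 - 2 * a\<^sup>2) * inner (res 1 ux) y + inner (J G) (J R)
      - \<gamma> * inner (J y) (J R) - inner (J y) (J y) - a\<^sup>2 * inner (J yx) (J yx)"
    unfolding Pe Jyt using JRR
    by (simp add: inner_add_left inner_diff_left algebra_simps power2_eq_square)
  have b1: "(1 - 2 * a\<^sup>2) * inner (res 1 ux) y \<ge> - (\<bar>1 - 2 * a\<^sup>2\<bar> * (W * X))"
  proof -
    have "\<bar>(1 - 2 * a\<^sup>2) * inner (res 1 ux) y\<bar> \<le> \<bar>1 - 2 * a\<^sup>2\<bar> * (W * X)"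
      unfolding abs_mult W_def X_def by (intro mult_left_mono Cauchy_Schwarz_ineq2) simp
    then show ?thesis by linarith
  qed
  have b2: "inner (J G) (J R) \<ge> - (e * Z * (V + a * Z))"
  proof -
    have "\<bar>inner (J G) (J R)\<bar> \<le> norm (J G) * norm (J R)" by (rule Cauchy_Schwarz_ineq2)
    also have "\<dots> \<le> (e * Z) * (a * Z + V)"
      using G normR e unfolding Z_def by (intro mult_mono) auto
    finally show ?thesis by (simp add: add.commute)
  qed
  have b3: "\<gamma> * inner (J y) (J R) \<le> \<gamma> * X * (V + a * Z)"
  proof -
    have "inner (J y) (J R) \<le> norm (J y) * norm (J R)" by (rule norm_cauchy_schwarz)
    also have "\<dots> \<le> X * (a * Z + V)"
      using normR norm_J_le[of y] unfolding X_def by (intro mult_mono) auto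
    finally show ?thesis using g by (simp add: mult_left_mono add.commute mult.assoc)
  qed
  have b4: "inner (J y) (J y) \<le> X\<^sup>2"
    unfolding power2_norm_eq_inner[symmetric] X_def using norm_J_le by (intro power_mono) auto
  have b5: "a\<^sup>2 * inner (J yx) (J yx) \<le> a\<^sup>2 * X\<^sup>2"
  proof (rule mult_left_mono)
    have "inner (J yx) (J yx) = inner (dres 1 y) yx" by (simp add: i2)
    also have "\<dots> = - inner (res 1 y - y) y"
      using inner_derives[OF derives_res(2)[of 1 y] d(4)] by simp
    also have "\<dots> = X\<^sup>2 - inner (J y) (J y)"
      unfolding X_def power2_norm_eq_inner inner_J by (simp add: inner_diff_left)
    also have "\<dots> \<le> X\<^sup>2" by simp
    finally show "inner (J yx) (J yx) \<le> X\<^sup>2" .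
  qed simp
  show "P \<ge> a\<^sup>2 * Z\<^sup>2 + V\<^sup>2 - \<bar>1 - 2 * a\<^sup>2\<bar> * (W * X) - e * Z * (V + a * Z) - \<gamma> * X * (V + a * Z) - (1 + a\<^sup>2) * X\<^sup>2"
    unfolding Pe2 distrib_right[of 1 "a\<^sup>2"] using b1 b2 b3 b4 b5 by linarith
  have q1: "inner (res 1 v) (dres 1 vx) = - (norm (dres 1 v))\<^sup>2"
    using inner_derives[OF derives_res(1)[of 1 v] derives_res(1)[of 1 vx]] r
    unfolding power2_norm_eq_inner by simp
  have q2: "(norm (dres 1 v))\<^sup>2 \<le> V\<^sup>2" unfolding V_def by (intro power_mono norm_dres_le_J) simp
  have q3: "inner (res 1 (ux - y)) (dres 1 u) = W\<^sup>2 - inner (res 1 y) (res 1 ux)"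
    unfolding W_def power2_norm_eq_inner r(2)[symmetric]
    using res_add[of 1 ux "- y"] res_scaleR[of 1 "-1" y] by (simp add: inner_diff_left)
  have q4: "inner (res 1 y) (res 1 ux) \<le> X * W"
    unfolding X_def W_def
    by (rule order_trans[OF norm_cauchy_schwarz]) (intro mult_right_mono norm_res_le, auto)
  show "Q \<ge> W\<^sup>2 - X * W - V\<^sup>2" unfolding Q_def q1 q3 using q2 q4 by linarith
qed

section \<open>Decay of damped flows\<close>

text \<open>Divide the inequality for \<open>n'\<close> by \<open>2 sqrt n\<close> and integrate. Since \<open>sqrt\<close> is not differentiable at \<open>0\<close>,
\<open>n\<close> is first raised by a small constant \<open>\<eta>\<close>.\<close>

lemma sqrt_growth:
  fixes n n' :: "real \<Rightarrow> real"
  assumes d: "\<And>t. 0 \<le> t \<Longrightarrow> t \<le> t0 \<Longrightarrow> (n has_real_derivative n' t) (at t within {0..})"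
    and nn: "\<And>t. 0 \<le> n t" and k: "0 < k" and B: "0 \<le> B" and t0: "0 \<le> t0"
    and le: "\<And>t. 0 \<le> t \<Longrightarrow> t \<le> t0 \<Longrightarrow> n' t \<le> 2 * sqrt (n t) * (B / sqrt (1 + k * t))"
  shows "sqrt (n t0) \<le> sqrt (n 0) + 2 * B / k * sqrt (1 + k * t0)"
proof (rule field_le_epsilon)
  fix e :: real assume e: "0 < e"
  define \<eta> where "\<eta> = e\<^sup>2"
  have \<eta>: "0 < \<eta>" using e by (simp add: \<eta>_def)
  define m where "m = (\<lambda>t. sqrt (\<eta> + n t) - 2 * B / k * sqrt (1 + k * t))"
  have pos: "0 < \<eta> + n t" for t using \<eta> nn[of t] by linarith
  have kp: "0 < 1 + k * t" if "0 \<le> t" for t using that k by (simp add: add_pos_nonneg)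
  have md: "(m has_real_derivative n' t / (2 * sqrt (\<eta> + n t)) - B / sqrt (1 + k * t)) (at t within {0..})"
    if t: "0 \<le> t" "t \<le> t0" for t
  proof -
    have "(m has_real_derivative (inverse (sqrt (\<eta> + n t)) / 2) * (0 + n' t) - 2 * B / k * ((inverse (sqrt (1 + k * t)) / 2) * k)) (at t within {0..})"
      unfolding m_def using pos[of t] kp[OF t(1)]
      by (auto intro!: derivative_eq_intros d[OF t] DERIV_real_sqrt)
    then show ?thesis using k by (simp add: field_simps)
  qed
  have "m t0 \<le> m 0"
  proof (cases "t0 = 0")
    case False
    show ?thesis
    proof (rule DERIV_nonpos_imp_decreasing_open[OF t0])
      fix t assume t: "0 < t" "t < t0"
      have "(m has_real_derivative n' t / (2 * sqrt (\<eta> + n t)) - B / sqrt (1 + k * t)) (at t)"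
        using md[of t] t at_within_interior[of t "{0..}"] by simp
      moreover have "n' t / (2 * sqrt (\<eta> + n t)) \<le> B / sqrt (1 + k * t)"
      proof -
        have b: "0 \<le> B / sqrt (1 + k * t)" using B kp[of t] t by simp
        have "n' t \<le> 2 * sqrt (n t) * (B / sqrt (1 + k * t))" using le t by simp
        also have "\<dots> \<le> 2 * sqrt (\<eta> + n t) * (B / sqrt (1 + k * t))"
          using b \<eta> by (intro mult_right_mono) auto
        finally show ?thesis using pos[of t] by (simp add: pos_divide_le_eq mult.commute)
      qed
      ultimately show "\<exists>y. (m has_real_derivative y) (at t) \<and> y \<le> 0" by fastforce
    next
      show "continuous_on {0..t0} m"
        using md by (auto intro!: DERIV_continuous_on has_field_derivative_subset[OF md])
    qed
  qed simp
  then have "sqrt (\<eta> + n t0) \<le> sqrt (\<eta> + n 0) + 2 * B / k * sqrt (1 + k * t0) - 2 * B / k"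
    unfolding m_def by simp
  moreover have "0 \<le> 2 * B / k" using B k by simp
  moreover have "sqrt (n t0) \<le> sqrt (\<eta> + n t0)" using \<eta> by simp
  moreover have "sqrt (\<eta> + n 0) \<le> e + sqrt (n 0)"
    using sqrt_add_le_add_sqrt[of \<eta> "n 0"] \<eta> nn[of 0] e by (simp add: \<eta>_def)
  ultimately show "sqrt (n t0) \<le> sqrt (n 0) + 2 * B / k * sqrt (1 + k * t0) + e" by linarith
qed

text \<open>At the first time \<open>t0\<close> at which \<open>f\<close> reaches the barrier \<open>b\<close>, the difference \<open>f - b\<close> has a negative derivative, so
it was positive shortly before.\<close>

lemma first_crossing:
  fixes f b :: "real \<Rightarrow> real"
  assumes fd: "\<And>t. 0 \<le> t \<Longrightarrow> (f has_real_derivative f' t) (at t within {0..})"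
    and bd: "\<And>t. 0 \<le> t \<Longrightarrow> (b has_real_derivative b' t) (at t within {0..})"
    and init: "f 0 < b 0"
    and step: "\<And>t. 0 < t \<Longrightarrow> (\<And>r. 0 \<le> r \<Longrightarrow> r \<le> t \<Longrightarrow> f r \<le> b r) \<Longrightarrow> f t = b t \<Longrightarrow> f' t < b' t"
    and t: "0 \<le> t"
  shows "f t \<le> b t"
proof (rule ccontr)
  assume "\<not> f t \<le> b t"
  then have ft: "b t < f t" by simp
  define h where "h = (\<lambda>t. f t - b t)"
  have hd: "(h has_real_derivative f' t - b' t) (at t within {0..})" if "0 \<le> t" for t
    unfolding h_def using that by (intro DERIV_diff fd bd)
  have hc: "continuous_on {0..t} h"
    by (rule DERIV_continuous_on) (rule has_field_derivative_subset[OF hd], auto)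
  define S where "S = {r \<in> {0..t}. 0 \<le> h r}"
  have S: "closed S" unfolding S_def
    by (rule continuous_on_closed_Collect_le[OF continuous_on_const hc]) simp
  have tS: "t \<in> S" using ft t by (simp add: S_def h_def)
  have bdd: "bdd_below S" unfolding S_def by (auto intro: bdd_belowI[of _ 0])
  define t0 where "t0 = Inf S"
  have t0: "t0 \<in> S" unfolding t0_def using closed_contains_Inf[OF _ bdd S] tS by auto
  have neg: "h r < 0" if "0 \<le> r" "r < t0" for r
  proof (rule ccontr)
    assume "\<not> h r < 0"
    then have "r \<in> S" using that t0 by (auto simp: S_def)
    then have "t0 \<le> r" unfolding t0_def by (rule cInf_lower[OF _ bdd])
    then show False using that by simp
  qed
  have t0p: "0 < t0"
    using t0 init by (cases "t0 = 0") (auto simp: S_def h_def)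
  have hd0: "(h has_real_derivative f' t0 - b' t0) (at t0)"
    using hd[of t0] t0p at_within_interior[of t0 "{0..}"] by simp
  have ht0: "h t0 = 0"
  proof (rule antisym)
    have "isCont h t0" by (rule DERIV_isCont[OF hd0])
    then have lim: "(h \<longlongrightarrow> h t0) (at_left t0)" by (simp add: isCont_def filterlim_at_split)
    have ev: "\<forall>\<^sub>F r in at_left t0. h r \<le> 0"
      using eventually_at_left_real[OF t0p] by eventually_elim (use neg less_imp_le in auto)
    show "h t0 \<le> 0" by (rule tendsto_upperbound[OF lim ev]) simp
    show "0 \<le> h t0" using t0 by (simp add: S_def)
  qed
  have "f' t0 < b' t0"
  proof (rule step[OF t0p])
    show "f r \<le> b r" if "0 \<le> r" "r \<le> t0" for r
      using neg[of r] that ht0 by (cases "r = t0") (auto simp: h_def)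
    show "f t0 = b t0" using ht0 by (simp add: h_def)
  qed
  then obtain d where d: "0 < d" "\<And>k. 0 < k \<Longrightarrow> k < d \<Longrightarrow> h t0 < h (t0 - k)"
    using DERIV_neg_dec_left[OF hd0] by auto
  define k where "k = min (d / 2) t0"
  have "0 < k" "k < d" "k \<le> t0" using d(1) t0p by (auto simp: k_def)
  then show False using d(2)[of k] neg[of "t0 - k"] ht0 by simp
qed

text \<open>What the decay argument needs to know about the components \<open>v, u, z, y\<close> as curves in \<open>L\<^sup>2\<close>: the
equations, with the nonlinear flux \<open>g\<close> and its derivative \<open>G\<close>; the size of the nonlinearity in \<open>H\<^sup>-\<^sup>1\<close> and
in \<open>L\<^sup>1\<close>; an energy \<open>e0\<close> that decays exactly by the damping; a bound in \<open>H\<^sup>1\<close> and the integrability of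
the initial data, both in terms of the size \<open>I\<close> of the data.\<close>

locale flow =
  fixes a \<gamma> Cg m e I :: real
    and v u z y vx ux zx yx g G :: "real \<Rightarrow> l2fun" and e0 :: "real \<Rightarrow> real"
  assumes a: "0 < a" and \<gamma>: "0 < \<gamma>" and Cg: "0 \<le> Cg" and e: "0 \<le> e" and I: "0 < I"
    and dx: "\<And>t. 0 \<le> t \<Longrightarrow> derives (v t) (vx t)" "\<And>t. 0 \<le> t \<Longrightarrow> derives (u t) (ux t)"
      "\<And>t. 0 \<le> t \<Longrightarrow> derives (z t) (zx t)" "\<And>t. 0 \<le> t \<Longrightarrow> derives (y t) (yx t)"
      "\<And>t. 0 \<le> t \<Longrightarrow> derives (g t) (G t)"
    and v_t: "\<And>t. 0 \<le> t \<Longrightarrow> (v has_vector_derivative ux t - y t) (at t within {0..})"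
    and u_t: "\<And>t. 0 \<le> t \<Longrightarrow> (u has_vector_derivative vx t) (at t within {0..})"
    and z_t: "\<And>t. 0 \<le> t \<Longrightarrow> (z has_vector_derivative a *\<^sub>R yx t) (at t within {0..})"
    and y_t: "\<And>t. 0 \<le> t \<Longrightarrow>
      (y has_vector_derivative a *\<^sub>R zx t + v t - \<gamma> *\<^sub>R y t + G t) (at t within {0..})"
    and G_small: "\<And>t. 0 \<le> t \<Longrightarrow> norm (J (G t)) \<le> e * norm (J (zx t))"
    and g_L1: "\<And>t. 0 \<le> t \<Longrightarrow> integrable lborel (\<lambda>x. \<bar>app (g t) x\<bar>)"
      "\<And>t. 0 \<le> t \<Longrightarrow> (LINT x|lborel. \<bar>app (g t) x\<bar>) \<le> Cg * (norm (z t))\<^sup>2"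
    and e0_t: "\<And>t. 0 \<le> t \<Longrightarrow> (e0 has_real_derivative - \<gamma> * (norm (y t))\<^sup>2) (at t within {0..})"
    and e0_bounds: "\<And>t. 0 \<le> t \<Longrightarrow> ((norm (v t))\<^sup>2 + (norm (u t))\<^sup>2 + (norm (z t))\<^sup>2 + (norm (y t))\<^sup>2) / 4 \<le> e0 t"
      "\<And>t. 0 \<le> t \<Longrightarrow> e0 t \<le> (norm (v t))\<^sup>2 + (norm (u t))\<^sup>2 + (norm (z t))\<^sup>2 + (norm (y t))\<^sup>2"
    and H1_bound: "\<And>t. 0 \<le> t \<Longrightarrow> (norm (v t))\<^sup>2 + (norm (u t))\<^sup>2 + (norm (z t))\<^sup>2 + (norm (y t))\<^sup>2 \<le> (m * I)\<^sup>2"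
      "\<And>t. 0 \<le> t \<Longrightarrow> (norm (vx t))\<^sup>2 + (norm (ux t))\<^sup>2 + (norm (zx t))\<^sup>2 + (norm (yx t))\<^sup>2 \<le> (m * I)\<^sup>2"
    and L1_init: "\<And>w. w \<in> {v, u, z, y} \<Longrightarrow>
      integrable lborel (\<lambda>x. \<bar>app (w 0) x\<bar>) \<and> (LINT x|lborel. \<bar>app (w 0) x\<bar>) \<le> I"
begin

definition "N2 t = (norm (v t))\<^sup>2 + (norm (u t))\<^sup>2 + (norm (z t))\<^sup>2 + (norm (y t))\<^sup>2"

definition "cross t = inner (J (y t)) (J (v t)) - a * inner (dres 1 (y t)) (z t) + 2 * a * inner (J (u t)) (J (z t))"

definition "cross2 t = inner (res 1 (v t)) (dres 1 (u t))"

definition "yt t = a *\<^sub>R zx t + v t - \<gamma> *\<^sub>R y t + G t"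

definition "cross' t = (inner (J (y t)) (J (ux t - y t)) + inner (J (yt t)) (J (v t))
      - a * (inner (dres 1 (y t)) (a *\<^sub>R yx t) + inner (dres 1 (yt t)) (z t)))
      + 2 * a * (inner (J (u t)) (J (a *\<^sub>R yx t)) + inner (J (vx t)) (J (z t)))"

definition "cross2' t = inner (res 1 (v t)) (dres 1 (vx t)) + inner (res 1 (ux t - y t)) (dres 1 (u t))"

lemma cross_deriv: assumes t: "0 \<le> t"
  shows "(cross has_real_derivative cross' t) (at t within {0..})"
proof -
  note J = bounded_linear.has_vector_derivative[OF bounded_linear_J]
  note D = bounded_linear.has_vector_derivative[OF bounded_linear_dres]
  note ys = y_t[OF t, folded yt_def]
  show ?thesis
    unfolding cross_def[abs_def] cross'_def
    by (intro DERIV_add DERIV_diff DERIV_cmult inner_curve J D v_t u_t z_t ys t)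
qed

lemma cross2_deriv: assumes t: "0 \<le> t"
  shows "(cross2 has_real_derivative cross2' t) (at t within {0..})"
  unfolding cross2_def[abs_def] cross2'_def
  by (intro inner_curve bounded_linear.has_vector_derivative[OF bounded_linear_dres]
      bounded_linear.has_vector_derivative[OF bounded_linear_res] v_t u_t t) simp

lemma N2_nonneg: "0 \<le> N2 t" by (simp add: N2_def)

lemma N2_prod: "norm f * norm h \<le> N2 t" if "f \<in> {v t, u t, z t, y t}" "h \<in> {v t, u t, z t, y t}"
proof -
  have "(norm f)\<^sup>2 \<le> N2 t" "(norm h)\<^sup>2 \<le> N2 t" using that by (auto simp: N2_def)
  then have "norm f \<le> sqrt (N2 t)" "norm h \<le> sqrt (N2 t)" by (auto simp: real_le_rsqrt)
  then have "norm f * norm h \<le> sqrt (N2 t) * sqrt (N2 t)" by (intro mult_mono) (auto simp: N2_nonneg)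
  then show ?thesis using N2_nonneg by simp
qed

lemma cross_bound: "\<bar>cross t + cross2 t / 4\<bar> \<le> (2 + 3 * a) * N2 t"
proof -
  have JJ: "\<bar>inner (J f) (J h)\<bar> \<le> N2 t" if "f \<in> {v t, u t, z t, y t}" "h \<in> {v t, u t, z t, y t}" for f h
  proof -
    have "\<bar>inner (J f) (J h)\<bar> \<le> norm (J f) * norm (J h)" by (rule Cauchy_Schwarz_ineq2)
    also have "\<dots> \<le> norm f * norm h" by (intro mult_mono norm_J_le) auto
    finally show ?thesis using N2_prod[OF that] by linarith
  qed
  have 1: "\<bar>inner (J (y t)) (J (v t))\<bar> \<le> N2 t" "\<bar>inner (J (u t)) (J (z t))\<bar> \<le> N2 t"
    by (intro JJ; simp)+
  have 2: "\<bar>inner (dres 1 (y t)) (z t)\<bar> \<le> N2 t"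
  proof -
    have "\<bar>inner (dres 1 (y t)) (z t)\<bar> \<le> norm (dres 1 (y t)) * norm (z t)" by (rule Cauchy_Schwarz_ineq2)
    also have "\<dots> \<le> norm (y t) * norm (z t)" by (intro mult_mono norm_dres_le) auto
    finally show ?thesis using N2_prod[of "y t" t "z t"] by simp
  qed
  have 3: "\<bar>cross2 t\<bar> \<le> N2 t"
  proof -
    have "\<bar>cross2 t\<bar> \<le> norm (res 1 (v t)) * norm (dres 1 (u t))" unfolding cross2_def by (rule Cauchy_Schwarz_ineq2)
    also have "\<dots> \<le> norm (v t) * norm (u t)" by (intro mult_mono norm_dres_le norm_res_le) auto
    finally show ?thesis using N2_prod[of "v t" t "u t"] by simp
  qed
  have 4: "\<bar>a * inner (dres 1 (y t)) (z t)\<bar> \<le> a * N2 t" "\<bar>2 * a * inner (J (u t)) (J (z t))\<bar> \<le> 2 * a * N2 t"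
    using 1(2) 2 a by (simp_all add: abs_mult)
  have "(2 + 3 * a) * N2 t = 2 * N2 t + a * N2 t + 2 * a * N2 t" by algebra
  then show ?thesis unfolding cross_def using 1(1) 3 4 N2_nonneg[of t] by linarith
qed

definition "low s t = (norm (res s (v t)))\<^sup>2 + (norm (res s (u t)))\<^sup>2 + (norm (res s (z t)))\<^sup>2 + (norm (res s (y t)))\<^sup>2"

text \<open>The linear part without damping is skew-symmetric and commutes with the resolvent; only the damping and the
nonlinear term contribute.\<close>

lemma low_deriv: assumes t: "0 \<le> t" and s: "0 < s"
  shows "(low s has_real_derivative
    2 * (inner (res s (y t)) (res s (G t)) - \<gamma> * (norm (res s (y t)))\<^sup>2)) (at t within {0..})"
proof -
  note T = bounded_linear.has_vector_derivative[OF bounded_linear_res[OF s]]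
  have sub: "res s (f - h) = res s f - res s h" for f h
    using bounded_linear.linear[OF bounded_linear_res[OF s]] by (rule linear_diff)
  have sm: "res s (c *\<^sub>R f) = c *\<^sub>R res s f" "res s (f + h) = res s f + res s h" for f h c
    using res_scaleR[OF s] res_add[OF s] by auto
  let ?v = "res s (v t)" and ?u = "res s (u t)" and ?z = "res s (z t)" and ?y = "res s (y t)"
  have "(low s has_real_derivative
      ((inner ?v (res s (ux t - y t)) + inner (res s (ux t - y t)) ?v) + (inner ?u (res s (vx t)) + inner (res s (vx t)) ?u)
      + (inner ?z (res s (a *\<^sub>R yx t)) + inner (res s (a *\<^sub>R yx t)) ?z)
      + (inner ?y (res s (yt t)) + inner (res s (yt t)) ?y))) (at t within {0..})"
    unfolding low_def[abs_def] power2_norm_eq_inner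
    by (intro DERIV_add inner_curve T v_t u_t z_t y_t[folded yt_def] t)
  moreover have "inner (dres s (u t)) ?v = - inner ?u (dres s (v t))"
    "inner (dres s (y t)) ?z = - inner ?y (dres s (z t))"
    by (intro inner_derives derives_res s)+
  moreover have "res s (ux t) = dres s (u t)" "res s (vx t) = dres s (v t)"
    "res s (yx t) = dres s (y t)" "res s (zx t) = dres s (z t)"
    using dx[OF t] by (auto intro: res_deriv[OF s])
  ultimately show ?thesis
    unfolding yt_def sub sm
    by (simp add: inner_add_left inner_add_right inner_diff_left inner_diff_right inner_commute
        power2_norm_eq_inner algebra_simps)
qed

text \<open>The data contribute \<open>s powr (-1/4)\<close> to the norm of the low frequencies. As \<open>G\<close> is a derivative,
\<open>res s G = dres s g\<close> gains the factor \<open>s powr (-3/4)\<close>; integrating \<open>\<parallel>z\<parallel>\<^sup>2 \<le> K / sqrt (1 + k r)\<close> in time loses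
only \<open>s powr (1/2)\<close>, and both contributions have the same size.\<close>

lemma low_bound:
  assumes k: "0 < k" and K: "0 \<le> K" and t0: "0 \<le> t0"
    and decay: "\<And>r. 0 \<le> r \<Longrightarrow> r \<le> t0 \<Longrightarrow> (norm (z r))\<^sup>2 \<le> K / sqrt (1 + k * r)"
  defines "s \<equiv> 1 + k * t0"
  shows "low s t0 \<le> (2 * I + 2 * Cg * K / k)\<^sup>2 / sqrt s"
proof -
  have s: "1 \<le> s" "0 < s" using k t0 by (auto simp: s_def add_pos_nonneg)
  \<comment> \<open>With \<open>q = s powr (1/4)\<close>, all powers of \<open>s\<close> are integral powers of \<open>q\<close>.\<close>
  define q where "q = sqrt (sqrt s)"
  have q: "0 < q" "q\<^sup>2 = sqrt s" "q^4 = s"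
  proof -
    show "0 < q" "q\<^sup>2 = sqrt s" using s by (auto simp: q_def)
    have "q^4 = (q\<^sup>2)\<^sup>2" by simp
    then show "q^4 = s" using s by (simp add: q_def)
  qed
  have init: "low s 0 \<le> 4 * (I\<^sup>2 / sqrt s)"
  proof -
    have "(norm (res s (w 0)))\<^sup>2 \<le> I\<^sup>2 / sqrt s" if "w \<in> {v, u, z, y}" for w
    proof -
      have "(norm (res s (w 0)))\<^sup>2 + s * (norm (dres s (w 0)))\<^sup>2 \<le> I\<^sup>2 / sqrt s"
        by (rule res_L1[OF s(2)]) (use L1_init[OF that] in auto)
      moreover have "0 \<le> s * (norm (dres s (w 0)))\<^sup>2" using s by simp
      ultimately show ?thesis by linarith
    qed
    from this[of v] this[of u] this[of z] this[of y] show ?thesis unfolding low_def by simp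
  qed
  have lownn: "0 \<le> low s t" for t by (simp add: low_def)
  have sq: "sqrt (low s t0) \<le> sqrt (low s 0) + 2 * (Cg * K / q^3) / k * sqrt (1 + k * t0)"
  proof (rule sqrt_growth[where n' = "\<lambda>t. 2 * (inner (res s (y t)) (res s (G t)) - \<gamma> * (norm (res s (y t)))\<^sup>2)"])
    show "(low s has_real_derivative 2 * (inner (res s (y t)) (res s (G t)) - \<gamma> * (norm (res s (y t)))\<^sup>2)) (at t within {0..})"
      if "0 \<le> t" for t by (rule low_deriv[OF that s(2)])
    show "0 \<le> Cg * K / q^3" using Cg K q by simp
    fix t assume t: "0 \<le> t" "t \<le> t0"
    have kt: "0 < 1 + k * t" using k t by (simp add: add_pos_nonneg)
    have "res s (G t) = dres s (g t)" by (rule res_deriv[OF s(2) dx(5)[OF t(1)]])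
    have "(norm (res s (g t)))\<^sup>2 + s * (norm (dres s (g t)))\<^sup>2 \<le> (Cg * (norm (z t))\<^sup>2)\<^sup>2 / sqrt s"
      by (rule res_L1[OF s(2) g_L1(1)[OF t(1)] g_L1(2)[OF t(1)]])
    then have "s * (norm (res s (G t)))\<^sup>2 \<le> (Cg * (norm (z t))\<^sup>2)\<^sup>2 / q\<^sup>2"
      unfolding \<open>res s (G t) = dres s (g t)\<close> q(2) using zero_le_power2[of "norm (res s (g t))"] by linarith
    then have "(norm (res s (G t)) * q^3)\<^sup>2 \<le> (Cg * (norm (z t))\<^sup>2)\<^sup>2"
      using q(1) unfolding q(3)[symmetric]
      by (simp add: pos_le_divide_eq power_mult_distrib) (simp add: power_add[symmetric] power_mult[symmetric] mult.commute mult.left_commute eval_nat_numeral)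
    then have "norm (res s (G t)) * q^3 \<le> Cg * (norm (z t))\<^sup>2"
      by (rule power2_le_imp_le) (use Cg in simp)
    also have "\<dots> \<le> Cg * (K / sqrt (1 + k * t))" using Cg decay[OF t] by (rule mult_left_mono[rotated])
    finally have G: "norm (res s (G t)) \<le> Cg * K / q^3 / sqrt (1 + k * t)"
      using q(1) kt by (simp add: field_simps)
    have "inner (res s (y t)) (res s (G t)) \<le> norm (res s (y t)) * norm (res s (G t))" by (rule norm_cauchy_schwarz)
    also have "\<dots> \<le> sqrt (low s t) * (Cg * K / q^3 / sqrt (1 + k * t))"
      using G by (intro mult_mono) (auto simp: low_def real_le_rsqrt)
    finally have "inner (res s (y t)) (res s (G t)) \<le> sqrt (low s t) * (Cg * K / q^3 / sqrt (1 + k * t))" .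
    moreover have "0 \<le> \<gamma> * (norm (res s (y t)))\<^sup>2" using \<gamma> by simp
    ultimately show "2 * (inner (res s (y t)) (res s (G t)) - \<gamma> * (norm (res s (y t)))\<^sup>2)
        \<le> 2 * sqrt (low s t) * (Cg * K / q ^ 3 / sqrt (1 + k * t))" by (simp add: mult.assoc)
  qed (use lownn k t0 in auto)
  have "sqrt (low s 0) \<le> sqrt (4 * (I\<^sup>2 / sqrt s))" using init by simp
  also have "\<dots> = 2 * I / q" using I s by (simp add: real_sqrt_mult real_sqrt_divide q_def)
  finally have 1: "sqrt (low s 0) \<le> 2 * I / q" .
  have 2: "2 * (Cg * K / q^3) / k * sqrt (1 + k * t0) = (2 * Cg * K / k) / q"
  proof -
    have "sqrt (1 + k * t0) = q\<^sup>2" unfolding q(2) s_def ..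
    then show ?thesis using q(1) k by (simp add: field_simps eval_nat_numeral)
  qed
  have "sqrt (low s t0) \<le> (2 * I + 2 * Cg * K / k) / q"
    using sq 1 unfolding 2 by (simp add: add_divide_distrib)
  then have "(sqrt (low s t0))\<^sup>2 \<le> ((2 * I + 2 * Cg * K / k) / q)\<^sup>2" using lownn by (intro power_mono) auto
  then show ?thesis using lownn q(2) by (simp add: power_divide)
qed

text \<open>The barrier is \<open>b t = K / sqrt (1 + k t)\<close> with \<open>K = L I\<^sup>2\<close>. If \<open>E = b\<close> at time \<open>t\<close> for the first time, then
\<open>N2 t \<ge> K / (2 sqrt s)\<close>, whereas the low and high frequencies carry at most \<open>6 (9 + m\<^sup>2) I\<^sup>2 / sqrt s\<close>; the
choice of \<open>L\<close> leaves \<open>s D > K / (24 sqrt s)\<close> for the medium ones. Therefore \<open>E' \<le> - c D\<close> is below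
\<open>- (c K / 24) / (s sqrt s)\<close>, and \<open>k = c / 12\<close> makes this the slope of \<open>b\<close>.\<close>

lemma decay:
  assumes l: "0 < l" "l * (2 + 3 * a) \<le> 1 / 8" and c: "0 < c"
    and lyap: "\<And>X V Z W P Q. 0 \<le> X \<Longrightarrow> 0 \<le> V \<Longrightarrow> 0 \<le> Z \<Longrightarrow> 0 \<le> W \<Longrightarrow>
       P \<ge> a\<^sup>2 * Z\<^sup>2 + V\<^sup>2 - \<bar>1 - 2 * a\<^sup>2\<bar> * (W * X) - e * Z * (V + a * Z) - \<gamma> * X * (V + a * Z) - (1 + a\<^sup>2) * X\<^sup>2 \<Longrightarrow>
       Q \<ge> W\<^sup>2 - X * W - V\<^sup>2 \<Longrightarrow>
       - \<gamma> * X\<^sup>2 - l * P - l / 4 * Q \<le> - c * (X\<^sup>2 + V\<^sup>2 + Z\<^sup>2 + W\<^sup>2)"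
    and small: "16 * Cg * (24 * (10 + m\<^sup>2)) * I \<le> c / 12"
    and t: "0 \<le> t"
  shows "N2 t \<le> 8 * (24 * (10 + m\<^sup>2)) * I\<^sup>2 / sqrt (1 + c / 12 * t)"
proof -
  define k where "k = c / 12"
  define L where "L = 24 * (10 + m\<^sup>2)"
  define K where "K = L * I\<^sup>2"
  have k: "0 < k" using c by (simp add: k_def)
  have L: "0 < L" unfolding L_def by (simp add: add_pos_nonneg)
  have K: "0 < K" using L I by (simp add: K_def)
  have kp: "1 \<le> 1 + k * t" "0 < 1 + k * t" if "0 \<le> t" for t using that k by (auto simp: add_pos_nonneg)
  define E where "E = (\<lambda>t. e0 t - l * (cross t + cross2 t / 4))"
  define E' where "E' = (\<lambda>t. - \<gamma> * (norm (y t))\<^sup>2 - l * (cross' t + cross2' t / 4))"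
  have E_deriv: "(E has_real_derivative E' t) (at t within {0..})" if "0 \<le> t" for t
    unfolding E_def E'_def
    by (intro DERIV_diff DERIV_cmult DERIV_add DERIV_cdivide e0_t cross_deriv cross2_deriv that)
  have E_bounds: "N2 t \<le> 8 * E t" "E t \<le> 2 * N2 t" if t: "0 \<le> t" for t
  proof -
    define w where "w = l * (cross t + cross2 t / 4)"
    have "\<bar>w\<bar> \<le> l * ((2 + 3 * a) * N2 t)"
      unfolding w_def using l(1) cross_bound[of t] by (simp add: abs_mult)
    also have "\<dots> \<le> 1 / 8 * N2 t" unfolding mult.assoc[symmetric] by (rule mult_right_mono[OF l(2) N2_nonneg])
    finally have "\<bar>w\<bar> \<le> N2 t / 8" by simp
    moreover have "N2 t / 4 \<le> e0 t" "e0 t \<le> N2 t" using e0_bounds[OF t] by (auto simp: N2_def)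
    ultimately show "N2 t \<le> 8 * E t" "E t \<le> 2 * N2 t" unfolding E_def w_def[symmetric] right_diff_distrib using N2_nonneg[of t] by linarith+
  qed
  define D where "D = (\<lambda>t. (norm (dres 1 (v t)))\<^sup>2 + (norm (dres 1 (u t)))\<^sup>2
      + (norm (dres 1 (z t)))\<^sup>2 + (norm (dres 1 (y t)))\<^sup>2)"
  have diss: "E' t \<le> - c * D t" if t: "0 \<le> t" for t
  proof -
    note ids = dissipation_identities[OF dx(1-4)[OF t] yt_def G_small[OF t] a \<gamma> e, folded cross'_def cross2'_def]
    have r: "res 1 (ux t) = dres 1 (u t)" "res 1 (zx t) = dres 1 (z t)"
      using dx[OF t] by (auto intro: res_deriv)
    have "E' t = - \<gamma> * (norm (y t))\<^sup>2 - l * cross' t - l / 4 * cross2' t"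
      unfolding E'_def by (simp add: algebra_simps)
    also have "\<dots> \<le> - c * ((norm (y t))\<^sup>2 + (norm (J (v t)))\<^sup>2 + (norm (J (zx t)))\<^sup>2 + (norm (res 1 (ux t)))\<^sup>2)"
      by (rule lyap[OF _ _ _ _ ids]) auto
    also have "\<dots> \<le> - c * D t"
    proof -
      have "(norm (dres 1 (y t)))\<^sup>2 \<le> (norm (y t))\<^sup>2" "(norm (dres 1 (v t)))\<^sup>2 \<le> (norm (J (v t)))\<^sup>2"
        "(norm (dres 1 (z t)))\<^sup>2 \<le> (norm (J (zx t)))\<^sup>2"
        unfolding r(2)[symmetric]
        by (intro power_mono norm_dres_le norm_dres_le_J norm_res_le_J norm_ge_zero)+
      then have "D t \<le> (norm (y t))\<^sup>2 + (norm (J (v t)))\<^sup>2 + (norm (J (zx t)))\<^sup>2 + (norm (res 1 (ux t)))\<^sup>2"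
        unfolding D_def r by linarith
      then show ?thesis using c by simp
    qed
    finally show ?thesis .
  qed
  define b where "b = (\<lambda>t. K / sqrt (1 + k * t))"
  define b' where "b' = (\<lambda>t. - (K * k) / (2 * (1 + k * t) * sqrt (1 + k * t)))"
  have "E t \<le> b t"
  proof (rule first_crossing[OF E_deriv _ _ _ t])
    fix t :: real assume t: "0 \<le> t"
    have sq: "sqrt (1 + k * t) * sqrt (1 + k * t) = 1 + k * t" using kp[OF t] by simp
    have "(b has_real_derivative (0 * sqrt (1 + k * t) - K * ((inverse (sqrt (1 + k * t)) / 2) * k)) / (sqrt (1 + k * t) * sqrt (1 + k * t))) (at t within {0..})"
      unfolding b_def using kp(2)[OF t]
      by (auto intro!: derivative_eq_intros DERIV_real_sqrt)
    also have "(0 * sqrt (1 + k * t) - K * ((inverse (sqrt (1 + k * t)) / 2) * k)) / (sqrt (1 + k * t) * sqrt (1 + k * t)) = b' t"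
      unfolding sq b'_def using kp(2)[OF t] by (simp add: field_simps)
    finally show "(b has_real_derivative b' t) (at t within {0..})" .
  next
    have "E 0 \<le> 2 * (m * I)\<^sup>2" using E_bounds(2)[of 0] H1_bound(1)[of 0] by (simp add: N2_def)
    also have "\<dots> = (2 * m\<^sup>2) * I\<^sup>2" by (simp add: power_mult_distrib)
    also have "\<dots> < L * I\<^sup>2"
      using I zero_le_power2[of m] by (intro mult_strict_right_mono) (simp_all add: L_def add_nonneg_pos)
    finally show "E 0 < b 0" by (simp add: b_def K_def)
  next
    fix t :: real assume t: "0 < t" and prev: "\<And>r. 0 \<le> r \<Longrightarrow> r \<le> t \<Longrightarrow> E r \<le> b r" and eq: "E t = b t"
    define s where "s = 1 + k * t"
    have s: "1 \<le> s" "0 < s" using kp[of t] t by (auto simp: s_def)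
    have sqs: "1 \<le> sqrt s" "sqrt s \<le> s" using s by (auto simp: real_le_lsqrt power2_eq_square)
    have "low s t \<le> (2 * I + 2 * Cg * (8 * K) / k)\<^sup>2 / sqrt s"
      unfolding s_def
    \<comment> \<open>Up to time \<open>t\<close> the barrier gives \<open>\<parallel>z\<parallel>\<^sup>2 \<le> 8 E \<le> 8 b\<close>, so \<open>low_bound\<close> applies with \<open>8 K\<close>.\<close>
    proof (rule low_bound[OF k])
      fix r assume r: "0 \<le> r" "r \<le> t"
      have "(norm (z r))\<^sup>2 \<le> N2 r" by (simp add: N2_def)
      also have "\<dots> \<le> 8 * E r" using E_bounds(1) r by simp
      also have "\<dots> \<le> 8 * b r" using prev[OF r] by simp
      finally show "(norm (z r))\<^sup>2 \<le> 8 * K / sqrt (1 + k * r)" by (simp add: b_def)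
    qed (use K t in auto)
    also have "\<dots> \<le> (3 * I)\<^sup>2 / sqrt s"
    proof (rule divide_right_mono[OF power_mono])
      have "2 * Cg * (8 * K) / k = (16 * Cg * L * I) / k * I" by (simp add: K_def power2_eq_square)
      also have "\<dots> \<le> 1 * I"
        using small k I unfolding L_def[symmetric] k_def[symmetric] by (intro mult_right_mono) auto
      finally show "2 * I + 2 * Cg * (8 * K) / k \<le> 3 * I" by simp
      show "0 \<le> 2 * I + 2 * Cg * (8 * K) / k" using I Cg K k by simp
    qed (use s in simp)
    finally have low: "low s t \<le> 9 * I\<^sup>2 / sqrt s" by (simp add: power_mult_distrib)
    have N2: "K / (2 * sqrt s) \<le> N2 t"
      using E_bounds(2)[of t] t eq by (simp add: b_def s_def field_simps)
    have "N2 t \<le> 6 * (low s t + s * D t + (m * I)\<^sup>2 / s)"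
    proof -
      have "0 \<le> t" using t by simp
      note ip = interpolation[OF s(1) dx(1)[OF this]] interpolation[OF s(1) dx(2)[OF this]]
        interpolation[OF s(1) dx(3)[OF this]] interpolation[OF s(1) dx(4)[OF this]]
      have "N2 t \<le> 6 * (low s t + s * D t + ((norm (vx t))\<^sup>2 + (norm (ux t))\<^sup>2 + (norm (zx t))\<^sup>2 + (norm (yx t))\<^sup>2) / s)"
        unfolding N2_def low_def D_def using ip by (simp add: algebra_simps add_divide_distrib)
      also have "\<dots> \<le> 6 * (low s t + s * D t + (m * I)\<^sup>2 / s)"
        using H1_bound(2)[of t] t s by (simp add: divide_right_mono)
      finally show ?thesis .
    qed
    moreover have "(m * I)\<^sup>2 / s \<le> m\<^sup>2 * I\<^sup>2 / sqrt s"
      using sqs s by (simp add: power_mult_distrib frac_le)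
    ultimately have "K / (2 * sqrt s) \<le> 6 * (9 * I\<^sup>2 / sqrt s + s * D t + m\<^sup>2 * I\<^sup>2 / sqrt s)"
      using N2 low unfolding distrib_left by linarith
    moreover have "K / (2 * sqrt s) = 12 * (10 + m\<^sup>2) * I\<^sup>2 / sqrt s"
    proof -
      have "K = 2 * (12 * (10 + m\<^sup>2) * I\<^sup>2)" by (simp add: K_def L_def algebra_simps)
      then show ?thesis by simp
    qed
    moreover define X Y where "X = I\<^sup>2 / sqrt s" and "Y = m\<^sup>2 * I\<^sup>2 / sqrt s"
    moreover have "9 * I\<^sup>2 / sqrt s = 9 * X" by (simp add: X_def)
    moreover have "12 * (10 + m\<^sup>2) * I\<^sup>2 / sqrt s = 120 * X + 12 * Y"
      by (simp add: X_def Y_def add_divide_distrib algebra_simps)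
    moreover have "(10 + m\<^sup>2) * I\<^sup>2 / sqrt s = 10 * X + Y"
      by (simp add: X_def Y_def add_divide_distrib algebra_simps)
    moreover have "0 < X" using I s by (simp add: X_def)
    moreover have "p < r" if "h \<le> 6 * (n + r + Y)" "h = q" "n = 9 * X" "q = 120 * X + 12 * Y"
      "p = 10 * X + Y" "0 < X" for h n p q r X Y :: real
      using that by simp
    ultimately have "(10 + m\<^sup>2) * I\<^sup>2 / sqrt s < s * D t" by blast
    moreover have "K / 24 = (10 + m\<^sup>2) * I\<^sup>2" by (simp add: K_def L_def)
    ultimately have "K / 24 / sqrt s < s * D t" by simp
    then have "K / 24 / sqrt s / s < D t"
      using s by (subst pos_divide_less_eq) (simp_all add: mult.commute)
    then have "- c * D t < - c * (K / 24 / sqrt s / s)"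
      using c by (intro mult_strict_left_mono_neg) auto
    also have "\<dots> = b' t"
    proof -
      have "b' t = - (K * k) / (2 * s * sqrt s)" by (simp only: b'_def s_def)
      then show ?thesis unfolding k_def by (simp add: mult.commute)
    qed
    finally show "E' t < b' t" using diss[of t] t by simp
  qed
  then have "N2 t \<le> 8 * (K / sqrt (1 + k * t))" using E_bounds(1)[OF t] unfolding b_def by linarith
  then show ?thesis unfolding K_def L_def k_def by (simp only: times_divide_eq_right mult.assoc)
qed

end

section \<open>Iterated derivatives and Schwartz functions\<close>

lemma nderiv_0: "nderiv 0 f = f" by (simp add: nderiv_def)

lemma nderiv_Suc: "nderiv (Suc n) f = (\<lambda>x. vector_derivative (nderiv n f) (at x))"
  by (simp add: nderiv_def)

lemma nderiv_has_derivative: "smooth f \<Longrightarrow> (nderiv k f has_vector_derivative nderiv (Suc k) f x) (at x)"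
  unfolding smooth_def nderiv_Suc by (simp add: vector_derivative_works[symmetric])

text \<open>The rules for iterated derivatives below come from exhibiting the whole sequence of derivatives.\<close>

lemma nderiv_eqI:
  assumes "\<And>k x. (F k has_vector_derivative F (Suc k) x) (at x)"
  shows "nderiv k (F 0) = F k" "smooth (F 0)"
proof -
  show n: "nderiv k (F 0) = F k" for k
  proof (induction k)
    case (Suc k)
    show ?case unfolding nderiv_Suc Suc using assms by (auto simp: vector_derivative_at)
  qed (simp add: nderiv_0)
  show "smooth (F 0)"
    unfolding smooth_def n using assms by (auto intro: differentiableI_vector)
qed

lemma nderiv_cmult:
  fixes f :: "real \<Rightarrow> complex"
  assumes f: "smooth f"
  shows "nderiv k (\<lambda>x. c * f x) = (\<lambda>x. c * nderiv k f x)" "smooth (\<lambda>x. c * f x)"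
  using nderiv_eqI[of "\<lambda>k x. c * nderiv k f x"] nderiv_has_derivative[OF f]
  by (simp_all add: nderiv_0 has_vector_derivative_mult_right)

lemma nderiv_add:
  assumes f: "smooth f" and g: "smooth g"
  shows "nderiv k (\<lambda>x. f x + g x) = (\<lambda>x. nderiv k f x + nderiv k g x)" "smooth (\<lambda>x. f x + g x)"
  using nderiv_eqI[of "\<lambda>k x. nderiv k f x + nderiv k g x"] nderiv_has_derivative[OF f] nderiv_has_derivative[OF g]
  by (simp_all add: nderiv_0 has_vector_derivative_add)

lemma nderiv_compose_scale:
  assumes f: "smooth f"
  shows "nderiv k (\<lambda>x. f (c * x)) = (\<lambda>x. c ^ k *\<^sub>R nderiv k f (c * x))" "smooth (\<lambda>x. f (c * x))"
proof -
  have *: "((\<lambda>x. c ^ k *\<^sub>R nderiv k f (c * x)) has_vector_derivative c ^ Suc k *\<^sub>R nderiv (Suc k) f (c * x)) (at x)" for k x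
  proof -
    have "((nderiv k f \<circ> (\<lambda>x. c * x)) has_vector_derivative c *\<^sub>R nderiv (Suc k) f (c * x)) (at x)"
      by (rule vector_diff_chain_at)
        (auto intro!: derivative_eq_intros nderiv_has_derivative f simp flip: has_real_derivative_iff_has_vector_derivative)
    from bounded_linear.has_vector_derivative[OF bounded_linear_scaleR_right this, of "c ^ k"]
    show ?thesis by (simp add: o_def mult.commute)
  qed
  from nderiv_eqI[of "\<lambda>k x. c ^ k *\<^sub>R nderiv k f (c * x)", OF *]
  show "nderiv k (\<lambda>x. f (c * x)) = (\<lambda>x. c ^ k *\<^sub>R nderiv k f (c * x))" "smooth (\<lambda>x. f (c * x))"
    by (simp_all add: nderiv_0)
qed

lemma leibniz:
  fixes m :: "real \<Rightarrow> real" and f :: "real \<Rightarrow> 'a::real_normed_vector"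
  assumes m: "smooth m" and f: "smooth f"
  shows "nderiv k (\<lambda>x. m x *\<^sub>R f x) = (\<lambda>x. \<Sum>i\<le>k. of_nat (k choose i) *\<^sub>R (nderiv i m x *\<^sub>R nderiv (k - i) f x))"
    and "smooth (\<lambda>x. m x *\<^sub>R f x)"
proof -
  define F where "F = (\<lambda>k x. \<Sum>i\<le>k. of_nat (k choose i) *\<^sub>R (nderiv i m x *\<^sub>R nderiv (k - i) f x))"
  have *: "(F k has_vector_derivative F (Suc k) x) (at x)" for k x
  proof -
    define p where "p = (\<lambda>i j. nderiv i m x *\<^sub>R nderiv j f x)"
    have d: "((\<lambda>x. nderiv i m x *\<^sub>R nderiv j f x) has_vector_derivative p i (Suc j) + p (Suc i) j) (at x)" for i j
      unfolding p_def
      by (rule bounded_bilinear.has_vector_derivative[OF bounded_bilinear_scaleR nderiv_has_derivative[OF m] nderiv_has_derivative[OF f]])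
    have "(F k has_vector_derivative (\<Sum>i\<le>k. of_nat (k choose i) *\<^sub>R (p i (Suc (k - i)) + p (Suc i) (k - i)))) (at x)"
      unfolding F_def
      by (intro has_vector_derivative_sum bounded_linear.has_vector_derivative[OF bounded_linear_scaleR_right] d)
    also have "(\<Sum>i\<le>k. of_nat (k choose i) *\<^sub>R (p i (Suc (k - i)) + p (Suc i) (k - i)))
      = (\<Sum>i\<le>k. of_nat (k choose i) *\<^sub>R p i (Suc k - i)) + (\<Sum>i\<le>k. of_nat (k choose i) *\<^sub>R p (Suc i) (k - i))"
      by (simp add: scaleR_add_right sum.distrib Suc_diff_le)
    also have "(\<Sum>i\<le>k. of_nat (k choose i) *\<^sub>R p i (Suc k - i)) = (\<Sum>i\<le>Suc k. of_nat (k choose i) *\<^sub>R p i (Suc k - i))"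
      by simp
    also have "\<dots> = p 0 (Suc k) + (\<Sum>i\<le>k. of_nat (k choose Suc i) *\<^sub>R p (Suc i) (k - i))"
      by (subst sum.atMost_Suc_shift) simp
    also have "p 0 (Suc k) + (\<Sum>i\<le>k. of_nat (k choose Suc i) *\<^sub>R p (Suc i) (k - i))
        + (\<Sum>i\<le>k. of_nat (k choose i) *\<^sub>R p (Suc i) (k - i))
      = p 0 (Suc k) + (\<Sum>i\<le>k. of_nat (Suc k choose Suc i) *\<^sub>R p (Suc i) (k - i))"
      by (simp add: sum.distrib[symmetric] scaleR_add_left[symmetric] add.assoc add.commute)
    also have "\<dots> = (\<Sum>i\<le>Suc k. of_nat (Suc k choose i) *\<^sub>R p i (Suc k - i))"
      by (subst sum.atMost_Suc_shift) simp
    also have "\<dots> = F (Suc k) x" by (simp only: F_def p_def)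
    finally show ?thesis .
  qed
  have F0: "F 0 = (\<lambda>x. m x *\<^sub>R f x)" by (simp add: F_def nderiv_0)
  from nderiv_eqI[of F, OF *]
  show "nderiv k (\<lambda>x. m x *\<^sub>R f x) = (\<lambda>x. \<Sum>i\<le>k. of_nat (k choose i) *\<^sub>R (nderiv i m x *\<^sub>R nderiv (k - i) f x))"
    and "smooth (\<lambda>x. m x *\<^sub>R f x)" unfolding F0 by (simp_all add: F_def)
qed

lemma leibniz_bound:
  fixes m :: "real \<Rightarrow> real" and f :: "real \<Rightarrow> 'a::real_normed_vector"
  assumes m: "smooth m" and f: "smooth f"
    and mb: "\<And>i. i \<le> k \<Longrightarrow> \<bar>nderiv i m x\<bar> \<le> A" and fb: "\<And>i. i \<le> k \<Longrightarrow> norm (nderiv i f x) \<le> B"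
  shows "norm (nderiv k (\<lambda>x. m x *\<^sub>R f x) x) \<le> 2 ^ k * (A * B)"
proof -
  have A: "0 \<le> A" using mb[of 0] by (meson abs_ge_zero order_trans le0)
  have "norm (nderiv k (\<lambda>x. m x *\<^sub>R f x) x) \<le> (\<Sum>i\<le>k. of_nat (k choose i) * (A * B))"
    unfolding leibniz(1)[OF m f]
  proof (rule sum_norm_le)
    fix i assume "i \<in> {..k}"
    then have i: "i \<le> k" by simp
    have "\<bar>nderiv i m x\<bar> * norm (nderiv (k - i) f x) \<le> A * B"
      by (rule mult_mono[OF mb[OF i] fb A]) auto
    then show "norm (real (k choose i) *\<^sub>R (nderiv i m x *\<^sub>R nderiv (k - i) f x)) \<le> real (k choose i) * (A * B)"
      by (simp add: abs_mult mult.assoc mult_left_mono)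
  qed
  also have "\<dots> = real (\<Sum>i\<le>k. k choose i) * (A * B)" by (simp add: sum_distrib_right)
  also have "(\<Sum>i\<le>k. k choose i) = 2 ^ k" by (rule choose_row_sum)
  finally show ?thesis by simp
qed

text \<open>Powers of \<open>1 + \<bar>x\<bar>\<close> can be divided by, unlike those of \<open>x\<close>, and one estimate then covers bounded and
large arguments.\<close>

lemma schwartz_iff:
  "\<psi> \<in> schwartz \<longleftrightarrow> smooth \<psi> \<and> (\<forall>k N. \<exists>C. \<forall>x. (1 + \<bar>x\<bar>) ^ N * norm (nderiv k \<psi> x) \<le> C)"
proof
  assume p: "\<psi> \<in> schwartz"
  have "\<exists>C. \<forall>x. (1 + \<bar>x\<bar>) ^ N * norm (nderiv k \<psi> x) \<le> C" for k N
  proof -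
    from p have "bounded (range (\<lambda>x. x ^ N *\<^sub>R nderiv k \<psi> x))" "bounded (range (\<lambda>x. x ^ 0 *\<^sub>R nderiv k \<psi> x))"
      by (auto simp only: schwartz_def)
    then obtain A B where A: "\<And>x. norm (x ^ N *\<^sub>R nderiv k \<psi> x) \<le> A" and B: "\<And>x. norm (nderiv k \<psi> x) \<le> B"
      by (auto simp: bounded_iff)
    have "(1 + \<bar>x\<bar>) ^ N * norm (nderiv k \<psi> x) \<le> 2 ^ N * (A + B)" for x
    proof -
      have "(1 + \<bar>x\<bar>) ^ N \<le> 2 ^ N * (1 + \<bar>x\<bar> ^ N)"
      proof (cases "\<bar>x\<bar> \<le> 1")
        case True
        then have "(1 + \<bar>x\<bar>) ^ N \<le> 2 ^ N" by (intro power_mono) auto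
        moreover have "2 ^ N * 1 \<le> 2 ^ N * (1 + \<bar>x\<bar> ^ N)" by (rule mult_left_mono) auto
        ultimately show ?thesis by linarith
      next
        case False
        then have "(1 + \<bar>x\<bar>) ^ N \<le> (2 * \<bar>x\<bar>) ^ N" by (intro power_mono) auto
        then show ?thesis by (simp add: power_mult_distrib algebra_simps add_increasing)
      qed
      then have "(1 + \<bar>x\<bar>) ^ N * norm (nderiv k \<psi> x) \<le> 2 ^ N * (1 + \<bar>x\<bar> ^ N) * norm (nderiv k \<psi> x)"
        by (rule mult_right_mono) simp
      also have "\<dots> = 2 ^ N * (norm (x ^ N *\<^sub>R nderiv k \<psi> x) + norm (nderiv k \<psi> x))"
        by (simp add: algebra_simps power_abs)
      also have "\<dots> \<le> 2 ^ N * (A + B)" using A[of x] B[of x] by (intro mult_left_mono add_mono) auto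
      finally show ?thesis .
    qed
    then show ?thesis by blast
  qed
  then show "smooth \<psi> \<and> (\<forall>k N. \<exists>C. \<forall>x. (1 + \<bar>x\<bar>) ^ N * norm (nderiv k \<psi> x) \<le> C)"
    using p by (auto simp: schwartz_def)
next
  assume p: "smooth \<psi> \<and> (\<forall>k N. \<exists>C. \<forall>x. (1 + \<bar>x\<bar>) ^ N * norm (nderiv k \<psi> x) \<le> C)"
  have "bounded (range (\<lambda>x. x ^ j *\<^sub>R nderiv k \<psi> x))" for j k
  proof -
    from p obtain C where C: "\<And>x. (1 + \<bar>x\<bar>) ^ j * norm (nderiv k \<psi> x) \<le> C" by blast
    have "norm (x ^ j *\<^sub>R nderiv k \<psi> x) \<le> C" for x
    proof -
      have "\<bar>x\<bar> ^ j * norm (nderiv k \<psi> x) \<le> (1 + \<bar>x\<bar>) ^ j * norm (nderiv k \<psi> x)"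
        by (intro mult_right_mono power_mono) auto
      then show ?thesis using C[of x] by (simp add: power_abs)
    qed
    then show ?thesis by (auto simp: bounded_iff)
  qed
  then show "\<psi> \<in> schwartz" using p by (auto simp: schwartz_def)
qed

lemma schwartz_smooth: "\<psi> \<in> schwartz \<Longrightarrow> smooth \<psi>" by (simp add: schwartz_def)

lemma schwartz_decay: "\<psi> \<in> schwartz \<Longrightarrow> \<exists>C. \<forall>x. (1 + \<bar>x\<bar>) ^ N * norm (nderiv k \<psi> x) \<le> C"
  by (simp add: schwartz_iff)

lemma schwartz_nderiv: assumes "\<psi> \<in> schwartz" shows "nderiv j \<psi> \<in> schwartz"
proof -
  have n: "nderiv k (nderiv j \<psi>) = nderiv (k + j) \<psi>" for k
    by (simp add: nderiv_def funpow_add)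
  show ?thesis using assms unfolding schwartz_iff n by (simp add: smooth_def n)
qed

lemma schwartz_cmult: "\<psi> \<in> schwartz \<Longrightarrow> (\<lambda>x. c * \<psi> x) \<in> schwartz"
  unfolding schwartz_iff
proof (intro conjI allI)
  assume p: "smooth \<psi> \<and> (\<forall>k N. \<exists>C. \<forall>x. (1 + \<bar>x\<bar>) ^ N * cmod (nderiv k \<psi> x) \<le> C)"
  then show "smooth (\<lambda>x. c * \<psi> x)" by (simp add: nderiv_cmult)
  fix k N
  from p obtain C where C: "\<And>x. (1 + \<bar>x\<bar>) ^ N * cmod (nderiv k \<psi> x) \<le> C" by blast
  have "(1 + \<bar>x\<bar>) ^ N * cmod (nderiv k (\<lambda>x. c * \<psi> x) x) \<le> cmod c * C" for x
    using mult_left_mono[OF C[of x], of "cmod c"] p by (simp add: nderiv_cmult norm_mult mult.left_commute)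
  then show "\<exists>C. \<forall>x. (1 + \<bar>x\<bar>) ^ N * cmod (nderiv k (\<lambda>x. c * \<psi> x) x) \<le> C" by blast
qed

lemma schwartz_add: assumes p: "\<psi> \<in> schwartz" and q: "\<eta> \<in> schwartz" shows "(\<lambda>x. \<psi> x + \<eta> x) \<in> schwartz"
  unfolding schwartz_iff
proof (intro conjI allI)
  note s = schwartz_smooth[OF p] schwartz_smooth[OF q]
  show "smooth (\<lambda>x. \<psi> x + \<eta> x)" using s by (rule nderiv_add)
  fix k N
  obtain C where C: "\<And>x. (1 + \<bar>x\<bar>) ^ N * cmod (nderiv k \<psi> x) \<le> C" using schwartz_decay[OF p] by blast
  obtain D where D: "\<And>x. (1 + \<bar>x\<bar>) ^ N * cmod (nderiv k \<eta> x) \<le> D" using schwartz_decay[OF q] by blast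
  have "(1 + \<bar>x\<bar>) ^ N * cmod (nderiv k (\<lambda>x. \<psi> x + \<eta> x) x) \<le> C + D" for x
  proof -
    have "(1 + \<bar>x\<bar>) ^ N * cmod (nderiv k \<psi> x + nderiv k \<eta> x) \<le> (1 + \<bar>x\<bar>) ^ N * (cmod (nderiv k \<psi> x) + cmod (nderiv k \<eta> x))"
      by (intro mult_left_mono norm_triangle_ineq) simp
    then show ?thesis using C[of x] D[of x] by (simp add: nderiv_add[OF s] distrib_left)
  qed
  then show "\<exists>C. \<forall>x. (1 + \<bar>x\<bar>) ^ N * cmod (nderiv k (\<lambda>x. \<psi> x + \<eta> x) x) \<le> C" by blast
qed

text \<open>Smooth functions all of whose derivatives grow at most polynomially: the multipliers of Schwartz functions.\<close>

definition moderate :: "(real \<Rightarrow> real) \<Rightarrow> bool" where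
  "moderate m \<longleftrightarrow> smooth m \<and> (\<forall>k. \<exists>N C. \<forall>x. \<bar>nderiv k m x\<bar> \<le> C * (1 + \<bar>x\<bar>) ^ N)"

lemma schwartz_decay_upto: assumes "\<psi> \<in> schwartz"
  shows "\<exists>C. \<forall>x. \<forall>i\<le>k. (1 + \<bar>x\<bar>) ^ N * norm (nderiv i \<psi> x) \<le> C"
proof -
  obtain C where C: "\<And>i x. (1 + \<bar>x\<bar>) ^ N * norm (nderiv i \<psi> x) \<le> C i"
    using schwartz_decay[OF assms] by metis
  have "(1 + \<bar>x\<bar>) ^ N * norm (nderiv i \<psi> x) \<le> (\<Sum>i\<le>k. \<bar>C i\<bar>)" if "i \<le> k" for i x
    using C[of x i] member_le_sum[of i "{..k}" "\<lambda>i. \<bar>C i\<bar>"] that by force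
  then show ?thesis by blast
qed

lemma moderate_upto: assumes "moderate m"
  shows "\<exists>C N. 0 \<le> C \<and> (\<forall>x. \<forall>i\<le>k. \<bar>nderiv i m x\<bar> \<le> C * (1 + \<bar>x\<bar>) ^ N)"
proof -
  obtain C N where C: "\<And>i x. \<bar>nderiv i m x\<bar> \<le> C i * (1 + \<bar>x\<bar>) ^ N i"
    using assms unfolding moderate_def by metis
  have "\<bar>nderiv i m x\<bar> \<le> (\<Sum>i\<le>k. \<bar>C i\<bar>) * (1 + \<bar>x\<bar>) ^ (\<Sum>i\<le>k. N i)" if "i \<le> k" for i x
  proof -
    have "\<bar>nderiv i m x\<bar> \<le> C i * (1 + \<bar>x\<bar>) ^ N i" by (rule C)
    also have "\<dots> \<le> (\<Sum>i\<le>k. \<bar>C i\<bar>) * (1 + \<bar>x\<bar>) ^ (\<Sum>i\<le>k. N i)"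
    proof (rule mult_mono)
      show "C i \<le> (\<Sum>i\<le>k. \<bar>C i\<bar>)" using member_le_sum[of i "{..k}" "\<lambda>i. \<bar>C i\<bar>"] that by force
      show "(1 + \<bar>x\<bar>) ^ N i \<le> (1 + \<bar>x\<bar>) ^ (\<Sum>i\<le>k. N i)"
        using member_le_sum[of i "{..k}" N] that by (intro power_increasing) auto
    qed (auto intro: sum_nonneg)
    finally show ?thesis .
  qed
  then show ?thesis by (intro exI[of _ "\<Sum>i\<le>k. \<bar>C i\<bar>"] exI[of _ "\<Sum>i\<le>k. N i"]) (auto intro: sum_nonneg)
qed

lemma schwartz_mult: assumes m: "moderate m" and p: "\<psi> \<in> schwartz"
  shows "(\<lambda>x. m x *\<^sub>R \<psi> x) \<in> schwartz"
  unfolding schwartz_iff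
proof (intro conjI allI)
  have s: "smooth m" "smooth \<psi>" using m p by (auto simp: moderate_def schwartz_smooth)
  show "smooth (\<lambda>x. m x *\<^sub>R \<psi> x)" using s by (rule leibniz)
  fix k N
  obtain A M where A: "0 \<le> A" "\<And>x i. i \<le> k \<Longrightarrow> \<bar>nderiv i m x\<bar> \<le> A * (1 + \<bar>x\<bar>) ^ M"
    using moderate_upto[OF m] by blast
  obtain B where B: "\<And>x i. i \<le> k \<Longrightarrow> (1 + \<bar>x\<bar>) ^ (M + N) * norm (nderiv i \<psi> x) \<le> B"
    using schwartz_decay_upto[OF p] by blast
  have "(1 + \<bar>x\<bar>) ^ N * norm (nderiv k (\<lambda>x. m x *\<^sub>R \<psi> x) x) \<le> 2 ^ k * (A * B)" for x
  proof -
    have "norm (nderiv k (\<lambda>x. m x *\<^sub>R \<psi> x) x) \<le> 2 ^ k * ((A * (1 + \<bar>x\<bar>) ^ M) * (B / (1 + \<bar>x\<bar>) ^ (M + N)))"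
      by (rule leibniz_bound[OF s A(2)]) (use B[of _ x] in \<open>auto simp: pos_le_divide_eq mult.commute\<close>)
    also have "\<dots> = 2 ^ k * (A * B) / (1 + \<bar>x\<bar>) ^ N"
    proof -
      have "1 + \<bar>x\<bar> \<noteq> 0" by (rule less_imp_neq[symmetric]) simp
      then show ?thesis by (simp add: power_add)
    qed
    finally show ?thesis by (simp add: pos_le_divide_eq mult.commute)
  qed
  then show "\<exists>C. \<forall>x. (1 + \<bar>x\<bar>) ^ N * cmod (nderiv k (\<lambda>x. m x *\<^sub>R \<psi> x) x) \<le> C" by blast
qed

lemma moderate_id: "moderate (\<lambda>x. x)"
proof -
  define F :: "nat \<Rightarrow> real \<Rightarrow> real" where "F = (\<lambda>k x. if k = 0 then x else if k = 1 then 1 else 0)"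
  have "(F k has_vector_derivative F (Suc k) x) (at x)" for k x
    unfolding F_def has_real_derivative_iff_has_vector_derivative[symmetric]
    by (cases "k = 0") (auto intro!: derivative_eq_intros)
  from nderiv_eqI[of F, OF this] have F: "nderiv k (\<lambda>x. x) = F k" "smooth (\<lambda>x::real. x)" for k
    by (simp_all add: F_def)
  have "\<bar>F k x\<bar> \<le> 1 * (1 + \<bar>x\<bar>) ^ 1" for k x by (simp add: F_def)
  then show ?thesis unfolding moderate_def F(1) using F(2) by blast
qed

lemma compact_support_bounded:
  fixes m :: "real \<Rightarrow> 'a::real_normed_vector"
  assumes m: "smooth m" and supp: "{x. m x \<noteq> 0} \<subseteq> {x. \<bar>x\<bar> \<le> R}"
  shows "\<exists>C. \<forall>x. norm (nderiv k m x) \<le> C" "R < \<bar>x\<bar> \<Longrightarrow> nderiv k m x = 0"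
proof -
  show z: "nderiv k m x = 0" if "R < \<bar>x\<bar>" for k x
    using that
  proof (induction k arbitrary: x)
    case 0 then show ?case using supp by (force simp: nderiv_0)
  next
    case (Suc k)
    have op: "open {x. R < \<bar>x\<bar>}" by (intro open_Collect_less continuous_intros)
    have "((\<lambda>x. 0) has_vector_derivative 0) (at x)" by simp
    then have "(nderiv k m has_vector_derivative 0) (at x)"
      by (rule has_vector_derivative_transform_within_open[OF _ op]) (use Suc in auto)
    then show ?case unfolding nderiv_Suc by (rule vector_derivative_at)
  qed
  have "continuous_on {- \<bar>R\<bar>..\<bar>R\<bar>} (\<lambda>x. norm (nderiv k m x))"
    by (intro continuous_on_norm continuous_at_imp_continuous_on ballI)
      (rule has_vector_derivative_continuous[OF nderiv_has_derivative[OF m]])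
  then have "bounded ((\<lambda>x. norm (nderiv k m x)) ` {- \<bar>R\<bar>..\<bar>R\<bar>})"
    by (rule compact_imp_bounded[OF compact_continuous_image]) simp
  then obtain C where "\<forall>x\<in>{- \<bar>R\<bar>..\<bar>R\<bar>}. norm (nderiv k m x) \<le> C"
    unfolding bounded_iff by auto
  then have C: "\<bar>x\<bar> \<le> \<bar>R\<bar> \<Longrightarrow> norm (nderiv k m x) \<le> C" for x by (simp add: abs_le_iff minus_le_iff)
  have "norm (nderiv k m x) \<le> max C 0" for x
    using C[of x] z[of x k] by (cases "\<bar>x\<bar> \<le> \<bar>R\<bar>") auto
  then show "\<exists>C. \<forall>x. norm (nderiv k m x) \<le> C" by blast
qed

lemma moderate_compact_support:
  assumes "smooth m" "{x. m x \<noteq> 0} \<subseteq> {x. \<bar>x\<bar> \<le> R}"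
  shows "moderate m"
  unfolding moderate_def
proof (intro conjI allI)
  fix k
  obtain C where "\<And>x. norm (nderiv k m x) \<le> C" using compact_support_bounded(1)[OF assms] by blast
  then have "\<bar>nderiv k m x\<bar> \<le> C * (1 + \<bar>x\<bar>) ^ 0" for x by simp
  then show "\<exists>N C. \<forall>x. \<bar>nderiv k m x\<bar> \<le> C * (1 + \<bar>x\<bar>) ^ N" by blast
qed (rule assms)

section \<open>The Fourier transform on Schwartz functions\<close>

lemma integrable_inverse_1_plus_sq: "integrable lborel (\<lambda>x::real. 1 / (1 + x\<^sup>2))"
  using integrable_inverse_1_plus_square by (simp add: set_integrable_def inverse_eq_divide)

lemma schwartz_continuous: "\<psi> \<in> schwartz \<Longrightarrow> continuous_on UNIV \<psi>"
  using nderiv_has_derivative[of \<psi> 0] schwartz_smooth[of \<psi>]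
  by (auto simp: nderiv_0 intro!: continuous_at_imp_continuous_on has_vector_derivative_continuous)

lemma schwartz_measurable: "\<psi> \<in> schwartz \<Longrightarrow> \<psi> \<in> borel_measurable borel"
  by (rule borel_measurable_continuous_onI[OF schwartz_continuous])

text \<open>The quantitative form, with a constant that does not depend on \<open>f\<close>, serves to show convergence of sequences of
Fourier transforms.\<close>

lemma integrable_decay:
  fixes f :: "real \<Rightarrow> 'a::{banach, second_countable_topology}"
  assumes m: "f \<in> borel_measurable borel" and b: "\<And>x. (1 + \<bar>x\<bar>) ^ 2 * norm (f x) \<le> C"
  shows "integrable lborel f" "(LINT x|lborel. norm (f x)) \<le> C * (LINT x|lborel. 1 / (1 + x\<^sup>2))"
proof -
  have le: "norm (f x) \<le> C * (1 / (1 + x\<^sup>2))" for x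
  proof -
    have "1 + x\<^sup>2 \<le> (1 + \<bar>x\<bar>)\<^sup>2" by (simp add: power2_sum)
    then have "(1 + x\<^sup>2) * norm (f x) \<le> (1 + \<bar>x\<bar>)\<^sup>2 * norm (f x)" by (rule mult_right_mono) simp
    also have "\<dots> \<le> C" by (rule b)
    finally have "norm (f x) * (1 + x\<^sup>2) \<le> C" by (simp add: mult.commute)
    moreover have "0 < 1 + x\<^sup>2" by (simp add: add_pos_nonneg)
    ultimately show ?thesis by (simp add: pos_le_divide_eq)
  qed
  have C: "0 \<le> C" using order_trans[OF _ b[of 0]] by simp
  have i: "integrable lborel (\<lambda>x. C * (1 / (1 + x\<^sup>2)))"
    by (rule integrable_mult_right) (rule integrable_inverse_1_plus_sq)
  have m': "f \<in> borel_measurable lborel" using m by simp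
  show "integrable lborel f"
    by (rule Bochner_Integration.integrable_bound[OF i m']) (use le C in simp)
  then have "(LINT x|lborel. norm (f x)) \<le> (LINT x|lborel. C * (1 / (1 + x\<^sup>2)))"
    by (intro integral_mono integrable_norm i le)
  then show "(LINT x|lborel. norm (f x)) \<le> C * (LINT x|lborel. 1 / (1 + x\<^sup>2))"
    by (simp only: integral_mult_right_zero)
qed

lemma schwartz_integrable: assumes "\<psi> \<in> schwartz" shows "integrable lborel \<psi>"
  using schwartz_decay[OF assms, of 2 0] integrable_decay(1)[OF schwartz_measurable[OF assms]]
  by (auto simp: nderiv_0)

lemma cis_measurable[measurable]: "cis \<in> borel_measurable borel"
  by (rule borel_measurable_continuous_onI) (auto simp: cis_conv_exp intro!: continuous_intros)

lemma integrable_cis_mult: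
  assumes f: "integrable lborel f" and h[measurable]: "h \<in> borel_measurable borel"
  shows "integrable lborel (\<lambda>x::real. cis (h x) * f x)"
  by (rule Bochner_Integration.integrable_bound[OF f]) (use borel_measurable_integrable[OF f] in \<open>auto simp: norm_mult\<close>)

lemma norm_fourier_le: "norm (fourier \<psi> \<xi>) \<le> (LINT x|lborel. norm (\<psi> x))"
  unfolding fourier_def by (rule order_trans[OF integral_norm_bound]) (simp add: norm_mult)

text \<open>Multiplication by \<open>- \<i> x\<close>, which the Fourier transform turns into the derivative.\<close>

definition Xop :: "(real \<Rightarrow> complex) \<Rightarrow> real \<Rightarrow> complex" where "Xop \<psi> x = - \<i> * (x *\<^sub>R \<psi> x)"

lemma Xop_schwartz: "\<psi> \<in> schwartz \<Longrightarrow> Xop \<psi> \<in> schwartz"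
  unfolding Xop_def[abs_def] by (intro schwartz_cmult schwartz_mult moderate_id)

lemma Xop_pow_schwartz: "\<psi> \<in> schwartz \<Longrightarrow> (Xop ^^ k) \<psi> \<in> schwartz"
  by (induction k) (auto intro: Xop_schwartz)

lemma Xop_mult: "(Xop ^^ k) (\<lambda>x. m x *\<^sub>R \<psi> x) = (\<lambda>x. m x *\<^sub>R (Xop ^^ k) \<psi> x)"
  by (induction k) (auto simp: Xop_def fun_eq_iff scaleR_conv_of_real)

lemma cis_taylor: "norm (cis t - 1 - \<i> * of_real t) \<le> t\<^sup>2 / 2"
  using iexp_approx1[of t 1] by (simp add: cis_conv_exp numeral_2_eq_2 diff_diff_eq fact_numeral)

text \<open>The Taylor remainder of the exponential is quadratic in the increment, with a factor \<open>x\<^sup>2\<close> that the decay of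
\<open>\<psi>\<close> absorbs.\<close>

lemma fourier_has_derivative:
  assumes p: "\<psi> \<in> schwartz"
  shows "(fourier \<psi> has_vector_derivative fourier (Xop \<psi>) \<xi>) (at \<xi>)"
proof -
  define p2 where "p2 = (\<lambda>x::real. x *\<^sub>R (x *\<^sub>R \<psi> x))"
  have p2: "p2 \<in> schwartz" unfolding p2_def by (intro schwartz_mult moderate_id p)
  define M where "M = (LINT x|lborel. norm (p2 x))"
  have bound: "norm (fourier \<psi> \<eta> - fourier \<psi> \<xi> - (\<eta> - \<xi>) *\<^sub>R fourier (Xop \<psi>) \<xi>) \<le> M / 2 * (\<eta> - \<xi>)\<^sup>2" for \<eta>
  proof -
    define h where "h = \<eta> - \<xi>"
    have i: "integrable lborel (\<lambda>x. cis (- (x * \<eta>)) * \<psi> x)" "integrable lborel (\<lambda>x. cis (- (x * \<xi>)) * \<psi> x)"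
      "integrable lborel (\<lambda>x. cis (- (x * \<xi>)) * Xop \<psi> x)"
      by (intro integrable_cis_mult schwartz_integrable Xop_schwartz p; measurable)+
    have "fourier \<psi> \<eta> - fourier \<psi> \<xi> - h *\<^sub>R fourier (Xop \<psi>) \<xi>
      = (LINT x|lborel. cis (- (x * \<eta>)) * \<psi> x - cis (- (x * \<xi>)) * \<psi> x - h *\<^sub>R (cis (- (x * \<xi>)) * Xop \<psi> x))"
      unfolding fourier_def using i by simp
    also have "\<dots> = (LINT x|lborel. cis (- (x * \<xi>)) * (cis (- (x * h)) - 1 - \<i> * of_real (- (x * h))) * \<psi> x)"
    proof (rule Bochner_Integration.integral_cong)
      fix x
      have "cis (- (x * \<eta>)) = cis (- (x * \<xi>)) * cis (- (x * h))"
        unfolding h_def by (simp add: cis_mult algebra_simps)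
      then show "cis (- (x * \<eta>)) * \<psi> x - cis (- (x * \<xi>)) * \<psi> x - h *\<^sub>R (cis (- (x * \<xi>)) * Xop \<psi> x)
        = cis (- (x * \<xi>)) * (cis (- (x * h)) - 1 - \<i> * of_real (- (x * h))) * \<psi> x"
        unfolding Xop_def by (simp add: scaleR_conv_of_real algebra_simps)
    qed simp
    also have "norm \<dots> \<le> (LINT x|lborel. h\<^sup>2 / 2 * norm (p2 x))"
    proof (rule order_trans[OF integral_norm_bound integral_mono_AE'])
      show "integrable lborel (\<lambda>x. h\<^sup>2 / 2 * norm (p2 x))"
        using schwartz_integrable[OF p2] by simp
      show "AE x in lborel. norm (cis (- (x * \<xi>)) * (cis (- (x * h)) - 1 - \<i> * of_real (- (x * h))) * \<psi> x) \<le> h\<^sup>2 / 2 * norm (p2 x)"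
      proof (intro AE_I2)
        fix x
        have "norm (cis (- (x * \<xi>)) * (cis (- (x * h)) - 1 - \<i> * of_real (- (x * h))) * \<psi> x)
          = norm (cis (- (x * h)) - 1 - \<i> * of_real (- (x * h))) * norm (\<psi> x)" by (simp only: norm_mult norm_cis mult_1)
        also have "\<dots> \<le> ((- (x * h))\<^sup>2 / 2) * norm (\<psi> x)" by (intro mult_right_mono cis_taylor) simp
        also have "\<dots> = h\<^sup>2 / 2 * norm (p2 x)"
          by (simp add: p2_def power_mult_distrib abs_mult power2_eq_square)
        finally show "norm (cis (- (x * \<xi>)) * (cis (- (x * h)) - 1 - \<i> * of_real (- (x * h))) * \<psi> x) \<le> h\<^sup>2 / 2 * norm (p2 x)" .
      qed
    qed simp
    also have "\<dots> = M / 2 * h\<^sup>2" unfolding M_def by simp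
    finally show ?thesis unfolding h_def .
  qed
  show ?thesis
    unfolding has_vector_derivative_def has_derivative_iff_norm
  proof (intro conjI bounded_linear_scaleR_left)
    show "((\<lambda>\<eta>. norm (fourier \<psi> \<eta> - fourier \<psi> \<xi> - (\<eta> - \<xi>) *\<^sub>R fourier (Xop \<psi>) \<xi>) / norm (\<eta> - \<xi>)) \<longlongrightarrow> 0) (at \<xi>)"
    proof (rule tendsto_sandwich[OF always_eventually always_eventually tendsto_const])
      show "((\<lambda>\<eta>. M / 2 * \<bar>\<eta> - \<xi>\<bar>) \<longlongrightarrow> 0) (at \<xi>)" by (auto intro!: tendsto_eq_intros)
      show "\<forall>\<eta>. norm (fourier \<psi> \<eta> - fourier \<psi> \<xi> - (\<eta> - \<xi>) *\<^sub>R fourier (Xop \<psi>) \<xi>) / norm (\<eta> - \<xi>) \<le> M / 2 * \<bar>\<eta> - \<xi>\<bar>"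
      proof
        fix \<eta>
        show "norm (fourier \<psi> \<eta> - fourier \<psi> \<xi> - (\<eta> - \<xi>) *\<^sub>R fourier (Xop \<psi>) \<xi>) / norm (\<eta> - \<xi>) \<le> M / 2 * \<bar>\<eta> - \<xi>\<bar>"
        proof (cases "\<eta> = \<xi>")
          case False
          then have "0 < \<bar>\<eta> - \<xi>\<bar>" by simp
          moreover have "M / 2 * (\<eta> - \<xi>)\<^sup>2 = M / 2 * \<bar>\<eta> - \<xi>\<bar> * \<bar>\<eta> - \<xi>\<bar>" by (simp add: power2_eq_square)
          ultimately show ?thesis using bound[of \<eta>] by (simp only: real_norm_def pos_divide_le_eq)
        qed simp
      qed
    qed simp
  qed
qed

lemma fourier_nderiv:
  assumes p: "\<psi> \<in> schwartz"
  shows "nderiv k (fourier \<psi>) = fourier ((Xop ^^ k) \<psi>)" "smooth (fourier \<psi>)"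
  using nderiv_eqI[of "\<lambda>k. fourier ((Xop ^^ k) \<psi>)"] fourier_has_derivative[OF Xop_pow_schwartz[OF p]] by simp_all

text \<open>Integration by parts against \<open>cis (- (x \<xi>))\<close>.\<close>

lemma fourier_deriv:
  assumes p: "\<psi> \<in> schwartz"
  shows "fourier (nderiv 1 \<psi>) \<xi> = \<i> * of_real \<xi> * fourier \<psi> \<xi>"
proof -
  define e where "e = (\<lambda>x. cis (- (x * \<xi>)))"
  have e': "(e has_vector_derivative - \<i> * of_real \<xi> * e x) (at x)" for x
  proof -
    have e: "e = (\<lambda>x. exp (- \<i> * of_real \<xi> * of_real x))"
      by (auto simp: e_def cis_conv_exp mult.commute mult.left_commute)
    show ?thesis unfolding e
      by (rule has_vector_derivative_real_field[where f = "\<lambda>w. exp (- \<i> * of_real \<xi> * w)"])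
        (auto intro!: derivative_eq_intros)
  qed
  have ec: "continuous_on UNIV e"
    by (intro continuous_at_imp_continuous_on ballI) (rule has_vector_derivative_continuous[OF e'])
  have p': "(\<psi> has_vector_derivative nderiv 1 \<psi> x) (at x)" for x
    using nderiv_has_derivative[OF schwartz_smooth[OF p], of 0] by (simp add: nderiv_0)
  have i: "integrable lborel (\<lambda>x. e x * \<psi> x)" "integrable lborel (\<lambda>x. e x * nderiv 1 \<psi> x)"
    unfolding e_def by (intro integrable_cis_mult schwartz_integrable schwartz_nderiv p; measurable)+
  have "(LINT x|lborel. e x * nderiv 1 \<psi> x + - \<i> * of_real \<xi> * (e x * \<psi> x)) = 0"
  proof (rule integral_derivative_eq_0)
    show "((\<lambda>x. e x * \<psi> x) has_vector_derivative e x * nderiv 1 \<psi> x + - \<i> * of_real \<xi> * (e x * \<psi> x)) (at x)" for x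
      using has_vector_derivative_mult[OF e' p', of x] by (simp add: mult.assoc)
    show "continuous_on UNIV (\<lambda>x. e x * nderiv 1 \<psi> x + - \<i> * of_real \<xi> * (e x * \<psi> x))"
      by (intro continuous_on_add continuous_on_mult continuous_on_const ec
          schwartz_continuous[OF p] schwartz_continuous[OF schwartz_nderiv[OF p]])
  qed (use i in auto)
  then show ?thesis using i unfolding fourier_def by (simp add: e_def)
qed

lemma fourier_nderiv_power:
  assumes p: "\<psi> \<in> schwartz"
  shows "norm (fourier (nderiv k \<psi>) \<xi>) = \<bar>\<xi>\<bar> ^ k * norm (fourier \<psi> \<xi>)"
proof (induction k)
  case (Suc k)
  have "nderiv (Suc k) \<psi> = nderiv 1 (nderiv k \<psi>)" by (simp add: nderiv_Suc nderiv_0)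
  then show ?case using fourier_deriv[OF schwartz_nderiv[OF p], of k \<xi>] Suc by (simp add: norm_mult)
qed (simp add: nderiv_0)

lemma fourier_schwartz: assumes p: "\<psi> \<in> schwartz" shows "fourier \<psi> \<in> schwartz"
proof -
  have "bounded (range (\<lambda>x. x ^ j *\<^sub>R nderiv k (fourier \<psi>) x))" for j k
  proof -
    let ?r = "(Xop ^^ k) \<psi>"
    have r: "?r \<in> schwartz" by (rule Xop_pow_schwartz[OF p])
    have "norm (x ^ j *\<^sub>R nderiv k (fourier \<psi>) x) \<le> (LINT x|lborel. norm (nderiv j ?r x))" for x
      using norm_fourier_le[of "nderiv j ?r" x]
      by (simp add: fourier_nderiv[OF p] fourier_nderiv_power[OF r] power_abs)
    then show ?thesis by (auto simp: bounded_iff)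
  qed
  then show ?thesis using fourier_nderiv(2)[OF p] by (simp add: schwartz_def)
qed

text \<open>The inverse transform is a reflected and rescaled Fourier transform, and inherits its properties.\<close>

lemma inv_fourier_eq: "inv_fourier \<psi> x = of_real (1 / (2 * pi)) * fourier \<psi> (-1 * x)"
  unfolding inv_fourier_def fourier_def by (simp add: mult.commute)

lemma schwartz_compose_scale: assumes p: "\<psi> \<in> schwartz" and c: "c \<noteq> 0" shows "(\<lambda>x. \<psi> (c * x)) \<in> schwartz"
  unfolding schwartz_iff
proof (intro conjI allI)
  note n = nderiv_compose_scale[OF schwartz_smooth[OF p], where c = c]
  show "smooth (\<lambda>x. \<psi> (c * x))" by (rule n)
  fix k N
  obtain C where C: "\<And>x. (1 + \<bar>x\<bar>) ^ N * norm (nderiv k \<psi> x) \<le> C" using schwartz_decay[OF p] by blast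
  define B where "B = 1 + 1 / \<bar>c\<bar>"
  have B: "0 \<le> B" by (simp add: B_def)
  have "(1 + \<bar>x\<bar>) ^ N * norm (nderiv k (\<lambda>x. \<psi> (c * x)) x) \<le> B ^ N * \<bar>c\<bar> ^ k * C" for x
  proof -
    have "1 + \<bar>x\<bar> \<le> B * (1 + \<bar>c * x\<bar>)"
      using c by (simp add: B_def algebra_simps abs_mult)
    then have "(1 + \<bar>x\<bar>) ^ N \<le> (B * (1 + \<bar>c * x\<bar>)) ^ N" by (rule power_mono) simp
    then have "(1 + \<bar>x\<bar>) ^ N * (\<bar>c\<bar> ^ k * norm (nderiv k \<psi> (c * x))) \<le> (B * (1 + \<bar>c * x\<bar>)) ^ N * (\<bar>c\<bar> ^ k * norm (nderiv k \<psi> (c * x)))"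
      by (rule mult_right_mono) simp
    also have "\<dots> = B ^ N * \<bar>c\<bar> ^ k * ((1 + \<bar>c * x\<bar>) ^ N * norm (nderiv k \<psi> (c * x)))"
      by (simp add: power_mult_distrib)
    also have "\<dots> \<le> B ^ N * \<bar>c\<bar> ^ k * C" using B by (intro mult_left_mono C) auto
    finally show ?thesis unfolding n(1) by (simp add: power_abs)
  qed
  then show "\<exists>C. \<forall>x. (1 + \<bar>x\<bar>) ^ N * cmod (nderiv k (\<lambda>x. \<psi> (c * x)) x) \<le> C" by blast
qed

lemma inv_fourier_schwartz: assumes p: "\<psi> \<in> schwartz" shows "inv_fourier \<psi> \<in> schwartz"
  unfolding inv_fourier_eq[abs_def] by (intro schwartz_cmult schwartz_compose_scale fourier_schwartz p) simp

lemma fourier_mult_formula: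
  assumes f: "integrable lborel f" and g: "integrable lborel g"
  shows "(LINT \<xi>|lborel. fourier f \<xi> * g \<xi>) = (LINT x|lborel. f x * fourier g x)"
proof -
  have fm[measurable]: "f \<in> borel_measurable borel" "g \<in> borel_measurable borel"
    using borel_measurable_integrable[OF f] borel_measurable_integrable[OF g] by simp_all
  define H where "H = (\<lambda>x \<xi>. cis (- (x * \<xi>)) * f x * g \<xi>)"
  have int: "integrable (lborel \<Otimes>\<^sub>M lborel) (case_prod H)"
  proof (rule lborel_pair.Fubini_integrable)
    show "case_prod H \<in> borel_measurable (lborel \<Otimes>\<^sub>M lborel)" unfolding H_def by measurable
    show "integrable lborel (\<lambda>x. LINT y|lborel. norm (case (x, y) of (x, \<xi>) \<Rightarrow> H x \<xi>))"
      using f by (simp add: H_def norm_mult)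
    show "AE x in lborel. integrable lborel (\<lambda>y. case (x, y) of (x, \<xi>) \<Rightarrow> H x \<xi>)"
    proof (intro AE_I2)
      fix x
      have "integrable lborel (\<lambda>\<xi>. f x * (cis (- (x * \<xi>)) * g \<xi>))"
        by (intro integrable_mult_right integrable_cis_mult g) measurable
      then show "integrable lborel (\<lambda>y. case (x, y) of (x, \<xi>) \<Rightarrow> H x \<xi>)"
        by (simp add: H_def mult.assoc mult.left_commute)
    qed
  qed
  have "(LINT \<xi>|lborel. fourier f \<xi> * g \<xi>) = (LINT \<xi>|lborel. (LINT x|lborel. H x \<xi>))"
    unfolding fourier_def H_def by simp
  also have "\<dots> = (LINT x|lborel. (LINT \<xi>|lborel. H x \<xi>))"
    by (rule lborel_pair.Fubini_integral[OF int])
  also have "\<dots> = (LINT x|lborel. f x * fourier g x)"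
    unfolding fourier_def H_def
    by (rule Bochner_Integration.integral_cong[OF refl])
      (simp add: mult.assoc mult.left_commute[of _ "f _"] mult.commute[of _ "_::real"])
  finally show ?thesis .
qed

text \<open>The characteristic function of the standard normal distribution, rescaled.\<close>

lemma fourier_gaussian:
  assumes e: "0 < e"
  shows "(LINT \<xi>|lborel. cis (t * \<xi>) * of_real (exp (- (e * \<xi>)\<^sup>2 / 2)))
      = of_real (sqrt (2 * pi) / e * exp (- (t / e)\<^sup>2 / 2))"
    and "integrable lborel (\<lambda>\<xi>. cis (t * \<xi>) * of_real (exp (- (e * \<xi>)\<^sup>2 / 2)))"
proof -
  have i0: "integrable lborel (\<lambda>x::real. exp (- x\<^sup>2 / 2) :: real)"
  proof -
    have "integrable lborel (\<lambda>x. sqrt (2 * pi) * std_normal_density x)" by simp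
    then show ?thesis by (simp add: std_normal_density_def)
  qed
  from lborel_integrable_real_affine[OF i0, of e 0] e
  have i1: "integrable lborel (\<lambda>x. exp (- (e * x)\<^sup>2 / 2) :: real)" by simp
  show "integrable lborel (\<lambda>\<xi>. cis (t * \<xi>) * of_real (exp (- (e * \<xi>)\<^sup>2 / 2)))"
    by (rule integrable_cis_mult) (use integrable_of_real[OF i1, where 'a = complex] in auto)
  have "char std_normal_distribution (t / e) = (LINT x|lborel. std_normal_density x *\<^sub>R iexp (t / e * x))"
    unfolding char_def by (subst integral_density) (auto simp: std_normal_density_def)
  then have "(LINT x|lborel. std_normal_density x *\<^sub>R iexp (t / e * x)) = of_real (exp (- (t / e)\<^sup>2 / 2))"
    by (simp add: char_std_normal_distribution)
  moreover have "std_normal_density x *\<^sub>R iexp (t / e * x)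
      = of_real (1 / sqrt (2 * pi)) * (cis (t / e * x) * of_real (exp (- x\<^sup>2 / 2)))" for x
    by (simp add: std_normal_density_def cis_conv_exp scaleR_conv_of_real)
  ultimately have "of_real (1 / sqrt (2 * pi)) * (LINT x|lborel. cis (t / e * x) * of_real (exp (- x\<^sup>2 / 2)))
      = complex_of_real (exp (- (t / e)\<^sup>2 / 2))"
    by (simp only: integral_mult_right_zero)
  then have 1: "(LINT x|lborel. cis (t / e * x) * of_real (exp (- x\<^sup>2 / 2)))
      = complex_of_real (sqrt (2 * pi) * exp (- (t / e)\<^sup>2 / 2))"
    by (simp add: field_simps)
  have "(LINT x|lborel. cis (t / e * x) * complex_of_real (exp (- x\<^sup>2 / 2)))
      = \<bar>e\<bar> *\<^sub>R (LINT x|lborel. cis (t / e * (0 + e * x)) * complex_of_real (exp (- (0 + e * x)\<^sup>2 / 2)))"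
    by (rule lborel_integral_real_affine) (use e in simp)
  also have "\<dots> = of_real e * (LINT x|lborel. cis (t * x) * complex_of_real (exp (- (e * x)\<^sup>2 / 2)))"
    using e by (simp add: scaleR_conv_of_real)
  finally show "(LINT \<xi>|lborel. cis (t * \<xi>) * of_real (exp (- (e * \<xi>)\<^sup>2 / 2)))
      = of_real (sqrt (2 * pi) / e * exp (- (t / e)\<^sup>2 / 2))"
    using 1 e by (simp add: field_simps)
qed

lemma schwartz_bounded: assumes "\<psi> \<in> schwartz" shows "\<exists>C. \<forall>x. norm (\<psi> x) \<le> C"
  using schwartz_decay[OF assms, of 0 0] by (simp add: nderiv_0)

text \<open>Insert the Gaussian factor \<open>exp (- (e \<xi>)\<^sup>2 / 2)\<close> into the inversion integral and move the Fourier transform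
onto it by \<open>fourier_mult_formula\<close>: the result is an average of \<open>\<psi>\<close> over a Gaussian of width \<open>e\<close> around
\<open>x\<close>. Then let \<open>e\<close> tend to \<open>0\<close> on both sides.\<close>

theorem inv_fourier_fourier:
  assumes p: "\<psi> \<in> schwartz"
  shows "inv_fourier (fourier \<psi>) x = \<psi> x"
proof -
  define e where "e n = inverse (real (Suc n))" for n
  have e: "0 < e n" "e \<longlonglongrightarrow> 0" for n
    unfolding e_def using LIMSEQ_inverse_real_of_nat by auto
  have Fp: "integrable lborel (fourier \<psi>)" by (intro schwartz_integrable fourier_schwartz p)
  have [measurable]: "fourier \<psi> \<in> borel_measurable borel" "\<psi> \<in> borel_measurable borel"
    by (intro schwartz_measurable fourier_schwartz p)+
  obtain C where C: "\<And>y. norm (\<psi> y) \<le> C" using schwartz_bounded[OF p] by blast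
  define gs where "gs n \<xi> = cis (x * \<xi>) * complex_of_real (exp (- (e n * \<xi>)\<^sup>2 / 2))" for n \<xi>
  have gi: "integrable lborel (gs n)" for n
    unfolding gs_def by (rule fourier_gaussian(2)[OF e(1)])
  have eq: "(LINT \<xi>|lborel. fourier \<psi> \<xi> * gs n \<xi>)
      = of_real (sqrt (2 * pi)) * (LINT u|lborel. \<psi> (x + e n * u) * of_real (exp (- u\<^sup>2 / 2)))" for n
  proof -
    have "fourier (gs n) y = of_real (sqrt (2 * pi) / e n * exp (- ((x - y) / e n)\<^sup>2 / 2))" for y
    proof -
      have "fourier (gs n) y = (LINT \<xi>|lborel. cis ((x - y) * \<xi>) * of_real (exp (- (e n * \<xi>)\<^sup>2 / 2)))"
        unfolding fourier_def gs_def
        by (rule Bochner_Integration.integral_cong) (auto simp: cis_mult algebra_simps simp flip: mult.assoc)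
      then show ?thesis using fourier_gaussian(1)[OF e(1)] by simp
    qed
    then have "(LINT \<xi>|lborel. fourier \<psi> \<xi> * gs n \<xi>)
        = (LINT y|lborel. \<psi> y * of_real (sqrt (2 * pi) / e n * exp (- ((x - y) / e n)\<^sup>2 / 2)))"
      using fourier_mult_formula[OF schwartz_integrable[OF p] gi] by simp
    also have "\<dots> = \<bar>e n\<bar> *\<^sub>R (LINT u|lborel. \<psi> (x + e n * u) *
        of_real (sqrt (2 * pi) / e n * exp (- ((x - (x + e n * u)) / e n)\<^sup>2 / 2)))"
      by (rule lborel_integral_real_affine) (use e(1)[of n] in simp)
    also have "\<dots> = \<bar>e n\<bar> *\<^sub>R (LINT u|lborel. of_real (sqrt (2 * pi) / e n) * (\<psi> (x + e n * u) * of_real (exp (- u\<^sup>2 / 2))))"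
      using e(1)[of n] by (simp add: mult.left_commute mult.assoc)
    also have "\<dots> = of_real (sqrt (2 * pi)) * (LINT u|lborel. \<psi> (x + e n * u) * of_real (exp (- u\<^sup>2 / 2)))"
      using e(1)[of n] by (simp only: integral_mult_right_zero) (simp add: scaleR_conv_of_real)
    finally show ?thesis .
  qed
  have gauss: "integrable lborel (\<lambda>u::real. exp (- u\<^sup>2 / 2) :: real)" "(LINT u|lborel. complex_of_real (exp (- u\<^sup>2 / 2))) = of_real (sqrt (2 * pi))"
    using fourier_gaussian(1)[of 1 0] integrable_norm[OF fourier_gaussian(2)[of 1 0]] by (simp_all add: norm_mult)
  have "(\<lambda>n. LINT \<xi>|lborel. fourier \<psi> \<xi> * gs n \<xi>) \<longlonglongrightarrow> (LINT \<xi>|lborel. fourier \<psi> \<xi> * cis (x * \<xi>))"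
  proof (rule integral_dominated_convergence[where w = "\<lambda>\<xi>. norm (fourier \<psi> \<xi>)"])
    show "AE \<xi> in lborel. (\<lambda>n. fourier \<psi> \<xi> * gs n \<xi>) \<longlonglongrightarrow> fourier \<psi> \<xi> * cis (x * \<xi>)"
    proof (intro AE_I2)
      fix \<xi>
      have "(\<lambda>n. fourier \<psi> \<xi> * gs n \<xi>) \<longlonglongrightarrow> fourier \<psi> \<xi> * (cis (x * \<xi>) * of_real (exp (- (0 * \<xi>)\<^sup>2 / 2)))"
        unfolding gs_def by (intro tendsto_intros e) simp
      then show "(\<lambda>n. fourier \<psi> \<xi> * gs n \<xi>) \<longlonglongrightarrow> fourier \<psi> \<xi> * cis (x * \<xi>)" by simp
    qed
    show "AE \<xi> in lborel. norm (fourier \<psi> \<xi> * gs n \<xi>) \<le> norm (fourier \<psi> \<xi>)" for n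
      by (auto simp: gs_def norm_mult intro!: mult_left_le)
  qed (use Fp in \<open>auto simp: gs_def\<close>)
  moreover have "(\<lambda>n. LINT \<xi>|lborel. fourier \<psi> \<xi> * gs n \<xi>)
      \<longlonglongrightarrow> of_real (sqrt (2 * pi)) * (LINT u|lborel. \<psi> x * of_real (exp (- u\<^sup>2 / 2)))"
    unfolding eq
  proof (rule tendsto_mult_left, rule integral_dominated_convergence[where w = "\<lambda>u. C * exp (- u\<^sup>2 / 2)"])
    show "AE u in lborel. (\<lambda>n. \<psi> (x + e n * u) * complex_of_real (exp (- u\<^sup>2 / 2))) \<longlonglongrightarrow> \<psi> x * complex_of_real (exp (- u\<^sup>2 / 2))"
    proof (intro AE_I2 tendsto_mult_right)
      fix u
      have "isCont \<psi> x" using schwartz_continuous[OF p] by (simp add: continuous_on_eq_continuous_at)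
      moreover have "(\<lambda>n. x + e n * u) \<longlonglongrightarrow> x + 0 * u" by (intro tendsto_intros e)
      then have "(\<lambda>n. x + e n * u) \<longlonglongrightarrow> x" by simp
      ultimately show "(\<lambda>n. \<psi> (x + e n * u)) \<longlonglongrightarrow> \<psi> x" by (rule isCont_tendsto_compose)
    qed
    show "AE u in lborel. norm (\<psi> (x + e n * u) * complex_of_real (exp (- u\<^sup>2 / 2))) \<le> C * exp (- u\<^sup>2 / 2)" for n
      using C by (auto simp: norm_mult)
  qed (use gauss in auto)
  moreover have "of_real (sqrt (2 * pi)) * (LINT u|lborel. \<psi> x * of_real (exp (- u\<^sup>2 / 2))) = of_real (2 * pi) * \<psi> x"
    unfolding integral_mult_right_zero gauss(2) by (simp flip: of_real_mult)
  ultimately have "(LINT \<xi>|lborel. fourier \<psi> \<xi> * cis (x * \<xi>)) = of_real (2 * pi) * \<psi> x"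
    using LIMSEQ_unique by metis
  then show ?thesis unfolding inv_fourier_def by (simp add: mult.commute)
qed

theorem fourier_inv_fourier:
  assumes p: "\<psi> \<in> schwartz"
  shows "fourier (inv_fourier \<psi>) x = \<psi> x"
proof -
  have "fourier (inv_fourier \<psi>) x = (LINT y|lborel. cis (- (y * x)) * (of_real (1 / (2 * pi)) * fourier \<psi> (-1 * y)))"
    unfolding fourier_def[of "inv_fourier \<psi>"] inv_fourier_eq ..
  also have "\<dots> = \<bar>-1\<bar> *\<^sub>R (LINT y|lborel. cis (- ((0 + -1 * y) * x)) * (of_real (1 / (2 * pi)) * fourier \<psi> (-1 * (0 + -1 * y))))"
    by (rule lborel_integral_real_affine) simp
  also have "\<dots> = (LINT y|lborel. of_real (1 / (2 * pi)) * (cis (x * y) * fourier \<psi> y))"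
    by (simp add: mult.commute mult.left_commute)
  also have "\<dots> = inv_fourier (fourier \<psi>) x"
    unfolding integral_mult_right_zero inv_fourier_def by simp
  finally show ?thesis using inv_fourier_fourier[OF p] by simp
qed

lemma schwartz_sq_integrable: assumes p: "\<psi> \<in> schwartz" shows "integrable lborel (\<lambda>x. (norm (\<psi> x))\<^sup>2)"
proof -
  obtain C where C: "\<And>x. norm (\<psi> x) \<le> C" using schwartz_bounded[OF p] by blast
  have C0: "0 \<le> C" by (rule order_trans[OF norm_ge_zero C])
  have "integrable lborel (\<lambda>x. C * norm (\<psi> x))" using schwartz_integrable[OF p] by simp
  then show ?thesis
    by (rule Bochner_Integration.integrable_bound)
      (use C C0 schwartz_measurable[OF p] in \<open>auto simp: power2_eq_square mult_right_mono\<close>)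
qed

text \<open>\<open>fourier_mult_formula\<close> applied to \<open>\<psi>\<close> and the conjugate of its transform, whose transform is a multiple of
the conjugate of \<open>\<psi>\<close> by inversion.\<close>

theorem plancherel:
  assumes p: "\<psi> \<in> schwartz"
  shows "(LINT \<xi>|lborel. (norm (fourier \<psi> \<xi>))\<^sup>2) = 2 * pi * (LINT x|lborel. (norm (\<psi> x))\<^sup>2)"
proof -
  have Fp: "integrable lborel (fourier \<psi>)" by (intro schwartz_integrable fourier_schwartz p)
  have "fourier (\<lambda>\<xi>. cnj (fourier \<psi> \<xi>)) x = of_real (2 * pi) * cnj (\<psi> x)" for x
  proof -
    have "fourier (\<lambda>\<xi>. cnj (fourier \<psi> \<xi>)) x = cnj (LINT \<xi>|lborel. cis (x * \<xi>) * fourier \<psi> \<xi>)"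
    proof -
      have "cis (- (\<xi> * x)) * cnj (fourier \<psi> \<xi>) = cnj (cis (x * \<xi>) * fourier \<psi> \<xi>)" for \<xi>
        by (simp add: cis_cnj mult.commute)
      then show ?thesis unfolding fourier_def[of "\<lambda>\<xi>. cnj (fourier \<psi> \<xi>)"] by (simp only: Bochner_Integration.integral_cnj)
    qed
    also have "(LINT \<xi>|lborel. cis (x * \<xi>) * fourier \<psi> \<xi>) = of_real (2 * pi) * inv_fourier (fourier \<psi>) x"
      unfolding inv_fourier_def by simp
    finally show ?thesis using inv_fourier_fourier[OF p] by simp
  qed
  with fourier_mult_formula[OF schwartz_integrable[OF p] integrable_cnj[OF Fp]]
  have "(LINT \<xi>|lborel. fourier \<psi> \<xi> * cnj (fourier \<psi> \<xi>)) = (LINT x|lborel. of_real (2 * pi) * (\<psi> x * cnj (\<psi> x)))"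
    by (simp add: mult.left_commute)
  then have "(LINT \<xi>|lborel. complex_of_real ((norm (fourier \<psi> \<xi>))\<^sup>2)) = of_real (2 * pi) * (LINT x|lborel. complex_of_real ((norm (\<psi> x))\<^sup>2))"
    unfolding integral_mult_right_zero complex_norm_square .
  then have "complex_of_real (LINT \<xi>|lborel. (norm (fourier \<psi> \<xi>))\<^sup>2) = of_real (2 * pi * (LINT x|lborel. (norm (\<psi> x))\<^sup>2))"
    unfolding integral_complex_of_real of_real_mult .
  then show ?thesis by (simp only: of_real_eq_iff)
qed

lemma cauchy_schwarz_complex:
  fixes f g :: "'a \<Rightarrow> complex"
  assumes [measurable]: "f \<in> borel_measurable M" "g \<in> borel_measurable M"
    and f: "integrable M (\<lambda>x. (norm (f x))\<^sup>2)" and g: "integrable M (\<lambda>x. (norm (g x))\<^sup>2)"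
  shows "norm (LINT x|M. f x * g x) \<le> sqrt (LINT x|M. (norm (f x))\<^sup>2) * sqrt (LINT x|M. (norm (g x))\<^sup>2)"
    and "integrable M (\<lambda>x. f x * g x)"
proof -
  have i: "integrable M (\<lambda>x. norm (f x) * norm (g x))"
    using f g by (intro integrable_mult_of_squares[of M "\<lambda>x. norm (f x)" "\<lambda>x. norm (g x)"]) auto
  then show "integrable M (\<lambda>x. f x * g x)"
    by (rule Bochner_Integration.integrable_bound) (auto simp: norm_mult)
  define A B where "A = (LINT x|M. (norm (f x))\<^sup>2)" and "B = (LINT x|M. (norm (g x))\<^sup>2)"
  have AB: "0 \<le> A" "0 \<le> B" by (simp_all add: A_def B_def)
  have "(\<integral>\<^sup>+x. ennreal (norm (f x)) * ennreal (norm (g x)) \<partial>M)\<^sup>2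
      \<le> (\<integral>\<^sup>+x. (ennreal (norm (f x)))\<^sup>2 \<partial>M) * (\<integral>\<^sup>+x. (ennreal (norm (g x)))\<^sup>2 \<partial>M)"
    by (rule Cauchy_Schwarz_nn_integral) auto
  also have "(\<integral>\<^sup>+x. ennreal (norm (f x)) * ennreal (norm (g x)) \<partial>M) = ennreal (LINT x|M. norm (f x) * norm (g x))"
    using nn_integral_eq_integral[OF i] by (simp add: ennreal_mult)
  also have "(\<integral>\<^sup>+x. (ennreal (norm (f x)))\<^sup>2 \<partial>M) = ennreal A"
    using nn_integral_eq_integral[OF f] by (simp add: A_def ennreal_power)
  also have "(\<integral>\<^sup>+x. (ennreal (norm (g x)))\<^sup>2 \<partial>M) = ennreal B"
    using nn_integral_eq_integral[OF g] by (simp add: B_def ennreal_power)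
  finally have "ennreal ((LINT x|M. norm (f x) * norm (g x))\<^sup>2) \<le> ennreal (A * B)"
    using AB by (simp add: ennreal_power ennreal_mult)
  then have "(LINT x|M. norm (f x) * norm (g x))\<^sup>2 \<le> A * B"
    using AB by (simp add: ennreal_le_iff)
  then have "(LINT x|M. norm (f x) * norm (g x)) \<le> sqrt (A * B)" by (rule real_le_rsqrt)
  moreover have "norm (LINT x|M. f x * g x) \<le> (LINT x|M. norm (f x) * norm (g x))"
    by (rule order_trans[OF integral_norm_bound]) (simp add: norm_mult)
  ultimately show "norm (LINT x|M. f x * g x) \<le> sqrt (LINT x|M. (norm (f x))\<^sup>2) * sqrt (LINT x|M. (norm (g x))\<^sup>2)"
    unfolding A_def B_def real_sqrt_mult by linarith
qed

section \<open>Littlewood-Paley decomposition of tempered distributions\<close>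

text \<open>On the set where \<open>1 - chi (x / 2\<^sup>n)\<close> does not vanish, \<open>\<bar>x\<bar>\<close> is at least of order \<open>2\<^sup>n\<close>, so one power of
\<open>1 + \<bar>x\<bar>\<close> taken from the decay of \<open>\<eta>\<close> buys a factor \<open>2\<^sup>-\<^sup>n\<close>. Derivatives of the cutoff have this factor
already, from the chain rule.\<close>

lemma cutoff_decay:
  fixes chi :: "real \<Rightarrow> real"
  assumes chi: "smooth chi" "{\<xi>. chi \<xi> \<noteq> 0} \<subseteq> {\<xi>. \<bar>\<xi>\<bar> \<le> R}" "\<And>\<xi>. 0 \<le> chi \<xi> \<and> chi \<xi> \<le> 1"
      "\<And>\<xi>. \<bar>\<xi>\<bar> < 3/4 \<Longrightarrow> chi \<xi> = 1"
    and p: "\<eta> \<in> schwartz"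
  shows "\<exists>C. \<forall>n x. (1 + \<bar>x\<bar>) ^ N * norm (nderiv k (\<lambda>x. (1 - chi ((1/2) ^ n * x)) *\<^sub>R \<eta> x) x) \<le> C * (1/2) ^ n"
    and "(\<lambda>x. (1 - chi ((1/2) ^ n * x)) *\<^sub>R \<eta> x) \<in> schwartz"
proof -
  have n: "nderiv i (\<lambda>x. 1 - chi (c * x)) = (\<lambda>x. if i = 0 then 1 - chi (c * x) else - (c ^ i * nderiv i chi (c * x)))"
    "smooth (\<lambda>x. 1 - chi (c * x))" for i c
  proof -
    define F where "F = (\<lambda>i x. if i = 0 then 1 - chi (c * x) else - (c ^ i * nderiv i chi (c * x)))"
    have "(F i has_vector_derivative F (Suc i) x) (at x)" for i x
    proof -
      have d: "((\<lambda>x. c ^ i * nderiv i chi (c * x)) has_vector_derivative c ^ Suc i * nderiv (Suc i) chi (c * x)) (at x)"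
        using nderiv_has_derivative[OF nderiv_compose_scale(2)[OF chi(1), of c], of i x]
        unfolding nderiv_compose_scale(1)[OF chi(1)] by simp
      have "((\<lambda>x. 1 - c ^ i * nderiv i chi (c * x)) has_vector_derivative 0 - c ^ Suc i * nderiv (Suc i) chi (c * x)) (at x)"
        by (intro has_vector_derivative_diff has_vector_derivative_const d)
      with has_vector_derivative_minus[OF d] show ?thesis
        by (cases "i = 0") (simp_all add: F_def nderiv_0)
    qed
    from nderiv_eqI[of F, OF this]
    show "nderiv i (\<lambda>x. 1 - chi (c * x)) = (\<lambda>x. if i = 0 then 1 - chi (c * x) else - (c ^ i * nderiv i chi (c * x)))"
      "smooth (\<lambda>x. 1 - chi (c * x))" by (simp_all add: F_def)
  qed
  have b: "\<exists>A. \<forall>n x. \<forall>i\<le>k. \<bar>nderiv i (\<lambda>x. 1 - chi ((1/2) ^ n * x)) x\<bar> \<le> A * (1/2) ^ n * (1 + \<bar>x\<bar>)" for k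
  proof -
    obtain B where B: "\<And>i x. norm (nderiv i chi x) \<le> B i"
      using compact_support_bounded(1)[OF chi(1,2)] by metis
    define A where "A = 2 + (\<Sum>i\<le>k. \<bar>B i\<bar>)"
    have "\<bar>nderiv i (\<lambda>x. 1 - chi ((1/2) ^ n * x)) x\<bar> \<le> A * (1/2) ^ n * (1 + \<bar>x\<bar>)" if i: "i \<le> k" for n x i
    proof (cases "i = 0")
      case True
      have A: "2 \<le> A" by (simp add: A_def sum_nonneg)
      show ?thesis
      proof (cases "\<bar>(1/2) ^ n * x\<bar> < 3/4")
        case True
        then show ?thesis using A by (simp add: n(1) \<open>i = 0\<close> chi(4))
      next
        case False
        have "\<bar>1 - chi ((1/2) ^ n * x)\<bar> \<le> 1" using chi(3)[of "(1/2) ^ n * x"] by (simp add: abs_le_iff)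
        also have "\<dots> \<le> 2 * ((1/2) ^ n * \<bar>x\<bar>)" using False by (simp add: abs_mult)
        also have "\<dots> \<le> A * ((1/2) ^ n * (1 + \<bar>x\<bar>))" using A by (intro mult_mono) auto
        finally show ?thesis by (simp add: n(1) \<open>i = 0\<close> mult.assoc)
      qed
    next
      case False
      have "B i \<le> A" using member_le_sum[of i "{..k}" "\<lambda>i. \<bar>B i\<bar>"] i by (force simp: A_def)
      moreover have "((1/2::real) ^ n) ^ i \<le> (1/2) ^ n"
        using power_decreasing[of 1 i "(1/2::real) ^ n"] False by (simp add: power_le_one)
      ultimately have "((1/2) ^ n) ^ i * norm (nderiv i chi ((1/2) ^ n * x)) \<le> (1/2) ^ n * A"
        using B[of i "(1/2) ^ n * x"] by (intro mult_mono) auto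
      also have "\<dots> \<le> A * (1/2) ^ n * (1 + \<bar>x\<bar>)"
        using mult_left_mono[of 1 "1 + \<bar>x\<bar>" "A * (1/2) ^ n"] by (simp add: A_def sum_nonneg mult.commute)
      finally show ?thesis using False by (simp add: n(1) abs_mult)
    qed
    then show ?thesis by blast
  qed
  have mod: "moderate (\<lambda>x. 1 - chi ((1/2) ^ n * x))" for n
    unfolding moderate_def
  proof (intro conjI allI n(2))
    fix k
    obtain A where A: "\<And>n x i. i \<le> k \<Longrightarrow> \<bar>nderiv i (\<lambda>x. 1 - chi ((1/2) ^ n * x)) x\<bar> \<le> A * (1/2) ^ n * (1 + \<bar>x\<bar>)"
      using b by blast
    have "\<bar>nderiv k (\<lambda>x. 1 - chi ((1/2) ^ n * x)) x\<bar> \<le> (A * (1/2) ^ n) * (1 + \<bar>x\<bar>) ^ 1" for x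
      using A[of k n x] by simp
    then show "\<exists>N C. \<forall>x. \<bar>nderiv k (\<lambda>x. 1 - chi ((1/2) ^ n * x)) x\<bar> \<le> C * (1 + \<bar>x\<bar>) ^ N" by blast
  qed
  show "(\<lambda>x. (1 - chi ((1/2) ^ n * x)) *\<^sub>R \<eta> x) \<in> schwartz" by (rule schwartz_mult[OF mod p])
  obtain A where A: "\<And>n x i. i \<le> k \<Longrightarrow> \<bar>nderiv i (\<lambda>x. 1 - chi ((1/2) ^ n * x)) x\<bar> \<le> A * (1/2) ^ n * (1 + \<bar>x\<bar>)"
    using b by blast
  obtain B where B: "\<And>x i. i \<le> k \<Longrightarrow> (1 + \<bar>x\<bar>) ^ (N + 1) * norm (nderiv i \<eta> x) \<le> B"
    using schwartz_decay_upto[OF p] by blast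
  have "(1 + \<bar>x\<bar>) ^ N * norm (nderiv k (\<lambda>x. (1 - chi ((1/2) ^ n * x)) *\<^sub>R \<eta> x) x) \<le> (2 ^ k * (A * B)) * (1/2) ^ n" for n x
  proof -
    have "norm (nderiv k (\<lambda>x. (1 - chi ((1/2) ^ n * x)) *\<^sub>R \<eta> x) x)
        \<le> 2 ^ k * ((A * (1/2) ^ n * (1 + \<bar>x\<bar>)) * (B / (1 + \<bar>x\<bar>) ^ (N + 1)))"
      by (rule leibniz_bound[OF n(2) schwartz_smooth[OF p] A]) (use B[of _ x] in \<open>auto simp: pos_le_divide_eq mult.commute\<close>)
    also have "\<dots> = (2 ^ k * (A * B)) * (1/2) ^ n / (1 + \<bar>x\<bar>) ^ N"
    proof -
      have "1 + \<bar>x\<bar> \<noteq> 0" by (rule less_imp_neq[symmetric]) simp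
      then show ?thesis by simp
    qed
    finally show ?thesis by (simp add: pos_le_divide_eq mult.commute)
  qed
  then show "\<exists>C. \<forall>n x. (1 + \<bar>x\<bar>) ^ N * norm (nderiv k (\<lambda>x. (1 - chi ((1/2) ^ n * x)) *\<^sub>R \<eta> x) x) \<le> C * (1/2) ^ n"
    by blast
qed

text \<open>Up to constants, the seminorms of a Fourier transform are \<open>L\<^sup>1\<close> norms of derivatives of the function multiplied by
powers of \<open>x\<close>; these are controlled by \<open>cutoff_decay\<close>.\<close>

lemma seminorm_fourier_cutoff:
  fixes chi :: "real \<Rightarrow> real"
  assumes chi: "smooth chi" "{\<xi>. chi \<xi> \<noteq> 0} \<subseteq> {\<xi>. \<bar>\<xi>\<bar> \<le> R}" "\<And>\<xi>. 0 \<le> chi \<xi> \<and> chi \<xi> \<le> 1"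
      "\<And>\<xi>. \<bar>\<xi>\<bar> < 3/4 \<Longrightarrow> chi \<xi> = 1"
    and p: "\<eta> \<in> schwartz"
  shows "(\<lambda>n. schwartz_seminorm N (fourier (\<lambda>x. (1 - chi ((1/2) ^ n * x)) *\<^sub>R \<eta> x))) \<longlonglongrightarrow> 0"
proof -
  define \<rho> where "\<rho> n = (\<lambda>x. (1 - chi ((1/2) ^ n * x)) *\<^sub>R \<eta> x)" for n
  have \<rho>: "\<rho> n \<in> schwartz" for n unfolding \<rho>_def by (rule cutoff_decay(2)[OF chi p])
  have "\<exists>C. \<forall>n x. norm (x ^ j *\<^sub>R nderiv k (fourier (\<rho> n)) x) \<le> C * (1/2) ^ n" for j k
  proof -
    define \<eta>' where "\<eta>' = (Xop ^^ k) \<eta>"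
    have p': "\<eta>' \<in> schwartz" unfolding \<eta>'_def by (rule Xop_pow_schwartz[OF p])
    define r where "r n = (\<lambda>x. (1 - chi ((1/2) ^ n * x)) *\<^sub>R \<eta>' x)" for n
    have r: "r n \<in> schwartz" for n unfolding r_def by (rule cutoff_decay(2)[OF chi p'])
    have rX: "(Xop ^^ k) (\<rho> n) = r n" for n unfolding \<rho>_def r_def \<eta>'_def by (rule Xop_mult)
    obtain C where C: "\<And>n x. (1 + \<bar>x\<bar>) ^ 2 * norm (nderiv j (r n) x) \<le> C * (1/2) ^ n"
      using cutoff_decay(1)[OF chi p'] unfolding r_def by blast
    have "norm (x ^ j *\<^sub>R nderiv k (fourier (\<rho> n)) x) \<le> (C * (LINT x|lborel. 1 / (1 + x\<^sup>2))) * (1/2) ^ n" for n x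
    proof -
      have "norm (x ^ j *\<^sub>R nderiv k (fourier (\<rho> n)) x) = norm (fourier (nderiv j (r n)) x)"
        unfolding fourier_nderiv(1)[OF \<rho>] fourier_nderiv_power[OF r] rX by (simp add: power_abs)
      also have "\<dots> \<le> (LINT x|lborel. norm (nderiv j (r n) x))" by (rule norm_fourier_le)
      also have "\<dots> \<le> (C * (1/2) ^ n) * (LINT x|lborel. 1 / (1 + x\<^sup>2))"
        by (rule integrable_decay(2)[OF schwartz_measurable[OF schwartz_nderiv[OF r]] C])
      finally show ?thesis by (simp add: mult.commute mult.left_commute)
    qed
    then show ?thesis by blast
  qed
  then obtain C where C: "\<And>j k n x. norm (x ^ j *\<^sub>R nderiv k (fourier (\<rho> n)) x) \<le> C j k * (1/2) ^ n" by metis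
  have le: "schwartz_seminorm N (fourier (\<rho> n)) \<le> (\<Sum>j\<le>N. \<Sum>k\<le>N. C j k) * (1/2) ^ n" for n
    unfolding schwartz_seminorm_def sum_distrib_right
    by (intro sum_mono cSUP_least C) auto
  have nn: "0 \<le> schwartz_seminorm N (fourier (\<rho> n))" for n
    unfolding schwartz_seminorm_def
  proof (intro sum_nonneg)
    fix j k
    have "bdd_above (range (\<lambda>x. norm (x ^ j *\<^sub>R nderiv k (fourier (\<rho> n)) x)))"
      using C[of _ j k n] by (intro bdd_aboveI2)
    then have "norm (0 ^ j *\<^sub>R nderiv k (fourier (\<rho> n)) 0) \<le> (SUP x. norm (x ^ j *\<^sub>R nderiv k (fourier (\<rho> n)) x))"
      by (rule cSUP_upper[rotated]) simp
    then show "0 \<le> (SUP x. norm (x ^ j *\<^sub>R nderiv k (fourier (\<rho> n)) x))" by (rule order_trans[OF norm_ge_zero])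
  qed
  have lim: "(\<lambda>n. (\<Sum>j\<le>N. \<Sum>k\<le>N. C j k) * (1/2) ^ n) \<longlonglongrightarrow> (\<Sum>j\<le>N. \<Sum>k\<le>N. C j k) * 0"
    by (intro tendsto_intros LIMSEQ_power_zero) simp
  have "(\<lambda>n. schwartz_seminorm N (fourier (\<rho> n))) \<longlonglongrightarrow> 0"
    by (rule tendsto_sandwich[OF _ _ tendsto_const]) (use nn le lim in \<open>auto intro!: always_eventually\<close>)
  then show ?thesis unfolding \<rho>_def .
qed

definition lp_mult :: "(real \<Rightarrow> real) \<times> (real \<Rightarrow> real) \<Rightarrow> int \<Rightarrow> real \<Rightarrow> real" where
  "lp_mult lp q \<xi> = (if q = -1 then snd lp \<xi> else fst lp (2 powi (- q) * \<xi>))"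

text \<open>A block acts on the test function: the multiplier is applied to its inverse Fourier transform.\<close>

lemma block_apply: "block lp q F \<psi> = F (fourier (\<lambda>\<xi>. lp_mult lp q \<xi> *\<^sub>R inv_fourier \<psi> \<xi>))"
  by (simp add: block_def dist_inv_fourier_def dist_mult_def dist_fourier_def lp_mult_def scaleR_conv_of_real if_distrib[of "\<lambda>f. f _"] cong: if_cong)

context
  fixes phi chi :: "real \<Rightarrow> real"
  assumes lp: "littlewood_paley phi chi"
begin

lemma chi_props: "smooth chi" "{\<xi>. chi \<xi> \<noteq> 0} \<subseteq> {\<xi>. \<bar>\<xi>\<bar> \<le> 4/3}" "0 \<le> chi \<xi> \<and> chi \<xi> \<le> 1"
  using lp by (auto simp: littlewood_paley_def image_subset_iff)

lemma phi_props: "smooth phi" "phi \<xi> \<noteq> 0 \<Longrightarrow> 3/4 \<le> \<bar>\<xi>\<bar> \<and> \<bar>\<xi>\<bar> \<le> 8/3"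
  using lp by (auto simp: littlewood_paley_def)

lemma lp_sum: "((\<lambda>q::int. phi (2 powi (- q) * \<xi>)) has_sum (1 - chi \<xi>)) {0..}"
  using lp by (auto simp: littlewood_paley_def)

text \<open>The functions \<open>phi (2 powi (-q) \<xi>)\<close> with \<open>q \<ge> 0\<close> all vanish at such \<open>\<xi>\<close>.\<close>

lemma chi_one: assumes x: "\<bar>\<xi>\<bar> < 3/4" shows "chi \<xi> = 1"
proof -
  have "phi (2 powi (- q) * \<xi>) = 0" if "q \<in> {0..}" for q :: int
  proof (rule ccontr)
    assume "phi (2 powi (- q) * \<xi>) \<noteq> 0"
    then have "3/4 \<le> 2 powi (- q) * \<bar>\<xi>\<bar>" using phi_props(2) by (fastforce simp: abs_mult)
    moreover have "2 powi (- q) \<le> (1::real)"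
      using that by (simp add: power_int_minus power_int_def inverse_le_1_iff power_le_one)
    then have "2 powi (- q) * \<bar>\<xi>\<bar> \<le> 1 * \<bar>\<xi>\<bar>" by (rule mult_right_mono) simp
    ultimately show False using x by simp
  qed
  then have "((\<lambda>q::int. phi (2 powi (- q) * \<xi>)) has_sum 0) {0..}" by (rule has_sum_0)
  from has_sum_unique[OF this lp_sum] show ?thesis by simp
qed

text \<open>The partition of unity at the rescaled point \<open>\<xi> / 2\<^sup>n\<close> is the tail of the partition of unity at \<open>\<xi>\<close>.\<close>

lemma lp_partial_sum: "(\<Sum>q\<in>{-1..<int n}. lp_mult (phi, chi) q \<xi>) = chi ((1/2) ^ n * \<xi>)"
proof -
  let ?f = "\<lambda>q::int. phi (2 powi (- q) * \<xi>)"
  have e: "2 powi (- (q + int n)) * \<xi> = 2 powi (- q) * ((1/2) ^ n * \<xi>)" for q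
    by (simp add: power_int_add power_int_diff power_divide field_simps)
  have "((?f \<circ> (\<lambda>q. q + int n)) has_sum (1 - chi ((1/2) ^ n * \<xi>))) {0..}"
    using lp_sum[of "(1/2) ^ n * \<xi>"] by (simp only: o_def e)
  then have "(?f has_sum (1 - chi ((1/2) ^ n * \<xi>))) ((\<lambda>q. q + int n) ` {0..})"
    by (subst has_sum_reindex) (auto simp: inj_on_def)
  also have "(\<lambda>q. q + int n) ` {0..} = {int n..}"
    by (auto simp: image_iff intro!: bexI[of _ "_ - int n"])
  finally have tail: "(?f has_sum (1 - chi ((1/2) ^ n * \<xi>))) {int n..}" .
  have "(?f has_sum (\<Sum>q\<in>{0..<int n}. ?f q)) {0..<int n}" by (rule has_sum_finite) simp
  moreover have "{0..<int n} \<inter> {int n..} = {}" by auto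
  ultimately have "(?f has_sum ((\<Sum>q\<in>{0..<int n}. ?f q) + (1 - chi ((1/2) ^ n * \<xi>)))) ({0..<int n} \<union> {int n..})"
    using has_sum_Un_disjoint[OF _ tail] by blast
  also have "{0..<int n} \<union> {int n..} = {0..}" by auto
  finally have "(\<Sum>q\<in>{0..<int n}. ?f q) + (1 - chi ((1/2) ^ n * \<xi>)) = 1 - chi \<xi>"
    by (rule has_sum_unique[OF _ lp_sum])
  moreover have "{-1..<int n} = insert (-1) {0..<int n}" by auto
  ultimately show ?thesis by (simp add: lp_mult_def)
qed

lemma lp_mult_support: assumes q: "-1 \<le> q" and nz: "lp_mult (phi, chi) q \<xi> \<noteq> 0"
  shows "\<bar>\<xi>\<bar> \<le> 8/3 * 2 powi q"
proof (cases "q = -1")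
  case True
  then have "chi \<xi> \<noteq> 0" using nz by (simp add: lp_mult_def)
  then show ?thesis using chi_props(2) True by (auto simp: power_int_minus)
next
  case False
  then have "phi (2 powi (- q) * \<xi>) \<noteq> 0" using nz by (simp add: lp_mult_def)
  then have "2 powi (- q) * \<bar>\<xi>\<bar> \<le> 8/3" using phi_props(2)[of "2 powi (- q) * \<xi>"] by (simp add: abs_mult)
  then show ?thesis by (simp add: power_int_minus field_simps)
qed

lemma lp_mult_moderate: assumes q: "-1 \<le> q" shows "moderate (lp_mult (phi, chi) q)"
proof (rule moderate_compact_support)
  show "smooth (lp_mult (phi, chi) q)"
    unfolding lp_mult_def[abs_def] using chi_props(1) nderiv_compose_scale(2)[OF phi_props(1), of "2 powi (- q)"]
    by (cases "q = -1") simp_all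
  show "{\<xi>. lp_mult (phi, chi) q \<xi> \<noteq> 0} \<subseteq> {\<xi>. \<bar>\<xi>\<bar> \<le> 8/3 * 2 powi q}"
    using lp_mult_support[OF q] by auto
qed

end

lemma schwartz_sum: "finite A \<Longrightarrow> (\<And>q. q \<in> A \<Longrightarrow> f q \<in> schwartz) \<Longrightarrow> (\<lambda>x. \<Sum>q\<in>A. f q x) \<in> schwartz"
proof (induction A rule: finite_induct)
  case empty
  have z: "nderiv k (\<lambda>x. 0::complex) = (\<lambda>x. 0)" "smooth (\<lambda>x. 0::complex)" for k
    using nderiv_eqI[of "\<lambda>k x. 0::complex"] by auto
  show ?case unfolding schwartz_iff sum.empty z(1) using z(2) by auto
next
  case (insert q A) then show ?case by (simp add: schwartz_add)
qed

lemma tempered_linear: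
  assumes "tempered F" "\<psi> \<in> schwartz" "\<eta> \<in> schwartz"
  shows "F (\<lambda>x. c * \<psi> x + d * \<eta> x) = c * F \<psi> + d * F \<eta>"
  using assms by (simp add: tempered_def)

lemma tempered_sum:
  assumes F: "tempered F" and A: "finite A" and f: "\<And>q. q \<in> A \<Longrightarrow> f q \<in> schwartz"
  shows "F (\<lambda>x. \<Sum>q\<in>A. f q x) = (\<Sum>q\<in>A. F (f q))"
  using A f
proof (induction A rule: finite_induct)
  case empty
  have "F (\<lambda>x. 0 * (\<Sum>q\<in>({}::'a set). f q x) + 0 * (\<Sum>q\<in>({}::'a set). f q x)) = 0 * F (\<lambda>x. \<Sum>q\<in>({}::'a set). f q x) + 0 * F (\<lambda>x. \<Sum>q\<in>({}::'a set). f q x)"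
    by (intro tempered_linear[OF F] schwartz_sum) auto
  then show ?case by simp
next
  case (insert q A)
  have "F (\<lambda>x. 1 * f q x + 1 * (\<Sum>q\<in>A. f q x)) = 1 * F (f q) + 1 * F (\<lambda>x. \<Sum>q\<in>A. f q x)"
    by (intro tempered_linear[OF F] schwartz_sum insert) (use insert in auto)
  then show ?case using insert by simp
qed

lemma fourier_sum:
  assumes "finite A" "\<And>q. q \<in> A \<Longrightarrow> f q \<in> schwartz"
  shows "fourier (\<lambda>x. \<Sum>q\<in>A. f q x) \<xi> = (\<Sum>q\<in>A. fourier (f q) \<xi>)"
proof -
  have "(LINT x|lborel. (\<Sum>q\<in>A. cis (- (x * \<xi>)) * f q x)) = (\<Sum>q\<in>A. LINT x|lborel. cis (- (x * \<xi>)) * f q x)"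
    by (rule Bochner_Integration.integral_sum) (intro integrable_cis_mult schwartz_integrable assms; measurable)
  then show ?thesis unfolding fourier_def by (simp add: sum_distrib_left)
qed

context
  fixes phi chi :: "real \<Rightarrow> real"
  assumes lp: "littlewood_paley phi chi"
begin

text \<open>The partial sum applied to \<open>\<theta>\<close> differs from \<open>F \<theta>\<close> by \<open>F\<close> at the Fourier transform of a function cut off
to the frequencies above \<open>2\<^sup>n\<close>, which tends to \<open>0\<close> in every Schwartz seminorm.\<close>

lemma lp_converges:
  assumes F: "tempered F" and p: "\<theta> \<in> schwartz"
  shows "(\<lambda>n. \<Sum>q\<in>{-1..<int n}. block (phi, chi) q F \<theta>) \<longlonglongrightarrow> F \<theta>"
proof -
  define \<eta> where "\<eta> = inv_fourier \<theta>"
  have \<eta>: "\<eta> \<in> schwartz" unfolding \<eta>_def by (rule inv_fourier_schwartz[OF p])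
  have th: "fourier \<eta> = \<theta>" unfolding \<eta>_def using fourier_inv_fourier[OF p] by auto
  define \<rho> where "\<rho> n = (\<lambda>x. (1 - chi ((1/2) ^ n * x)) *\<^sub>R \<eta> x)" for n
  note c = chi_props[OF lp] chi_one[OF lp]
  have \<rho>: "\<rho> n \<in> schwartz" for n unfolding \<rho>_def by (rule cutoff_decay(2)[OF c \<eta>])
  let ?m = "\<lambda>q \<xi>. lp_mult (phi, chi) q \<xi> *\<^sub>R \<eta> \<xi>"
  have mq: "?m q \<in> schwartz" if "q \<in> {-1..<int n}" for q n
    using that by (intro schwartz_mult lp_mult_moderate[OF lp] \<eta>) auto
  have eq: "F \<theta> - (\<Sum>q\<in>{-1..<int n}. block (phi, chi) q F \<theta>) = F (fourier (\<rho> n))" for n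
  proof -
    have s: "(\<lambda>\<xi>. \<Sum>q\<in>{-1..<int n}. ?m q \<xi>) = (\<lambda>\<xi>. chi ((1/2) ^ n * \<xi>) *\<^sub>R \<eta> \<xi>)"
      unfolding scaleR_sum_left[symmetric] lp_partial_sum[OF lp] ..
    have sS: "(\<lambda>\<xi>. \<Sum>q\<in>{-1..<int n}. ?m q \<xi>) \<in> schwartz" by (intro schwartz_sum mq) auto
    have "(\<Sum>q\<in>{-1..<int n}. block (phi, chi) q F \<theta>) = (\<Sum>q\<in>{-1..<int n}. F (fourier (?m q)))"
      by (simp add: block_apply \<eta>_def)
    also have "\<dots> = F (\<lambda>\<xi>. \<Sum>q\<in>{-1..<int n}. fourier (?m q) \<xi>)"
      by (intro tempered_sum[OF F, symmetric] fourier_schwartz mq) auto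
    also have "(\<lambda>\<xi>. \<Sum>q\<in>{-1..<int n}. fourier (?m q) \<xi>) = fourier (\<lambda>\<xi>. \<Sum>q\<in>{-1..<int n}. ?m q \<xi>)"
      by (intro ext fourier_sum[symmetric] mq) auto
    finally have 1: "(\<Sum>q\<in>{-1..<int n}. block (phi, chi) q F \<theta>) = F (fourier (\<lambda>\<xi>. \<Sum>q\<in>{-1..<int n}. ?m q \<xi>))" .
    have i: "integrable lborel (\<lambda>x. cis (- (x * \<xi>)) * f x)" if "f \<in> schwartz" for \<xi> f
      by (intro integrable_cis_mult schwartz_integrable that) measurable
    have "fourier (\<rho> n) \<xi> = 1 * \<theta> \<xi> + (-1) * fourier (\<lambda>\<xi>. \<Sum>q\<in>{-1..<int n}. ?m q \<xi>) \<xi>" for \<xi>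
    proof -
      have "fourier (\<rho> n) \<xi> = (LINT x|lborel. cis (- (x * \<xi>)) * \<eta> x - cis (- (x * \<xi>)) * (\<Sum>q\<in>{-1..<int n}. ?m q x))"
        unfolding fourier_def \<rho>_def fun_cong[OF s] scaleR_diff_left scaleR_one right_diff_distrib ..
      also have "\<dots> = fourier \<eta> \<xi> - fourier (\<lambda>\<xi>. \<Sum>q\<in>{-1..<int n}. ?m q \<xi>) \<xi>"
        unfolding fourier_def by (rule Bochner_Integration.integral_diff[OF i[OF \<eta>] i[OF sS]])
      finally show ?thesis by (simp add: th)
    qed
    then have "fourier (\<rho> n) = (\<lambda>\<xi>. 1 * \<theta> \<xi> + (-1) * fourier (\<lambda>\<xi>. \<Sum>q\<in>{-1..<int n}. ?m q \<xi>) \<xi>)" by (rule ext)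
    then have "F (fourier (\<rho> n)) = 1 * F \<theta> + (-1) * F (fourier (\<lambda>\<xi>. \<Sum>q\<in>{-1..<int n}. ?m q \<xi>))"
      by (simp only: tempered_linear[OF F p fourier_schwartz[OF sS]])
    then show ?thesis unfolding 1 by simp
  qed
  obtain C N where CN: "\<And>\<psi>. \<psi> \<in> schwartz \<Longrightarrow> norm (F \<psi>) \<le> C * schwartz_seminorm N \<psi>"
    using F unfolding tempered_def by blast
  have "(\<lambda>n. C * schwartz_seminorm N (fourier (\<rho> n))) \<longlonglongrightarrow> C * 0"
    unfolding \<rho>_def by (intro tendsto_mult_left seminorm_fourier_cutoff[OF c \<eta>])
  then have "(\<lambda>n. C * schwartz_seminorm N (fourier (\<rho> n))) \<longlonglongrightarrow> 0" by simp
  then have "(\<lambda>n. F (fourier (\<rho> n))) \<longlonglongrightarrow> 0"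
    by (rule Lim_null_comparison[rotated]) (use CN[OF fourier_schwartz[OF \<rho>]] in \<open>auto intro: always_eventually\<close>)
  then have "(\<lambda>n. F \<theta> - F (fourier (\<rho> n))) \<longlonglongrightarrow> F \<theta> - 0" by (intro tendsto_diff tendsto_const)
  then show ?thesis by (simp add: eq[symmetric])
qed

text \<open>Bernstein's inequality on the side of the test functions. The block does not see the test function at
frequencies above \<open>3 * 2 powi q\<close>, so \<open>\<theta>'\<close> may be replaced by its part \<open>\<kappa>\<close> at frequencies of at most this
order; the derivative then costs a factor \<open>2 powi q\<close> in \<open>L\<^sup>2\<close>, by Plancherel's identity.\<close>

lemma block_deriv:
  assumes q: "-1 \<le> q" and p: "\<theta> \<in> schwartz"
  shows "\<exists>\<kappa>\<in>schwartz. block (phi, chi) q F (nderiv 1 \<theta>) = block (phi, chi) q F \<kappa> \<and>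
    sqrt (LINT x|lborel. (norm (\<kappa> x))\<^sup>2) \<le> 16/3 * 2 powi q * sqrt (LINT x|lborel. (norm (\<theta> x))\<^sup>2)"
proof -
  define \<eta> where "\<eta> = inv_fourier \<theta>"
  have \<eta>: "\<eta> \<in> schwartz" unfolding \<eta>_def by (rule inv_fourier_schwartz[OF p])
  have th: "fourier \<eta> = \<theta>" unfolding \<eta>_def using fourier_inv_fourier[OF p] by auto
  \<comment> \<open>\<open>chi\<close> is \<open>1\<close> up to \<open>3/4\<close>; dilated by \<open>2 powi (q + 2)\<close> it is \<open>1\<close> on the support of the multiplier.\<close>
  define M where "M = (\<lambda>\<xi>. chi (2 powi (- q - 2) * \<xi>))"
  define \<omega> where "\<omega> = (\<lambda>\<xi>. M \<xi> *\<^sub>R Xop \<eta> \<xi>)"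
  have pw: "2 powi (- q - 2) = inverse (2 powi q) / (4::real)"
    by (simp add: power_int_diff power_int_minus)
  have pos: "0 < (2::real) powi q" by simp
  have Msupp: "\<bar>\<xi>\<bar> \<le> 16/3 * 2 powi q" if "M \<xi> \<noteq> 0" for \<xi>
  proof -
    have "2 powi (- q - 2) * \<bar>\<xi>\<bar> \<le> 4/3" using that chi_props(2)[OF lp] by (auto simp: M_def abs_mult)
    then show ?thesis using pos unfolding pw by (simp add: field_simps)
  qed
  have "moderate M"
  proof (rule moderate_compact_support)
    show "smooth M" unfolding M_def by (rule nderiv_compose_scale(2)[OF chi_props(1)[OF lp]])
    show "{\<xi>. M \<xi> \<noteq> 0} \<subseteq> {\<xi>. \<bar>\<xi>\<bar> \<le> 16/3 * 2 powi q}" using Msupp by auto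
  qed
  then have \<omega>: "\<omega> \<in> schwartz" unfolding \<omega>_def by (intro schwartz_mult Xop_schwartz \<eta>)
  have inv: "inv_fourier (nderiv 1 \<theta>) = Xop \<eta>"
    unfolding \<eta>_def fun_eq_iff inv_fourier_eq Xop_def fourier_deriv[OF p] by (simp add: scaleR_conv_of_real)
  have cut: "(\<lambda>\<xi>. lp_mult (phi, chi) q \<xi> *\<^sub>R Xop \<eta> \<xi>) = (\<lambda>\<xi>. lp_mult (phi, chi) q \<xi> *\<^sub>R \<omega> \<xi>)"
  proof
    fix \<xi>
    show "lp_mult (phi, chi) q \<xi> *\<^sub>R Xop \<eta> \<xi> = lp_mult (phi, chi) q \<xi> *\<^sub>R \<omega> \<xi>"
  proof (cases "lp_mult (phi, chi) q \<xi> = 0")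
    case False
    have "\<bar>\<xi>\<bar> < 3 * 2 powi q" using lp_mult_support[OF lp q False] pos by linarith
    then have "\<bar>2 powi (- q - 2) * \<xi>\<bar> < 3/4"
      using pos unfolding pw by (simp add: abs_mult field_simps)
    then have "M \<xi> = 1" unfolding M_def by (rule chi_one[OF lp])
    then show ?thesis by (simp add: \<omega>_def)
  qed simp
  qed
  have 1: "block (phi, chi) q F (nderiv 1 \<theta>) = block (phi, chi) q F (fourier \<omega>)"
  proof -
    have io: "inv_fourier (fourier \<omega>) = \<omega>" using inv_fourier_fourier[OF \<omega>] by (rule ext)
    show ?thesis unfolding block_apply inv io cut ..
  qed
  have "(LINT x|lborel. (norm (fourier \<omega> x))\<^sup>2) = 2 * pi * (LINT x|lborel. (norm (\<omega> x))\<^sup>2)" by (rule plancherel[OF \<omega>])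
  also have "\<dots> \<le> 2 * pi * (LINT x|lborel. (16/3 * 2 powi q)\<^sup>2 * (norm (\<eta> x))\<^sup>2)"
  proof (intro mult_left_mono integral_mono)
    show "(norm (\<omega> x))\<^sup>2 \<le> (16/3 * 2 powi q)\<^sup>2 * (norm (\<eta> x))\<^sup>2" for x
    proof -
      have "norm (\<omega> x) = \<bar>M x\<bar> * (\<bar>x\<bar> * norm (\<eta> x))" by (simp add: \<omega>_def Xop_def norm_mult abs_mult)
      also have "\<dots> \<le> 1 * (16/3 * 2 powi q * norm (\<eta> x))"
      proof (cases "M x = 0")
        case False
        have "\<bar>M x\<bar> \<le> 1" using chi_props(3)[OF lp] by (simp add: M_def abs_le_iff)
        then show ?thesis using Msupp[OF False] by (intro mult_mono) auto
      qed simp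
      finally have "(norm (\<omega> x))\<^sup>2 \<le> (16/3 * 2 powi q * norm (\<eta> x))\<^sup>2" by (intro power_mono) auto
      then show ?thesis by (simp only: power_mult_distrib)
    qed
  qed (use schwartz_sq_integrable[OF \<omega>] schwartz_sq_integrable[OF \<eta>] in auto)
  also have "\<dots> = (16/3 * 2 powi q)\<^sup>2 * (LINT x|lborel. (norm (\<theta> x))\<^sup>2)"
    using plancherel[OF \<eta>] unfolding th by simp
  finally have "sqrt (LINT x|lborel. (norm (fourier \<omega> x))\<^sup>2) \<le> sqrt ((16/3 * 2 powi q)\<^sup>2 * (LINT x|lborel. (norm (\<theta> x))\<^sup>2))"
    by (rule real_sqrt_le_mono)
  also have "\<dots> = 16/3 * 2 powi q * sqrt (LINT x|lborel. (norm (\<theta> x))\<^sup>2)"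
    unfolding real_sqrt_mult using pos by (simp add: abs_mult)
  finally show ?thesis using 1 fourier_schwartz[OF \<omega>] by blast
qed

end

section \<open>From Besov norms to square integrability\<close>

lemma enn_powr_1: "enn_powr x 1 = x"
  unfolding enn_powr_def by (cases x) auto

lemma Lp_norm_2:
  fixes r :: "'a \<Rightarrow> real"
  assumes m[measurable]: "r \<in> borel_measurable M" and nn: "\<And>x. 0 \<le> r x"
  shows "integrable M (\<lambda>x. (r x)\<^sup>2) \<Longrightarrow> Lp_norm 2 M (\<lambda>x. ennreal (r x)) = ennreal (sqrt (LINT x|M. (r x)\<^sup>2))"
    and "Lp_norm 2 M (\<lambda>x. ennreal (r x)) < \<infinity> \<Longrightarrow> integrable M (\<lambda>x. (r x)\<^sup>2)"
proof -
  have p: "enn_powr (ennreal (r x)) 2 = ennreal ((r x)\<^sup>2)" for x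
    using nn[of x] by (simp add: enn_powr_def)
  have e: "Lp_norm 2 M (\<lambda>x. ennreal (r x)) = enn_powr (\<integral>\<^sup>+x. ennreal ((r x)\<^sup>2) \<partial>M) (1 / 2)"
    unfolding Lp_norm_def by (simp add: p)
  show "Lp_norm 2 M (\<lambda>x. ennreal (r x)) = ennreal (sqrt (LINT x|M. (r x)\<^sup>2))" if i: "integrable M (\<lambda>x. (r x)\<^sup>2)"
  proof -
    have "(\<integral>\<^sup>+x. ennreal ((r x)\<^sup>2) \<partial>M) = ennreal (LINT x|M. (r x)\<^sup>2)"
      by (rule nn_integral_eq_integral[OF i]) simp
    then show ?thesis unfolding e by (simp add: enn_powr_def powr_half_sqrt)
  qed
  show "integrable M (\<lambda>x. (r x)\<^sup>2)" if f: "Lp_norm 2 M (\<lambda>x. ennreal (r x)) < \<infinity>"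
  proof (rule integrableI_nonneg)
    show "(\<integral>\<^sup>+x. ennreal ((r x)\<^sup>2) \<partial>M) < \<infinity>"
      using f unfolding e by (auto simp: enn_powr_def less_top split: if_splits)
  qed auto
qed

text \<open>Cauchy-Schwarz for a representing function whose norm is almost the infimum.\<close>

lemma dist_pair_bound:
  assumes G: "dist_Lp_norm 2 G \<le> ennreal N" and N: "0 \<le> N" and p: "\<theta> \<in> schwartz"
  shows "norm (G \<theta>) \<le> N * sqrt (LINT x|lborel. (norm (\<theta> x))\<^sup>2)"
proof (rule field_le_epsilon)
  fix e :: real assume e: "0 < e"
  define T where "T = sqrt (LINT x|lborel. (norm (\<theta> x))\<^sup>2)"
  have T: "0 \<le> T" by (simp add: T_def)
  define d where "d = e / (T + 1)"
  have d: "0 < d" using e T by (simp add: d_def)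
  have "dist_Lp_norm 2 G < ennreal (N + d)" by (rule le_less_trans[OF G]) (use N d in \<open>simp add: ennreal_lessI\<close>)
  then obtain g where g: "g \<in> borel_measurable lborel" "Lp_norm 2 lborel (\<lambda>x. ennreal (norm (g x))) < ennreal (N + d)"
      "\<And>\<psi>. \<psi> \<in> schwartz \<Longrightarrow> G \<psi> = dist_of g \<psi>"
    unfolding dist_Lp_norm_def Inf_less_iff by blast
  have fin: "Lp_norm 2 lborel (\<lambda>x. ennreal (norm (g x))) < \<infinity>"
    by (rule less_trans[OF g(2)]) simp
  have gi: "integrable lborel (\<lambda>x. (norm (g x))\<^sup>2)"
    by (rule Lp_norm_2(2)[OF _ _ fin]) (use g(1) in auto)
  have "ennreal (sqrt (LINT x|lborel. (norm (g x))\<^sup>2)) < ennreal (N + d)"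
    using g(2) Lp_norm_2(1)[OF _ _ gi] g(1) by simp
  then have gN: "sqrt (LINT x|lborel. (norm (g x))\<^sup>2) \<le> N + d"
    by (subst (asm) ennreal_less_iff) simp_all
  have "norm (G \<theta>) = norm (LINT x|lborel. g x * \<theta> x)" by (simp add: g(3)[OF p] dist_of_def)
  also have "\<dots> \<le> sqrt (LINT x|lborel. (norm (g x))\<^sup>2) * T"
    unfolding T_def
    by (rule cauchy_schwarz_complex(1)[OF g(1) _ gi schwartz_sq_integrable[OF p]])
      (use schwartz_measurable[OF p] in simp)
  also have "\<dots> \<le> (N + d) * T" by (rule mult_right_mono[OF gN T])
  also have "\<dots> = N * T + d * T" by (simp add: distrib_right)
  also have "d * T \<le> e" using e T by (simp add: d_def field_simps)
  finally show "norm (G \<theta>) \<le> N * T + e" by simp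
qed

text \<open>The extended-real norm of a weighted sequence is turned into a real sequence with bounded partial sums.\<close>

lemma weighted_l1:
  fixes E :: "int \<Rightarrow> ennreal"
  assumes b: "Lp_norm 1 (count_space {-1..}) (\<lambda>q. ennreal (2 powr (of_int q * s)) * E q) \<le> ennreal M" and M: "0 \<le> M"
  shows "\<exists>N. (\<forall>q\<ge>-1. 0 \<le> N q \<and> E q = ennreal (N q)) \<and> (\<forall>n. (\<Sum>q\<in>{-1..<int n}. 2 powr (of_int q * s) * N q) \<le> M)"
proof -
  define h where "h = (\<lambda>q. ennreal (2 powr (of_int q * s)) * E q)"
  have "Lp_norm 1 (count_space {-1..}) h = (\<integral>\<^sup>+q. h q \<partial>count_space {-1..})"
    unfolding Lp_norm_def by (simp add: enn_powr_1)
  then have hb: "(\<integral>\<^sup>+q. h q \<partial>count_space {-1..}) \<le> ennreal M" using b by (simp add: h_def)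
  have fs: "(\<Sum>q\<in>A. h q) \<le> ennreal M" if A: "finite A" "A \<subseteq> {-1..}" for A
  proof -
    have "(\<Sum>q\<in>A. h q) = (\<integral>\<^sup>+q. h q \<partial>count_space A)" using A(1) by (simp add: nn_integral_count_space_finite)
    also have "\<dots> = (\<integral>\<^sup>+q. h q * indicator A q \<partial>count_space {-1..})"
      using A(2) by (subst nn_integral_restrict_space[symmetric]) (auto simp: restrict_count_space Int_absorb2)
    also have "\<dots> \<le> (\<integral>\<^sup>+q. h q \<partial>count_space {-1..})" by (rule nn_integral_mono) (auto simp: indicator_def)
    finally show ?thesis using hb by simp
  qed
  have fin: "E q < \<infinity>" if q: "-1 \<le> q" for q
  proof -
    have "h q \<le> ennreal M" using fs[of "{q}"] q by simp
    then have "h q < \<infinity>" by (rule le_less_trans) simp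
    then show ?thesis unfolding h_def by (auto simp: ennreal_mult_less_top)
  qed
  define N where "N q = enn2real (E q)" for q
  have N0: "0 \<le> N q" for q by (simp add: N_def)
  have EN: "E q = ennreal (N q)" if "-1 \<le> q" for q using fin[OF that] by (simp add: N_def)
  have "(\<Sum>q\<in>{-1..<int n}. 2 powr (of_int q * s) * N q) \<le> M" for n
  proof -
    have "ennreal (\<Sum>q\<in>{-1..<int n}. 2 powr (of_int q * s) * N q) = (\<Sum>q\<in>{-1..<int n}. ennreal (2 powr (of_int q * s) * N q))"
      by (rule sum_ennreal[symmetric]) (simp add: N_def)
    also have "\<dots> = (\<Sum>q\<in>{-1..<int n}. h q)"
      by (rule sum.cong) (auto simp: h_def EN ennreal_mult N0)
    also have "\<dots> \<le> ennreal M" by (rule fs) auto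
    finally show ?thesis using M by (simp add: ennreal_le_iff)
  qed
  then show ?thesis using EN N0 by blast
qed

text \<open>The constants make room for the smallest index \<open>q = -1\<close>.\<close>

lemma dyadic_weight_bounds:
  assumes q: "-1 \<le> (q::int)"
  shows "1 \<le> 2 * (2::real) powr (of_int q * (1/2))" "1 \<le> 4 * (2::real) powr (of_int q * (3/2))"
    "(2::real) powi q \<le> 2 * 2 powr (of_int q * (3/2))"
proof -
  have c: "(2::real) powr x \<ge> 1" if "0 \<le> x" for x using that by (simp add: ge_one_powr_ge_zero)
  have "1 \<le> (2::real) powr (1 + of_int q * (1/2))" by (rule c) (use q in simp)
  then show "1 \<le> 2 * (2::real) powr (of_int q * (1/2))" by (simp add: powr_add)
  have "1 \<le> (2::real) powr (2 + of_int q * (3/2))" by (rule c) (use q in simp)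
  then show "1 \<le> 4 * (2::real) powr (of_int q * (3/2))" by (simp add: powr_add)
  have "(2::real) powi q = 2 powr of_int q" by (simp add: powr_real_of_int')
  also have "\<dots> \<le> 2 powr (1 + of_int q * (3/2))" by (rule powr_mono) (use q in auto)
  finally show "(2::real) powi q \<le> 2 * 2 powr (of_int q * (3/2))" by (simp add: powr_add)
qed

lemma sum_weight_mono:
  fixes w w' N :: "int \<Rightarrow> real"
  assumes N: "\<And>q. -1 \<le> q \<Longrightarrow> 0 \<le> N q" and w: "\<And>q. -1 \<le> q \<Longrightarrow> w' q \<le> c * w q" and c: "0 \<le> c"
    and M: "(\<Sum>q\<in>{-1..<int n}. w q * N q) \<le> M"
  shows "(\<Sum>q\<in>{-1..<int n}. w' q * N q) \<le> c * M"
proof -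
  have "(\<Sum>q\<in>{-1..<int n}. w' q * N q) \<le> (\<Sum>q\<in>{-1..<int n}. c * (w q * N q))"
    using mult_right_mono[OF w N] by (intro sum_mono) (simp add: mult.assoc)
  also have "\<dots> \<le> c * M" unfolding sum_distrib_left[symmetric] by (rule mult_left_mono[OF M c])
  finally show ?thesis .
qed

text \<open>Supplies, with a bump function for \<open>\<psi>\<close>, test functions that approximate a continuous function uniformly on
an interval.\<close>

lemma polynomial_schwartz:
  assumes "real_polynomial_function g" "\<psi> \<in> schwartz"
  shows "(\<lambda>x. g x *\<^sub>R \<psi> x) \<in> schwartz"
  using assms
proof (induction g arbitrary: \<psi> rule: real_polynomial_function.induct)
  case (linear f)
  define c where "c = f 1"
  have "f x = c * x" for x
    using linear_cmul[OF bounded_linear.linear[OF linear(1)], of x 1] by (simp add: c_def)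
  then have "(\<lambda>x. f x *\<^sub>R \<psi> x) = (\<lambda>x. of_real c * (x *\<^sub>R \<psi> x))" by (auto simp: fun_eq_iff scaleR_conv_of_real)
  then show ?case using linear by (simp add: schwartz_cmult schwartz_mult moderate_id)
next
  case (const c) then show ?case by (simp add: scaleR_conv_of_real schwartz_cmult)
next
  case (add f g) then show ?case by (simp add: scaleR_add_left schwartz_add)
next
  case (mult f g) then show ?case by (simp flip: scaleR_scaleR)
qed

lemma integrable_compact_support:
  fixes g :: "real \<Rightarrow> 'a::{banach, second_countable_topology}"
  assumes c: "continuous_on UNIV g" and z: "\<And>x. R < \<bar>x\<bar> \<Longrightarrow> g x = 0"
  shows "integrable lborel g"
proof -
  have "set_integrable lborel {-R..R} g"
    by (rule borel_integrable_atLeastAtMost') (use c continuous_on_subset in auto)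
  moreover have "indicator {-R..R} x *\<^sub>R g x = g x" for x
    using z[of x] by (auto simp: indicator_def)
  ultimately show ?thesis by (simp add: set_integrable_def)
qed

context
  fixes phi chi :: "real \<Rightarrow> real"
  assumes lp: "littlewood_paley phi chi"
begin

text \<open>A bound for \<open>L\<^sup>2\<close> norms of blocks is a bound for their pairing with a test function; sum over the blocks.\<close>

lemma block_bounds:
  assumes F: "tempered F" and N: "\<And>q. -1 \<le> q \<Longrightarrow> 0 \<le> N q \<and> dist_Lp_norm 2 (block (phi, chi) q F) \<le> ennreal (N q)"
    and p: "\<theta> \<in> schwartz"
  shows "(\<And>n. (\<Sum>q\<in>{-1..<int n}. N q) \<le> B) \<Longrightarrow> norm (F \<theta>) \<le> B * sqrt (LINT x|lborel. (norm (\<theta> x))\<^sup>2)"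
    and "(\<And>n. (\<Sum>q\<in>{-1..<int n}. 2 powi q * N q) \<le> B) \<Longrightarrow>
      norm (F (nderiv 1 \<theta>)) \<le> 16/3 * B * sqrt (LINT x|lborel. (norm (\<theta> x))\<^sup>2)"
proof -
  define T where "T = sqrt (LINT x|lborel. (norm (\<theta> x))\<^sup>2)"
  have T: "0 \<le> T" by (simp add: T_def)
  have lim: "norm (F \<psi>) \<le> D" if \<psi>: "\<psi> \<in> schwartz"
    and le: "\<And>n. (\<Sum>q\<in>{-1..<int n}. norm (block (phi, chi) q F \<psi>)) \<le> D" for \<psi> D
  proof (rule LIMSEQ_le_const2[OF tendsto_norm[OF lp_converges[OF lp F \<psi>]]])
    show "\<exists>N. \<forall>n\<ge>N. norm (\<Sum>q\<in>{-1..<int n}. block (phi, chi) q F \<psi>) \<le> D"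
      using le by (intro exI[of _ 0] allI impI order_trans[OF norm_sum])
  qed
  show "norm (F \<theta>) \<le> B * sqrt (LINT x|lborel. (norm (\<theta> x))\<^sup>2)" if B: "\<And>n. (\<Sum>q\<in>{-1..<int n}. N q) \<le> B"
  proof (rule lim[OF p])
    fix n
    have "(\<Sum>q\<in>{-1..<int n}. norm (block (phi, chi) q F \<theta>)) \<le> (\<Sum>q\<in>{-1..<int n}. N q * T)"
      unfolding T_def by (intro sum_mono dist_pair_bound p) (use N in auto)
    also have "\<dots> \<le> B * T" unfolding sum_distrib_right[symmetric] by (intro mult_right_mono B T)
    finally show "(\<Sum>q\<in>{-1..<int n}. norm (block (phi, chi) q F \<theta>)) \<le> B * sqrt (LINT x|lborel. (norm (\<theta> x))\<^sup>2)"
      unfolding T_def .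
  qed
  show "norm (F (nderiv 1 \<theta>)) \<le> 16/3 * B * sqrt (LINT x|lborel. (norm (\<theta> x))\<^sup>2)"
    if B: "\<And>n. (\<Sum>q\<in>{-1..<int n}. 2 powi q * N q) \<le> B"
  proof (rule lim[OF schwartz_nderiv[OF p]])
    fix n
    have "(\<Sum>q\<in>{-1..<int n}. norm (block (phi, chi) q F (nderiv 1 \<theta>))) \<le> (\<Sum>q\<in>{-1..<int n}. 16/3 * T * (2 powi q * N q))"
    proof (rule sum_mono)
      fix q assume "q \<in> {-1..<int n}"
      then have q: "-1 \<le> q" by simp
      obtain \<kappa> where k: "\<kappa> \<in> schwartz" "block (phi, chi) q F (nderiv 1 \<theta>) = block (phi, chi) q F \<kappa>"
        "sqrt (LINT x|lborel. (norm (\<kappa> x))\<^sup>2) \<le> 16/3 * 2 powi q * T"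
        using block_deriv[OF lp q p, of F] unfolding T_def by blast
      have "norm (block (phi, chi) q F \<kappa>) \<le> N q * sqrt (LINT x|lborel. (norm (\<kappa> x))\<^sup>2)"
        by (intro dist_pair_bound k) (use N[OF q] in auto)
      also have "\<dots> \<le> N q * (16/3 * 2 powi q * T)" using N[OF q] by (intro mult_left_mono k) auto
      finally show "norm (block (phi, chi) q F (nderiv 1 \<theta>)) \<le> 16/3 * T * (2 powi q * N q)"
        unfolding k(2) by (simp add: mult.commute mult.left_commute)
    qed
    also have "\<dots> \<le> 16/3 * T * B" unfolding sum_distrib_left[symmetric] using T by (intro mult_left_mono B) auto
    finally show "(\<Sum>q\<in>{-1..<int n}. norm (block (phi, chi) q F (nderiv 1 \<theta>))) \<le> 16/3 * B * sqrt (LINT x|lborel. (norm (\<theta> x))\<^sup>2)"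
      unfolding T_def by (simp add: mult.commute mult.left_commute)
  qed
qed

lemma besov_half_bound:
  assumes F: "tempered F" and b: "besov_norm (phi, chi) (1/2) 2 1 F \<le> ennreal M" and M: "0 \<le> M" and p: "\<theta> \<in> schwartz"
  shows "norm (F \<theta>) \<le> 2 * M * sqrt (LINT x|lborel. (norm (\<theta> x))\<^sup>2)"
proof -
  obtain N where N: "\<And>q. -1 \<le> q \<Longrightarrow> 0 \<le> N q \<and> dist_Lp_norm 2 (block (phi, chi) q F) = ennreal (N q)"
    "\<And>n. (\<Sum>q\<in>{-1..<int n}. 2 powr (of_int q * (1/2)) * N q) \<le> M"
    using weighted_l1[OF b[unfolded besov_norm_def] M] by blast
  have "(\<Sum>q\<in>{-1..<int n}. 1 * N q) \<le> 2 * M" for n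
    by (rule sum_weight_mono[OF _ dyadic_weight_bounds(1) _ N(2)]) (use N(1) in auto)
  then have "(\<Sum>q\<in>{-1..<int n}. N q) \<le> 2 * M" for n by simp
  from block_bounds(1)[OF F _ p this] N(1) show ?thesis by auto
qed

lemma three_half_bounds:
  assumes F: "tempered F" and p: "\<theta> \<in> schwartz"
    and N: "\<And>q. -1 \<le> q \<Longrightarrow> 0 \<le> N q \<and> dist_Lp_norm 2 (block (phi, chi) q F) \<le> ennreal (N q)"
    "\<And>n. (\<Sum>q\<in>{-1..<int n}. 2 powr (of_int q * (3/2)) * N q) \<le> M"
  shows "norm (F \<theta>) \<le> 4 * M * sqrt (LINT x|lborel. (norm (\<theta> x))\<^sup>2)"
    and "norm (F (nderiv 1 \<theta>)) \<le> 16/3 * (2 * M) * sqrt (LINT x|lborel. (norm (\<theta> x))\<^sup>2)"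
proof -
  have "(\<Sum>q\<in>{-1..<int n}. 1 * N q) \<le> 4 * M" for n
    by (rule sum_weight_mono[OF _ dyadic_weight_bounds(2) _ N(2)]) (use N(1) in auto)
  then have "(\<Sum>q\<in>{-1..<int n}. N q) \<le> 4 * M" for n by simp
  from block_bounds(1)[OF F N(1) p this] show "norm (F \<theta>) \<le> 4 * M * sqrt (LINT x|lborel. (norm (\<theta> x))\<^sup>2)" .
  have "(\<Sum>q\<in>{-1..<int n}. 2 powi q * N q) \<le> 2 * M" for n
    by (rule sum_weight_mono[OF _ dyadic_weight_bounds(3) _ N(2)]) (use N(1) in auto)
  from block_bounds(2)[OF F N(1) p this] show "norm (F (nderiv 1 \<theta>)) \<le> 16/3 * (2 * M) * sqrt (LINT x|lborel. (norm (\<theta> x))\<^sup>2)" .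
qed

text \<open>By Weierstrass' theorem the products of polynomials with a cutoff \<open>w\<close> approximate \<open>f w\<close>, so the
bound extends to \<open>\<theta> = f w\<close>; this gives \<open>\<integral> f\<^sup>2 w \<le> S sqrt (\<integral> f\<^sup>2 w\<^sup>2) \<le> S sqrt (\<integral> f\<^sup>2 w)\<close>. Then
let the cutoff grow.\<close>

lemma dual_L2_bound:
  assumes f: "continuous_on UNIV f" and S: "0 \<le> S"
    and dual: "\<And>\<theta> R. (\<lambda>x. complex_of_real (\<theta> x)) \<in> schwartz \<Longrightarrow> (\<And>x. R < \<bar>x\<bar> \<Longrightarrow> \<theta> x = 0) \<Longrightarrow>
      \<bar>LINT x|lborel. f x * \<theta> x\<bar> \<le> S * sqrt (LINT x|lborel. (\<theta> x)\<^sup>2)"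
  shows "integrable lborel (\<lambda>x. (f x)\<^sup>2)" "(LINT x|lborel. (f x)\<^sup>2) \<le> S\<^sup>2"
proof -
  define w where "w n = (\<lambda>x. chi (inverse (real (Suc n)) * x))" for n
  have w01: "0 \<le> w n x \<and> w n x \<le> 1" for n x unfolding w_def using chi_props(3)[OF lp] by blast
  have wz: "w n x = 0" if "4/3 * real (Suc n) < \<bar>x\<bar>" for n x
  proof (rule ccontr)
    assume "w n x \<noteq> 0"
    then have "inverse (real (Suc n)) * \<bar>x\<bar> \<le> 4/3" using chi_props(2)[OF lp] by (auto simp: w_def abs_mult)
    then show False using that by (simp add: field_simps)
  qed
  have ws: "smooth (w n)" for n unfolding w_def by (rule nderiv_compose_scale(2)[OF chi_props(1)[OF lp]])
  have wc: "continuous_on UNIV (w n)" for n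
    using nderiv_has_derivative[OF ws[of n], of 0]
    by (auto simp: nderiv_0 intro!: continuous_at_imp_continuous_on has_vector_derivative_continuous)
  have wS: "(\<lambda>x. complex_of_real (w n x)) \<in> schwartz" for n
  proof -
    have jd: "((\<lambda>x. complex_of_real (nderiv k (w n) x)) has_vector_derivative of_real (nderiv (Suc k) (w n) x)) (at x)" for k x
      by (rule bounded_linear.has_vector_derivative[OF bounded_linear_of_real nderiv_has_derivative[OF ws]])
    have j: "nderiv k (\<lambda>x. complex_of_real (w n x)) = (\<lambda>x. of_real (nderiv k (w n) x))" "smooth (\<lambda>x. complex_of_real (w n x))" for k
      using nderiv_eqI[of "\<lambda>k x. complex_of_real (nderiv k (w n) x)", OF jd] by (simp_all add: nderiv_0)
    have supp: "{x. w n x \<noteq> 0} \<subseteq> {x. \<bar>x\<bar> \<le> 4/3 * real (Suc n)}" using wz[of n] by force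
    show ?thesis
      unfolding schwartz_iff j(1)
    proof (intro conjI allI j(2))
      fix k N
      obtain C where C: "\<And>x. norm (nderiv k (w n) x) \<le> C" using compact_support_bounded(1)[OF ws supp] by blast
      have "(1 + \<bar>x\<bar>) ^ N * norm (complex_of_real (nderiv k (w n) x)) \<le> (1 + 4/3 * real (Suc n)) ^ N * C" for x
      proof (cases "4/3 * real (Suc n) < \<bar>x\<bar>")
        case True
        then show ?thesis using compact_support_bounded(2)[OF ws supp True, of k] C[of x] by simp
      next
        case False
        then have "(1 + \<bar>x\<bar>) ^ N \<le> (1 + 4/3 * real (Suc n)) ^ N" by (intro power_mono) auto
        then show ?thesis using C[of x] by (intro mult_mono) auto
      qed
      then show "\<exists>C. \<forall>x. (1 + \<bar>x\<bar>) ^ N * norm (complex_of_real (nderiv k (w n) x)) \<le> C" by blast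
    qed
  qed
  have key: "integrable lborel (\<lambda>x. (f x)\<^sup>2 * w n x)" "(LINT x|lborel. (f x)\<^sup>2 * w n x) \<le> S\<^sup>2" for n
  proof -
    define R where "R = 4/3 * real (Suc n)"
    have fw: "continuous_on UNIV (\<lambda>x. (f x)\<^sup>2 * w n x)" by (intro continuous_intros f wc)
    show i1: "integrable lborel (\<lambda>x. (f x)\<^sup>2 * w n x)"
      by (rule integrable_compact_support[OF fw, of R]) (use wz in \<open>simp add: R_def\<close>)
    have "\<exists>g. real_polynomial_function g \<and> (\<forall>x\<in>{-R..R}. \<bar>f x - g x\<bar> < inverse (real (Suc k)))" for k
    proof -
      have "continuous_on {-R..R} f" using continuous_on_subset[OF f] by simp
      from Stone_Weierstrass_real_polynomial_function[OF compact_Icc this, of "inverse (real (Suc k))"]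
      show ?thesis by (metis inverse_positive_iff_positive of_nat_0_less_iff zero_less_Suc)
    qed
    then obtain g where g: "\<And>k. real_polynomial_function (g k)"
        "\<And>k x. x \<in> {-R..R} \<Longrightarrow> \<bar>f x - g k x\<bar> < inverse (real (Suc k))" by metis
    have gc: "continuous_on UNIV (g k)" for k
      using continuous_real_polymonial_function[OF g(1)] by (simp add: continuous_at_imp_continuous_on)
    define \<theta> where "\<theta> k = (\<lambda>x. g k x * w n x)" for k
    have \<theta>c: "continuous_on UNIV (\<theta> k)" for k unfolding \<theta>_def by (intro continuous_intros gc wc)
    have \<theta>z: "\<theta> k x = 0" if "R < \<bar>x\<bar>" for k x using wz[of n x] that by (simp add: \<theta>_def R_def)
    have \<theta>S: "(\<lambda>x. complex_of_real (\<theta> k x)) \<in> schwartz" for k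
      using polynomial_schwartz[OF g(1) wS, of k n] by (simp add: \<theta>_def scaleR_conv_of_real)
    have \<theta>lim: "(\<lambda>k. \<theta> k x) \<longlonglongrightarrow> f x * w n x" for x
    proof (cases "R < \<bar>x\<bar>")
      case True
      then show ?thesis using wz[of n x] \<theta>z[OF True] by (simp add: R_def)
    next
      case False
      then have x: "x \<in> {-R..R}" by auto
      have "(\<lambda>k. f x - g k x) \<longlonglongrightarrow> 0"
        by (rule Lim_null_comparison[OF _ LIMSEQ_inverse_real_of_nat])
          (use less_imp_le[OF g(2)[OF x]] in \<open>auto intro!: always_eventually\<close>)
      then have "(\<lambda>k. f x - (f x - g k x)) \<longlonglongrightarrow> f x - 0" by (intro tendsto_diff tendsto_const)
      then have "(\<lambda>k. g k x) \<longlonglongrightarrow> f x" by simp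
      then show ?thesis unfolding \<theta>_def by (intro tendsto_mult tendsto_const)
    qed
    have \<theta>b: "\<bar>\<theta> k x\<bar> \<le> indicator {-R..R} x * (\<bar>f x\<bar> + 1)" for k x
    proof (cases "R < \<bar>x\<bar>")
      case True
      then show ?thesis using \<theta>z[OF True] by simp
    next
      case False
      then have x: "x \<in> {-R..R}" by auto
      have "inverse (real (Suc k)) \<le> 1" by (simp add: inverse_le_1_iff)
      then have "\<bar>g k x\<bar> \<le> \<bar>f x\<bar> + 1" using g(2)[OF x, of k] by linarith
      then have "\<bar>g k x\<bar> * \<bar>w n x\<bar> \<le> (\<bar>f x\<bar> + 1) * 1" using w01[of n x] by (intro mult_mono) auto
      then show ?thesis using x by (simp add: \<theta>_def abs_mult)
    qed
    have idom: "integrable lborel (\<lambda>x. indicator {-R..R} x * (\<bar>f x\<bar> + 1)\<^sup>2)"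
      using borel_integrable_atLeastAtMost'[of "-R" R "\<lambda>x. (\<bar>f x\<bar> + 1)\<^sup>2"]
      by (simp add: set_integrable_def continuous_on_subset[OF f] continuous_intros)
    have l1: "(\<lambda>k. LINT x|lborel. f x * \<theta> k x) \<longlonglongrightarrow> (LINT x|lborel. (f x)\<^sup>2 * w n x)"
    proof (rule integral_dominated_convergence[OF _ _ idom])
      show "AE x in lborel. (\<lambda>k. f x * \<theta> k x) \<longlonglongrightarrow> (f x)\<^sup>2 * w n x"
        using tendsto_mult_left[OF \<theta>lim] by (auto simp: power2_eq_square mult.assoc)
      show "AE x in lborel. norm (f x * \<theta> k x) \<le> indicator {-R..R} x * (\<bar>f x\<bar> + 1)\<^sup>2" for k
      proof (intro AE_I2)
        fix x
        have "\<bar>f x\<bar> * \<bar>\<theta> k x\<bar> \<le> (\<bar>f x\<bar> + 1) * (indicator {-R..R} x * (\<bar>f x\<bar> + 1))"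
          using \<theta>b by (intro mult_mono) auto
        then show "norm (f x * \<theta> k x) \<le> indicator {-R..R} x * (\<bar>f x\<bar> + 1)\<^sup>2"
          by (simp add: abs_mult power2_eq_square mult.left_commute)
      qed
      show "(\<lambda>x. f x * \<theta> k x) \<in> borel_measurable lborel" for k
        by simp (intro borel_measurable_continuous_onI continuous_intros f \<theta>c)
      show "(\<lambda>x. (f x)\<^sup>2 * w n x) \<in> borel_measurable lborel" using i1 by auto
    qed
    have l2: "(\<lambda>k. LINT x|lborel. (\<theta> k x)\<^sup>2) \<longlonglongrightarrow> (LINT x|lborel. (f x * w n x)\<^sup>2)"
    proof (rule integral_dominated_convergence[OF _ _ idom])
      show "AE x in lborel. (\<lambda>k. (\<theta> k x)\<^sup>2) \<longlonglongrightarrow> (f x * w n x)\<^sup>2"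
        using tendsto_power[OF \<theta>lim] by auto
      show "AE x in lborel. norm ((\<theta> k x)\<^sup>2) \<le> indicator {-R..R} x * (\<bar>f x\<bar> + 1)\<^sup>2" for k
      proof (intro AE_I2)
        fix x
        have "\<bar>\<theta> k x\<bar>\<^sup>2 \<le> (indicator {-R..R} x * (\<bar>f x\<bar> + 1))\<^sup>2" using \<theta>b by (intro power_mono) auto
        then show "norm ((\<theta> k x)\<^sup>2) \<le> indicator {-R..R} x * (\<bar>f x\<bar> + 1)\<^sup>2"
          by (cases "- R \<le> x \<and> x \<le> R") (auto simp: indicator_def)
      qed
      show "(\<lambda>x. (\<theta> k x)\<^sup>2) \<in> borel_measurable lborel" for k
        by simp (intro borel_measurable_continuous_onI continuous_intros \<theta>c)
      show "(\<lambda>x. (f x * w n x)\<^sup>2) \<in> borel_measurable lborel"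
        by simp (intro borel_measurable_continuous_onI continuous_intros f wc)
    qed
    define A where "A = (LINT x|lborel. (f x)\<^sup>2 * w n x)"
    have A0: "0 \<le> A" unfolding A_def using w01 by simp
    have "\<bar>A\<bar> \<le> S * sqrt (LINT x|lborel. (f x * w n x)\<^sup>2)"
      unfolding A_def
    proof (rule LIMSEQ_le[OF tendsto_rabs[OF l1] tendsto_mult_left[OF tendsto_real_sqrt[OF l2]]])
      show "\<exists>N. \<forall>k\<ge>N. \<bar>LINT x|lborel. f x * \<theta> k x\<bar> \<le> S * sqrt (LINT x|lborel. (\<theta> k x)\<^sup>2)"
        using dual[OF \<theta>S \<theta>z] by blast
    qed
    also have "(LINT x|lborel. (f x * w n x)\<^sup>2) \<le> A"
      unfolding A_def
    proof (rule integral_mono_AE'[OF i1])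
      show "AE x in lborel. (f x * w n x)\<^sup>2 \<le> (f x)\<^sup>2 * w n x"
      proof (intro AE_I2)
        fix x
        have "w n x * w n x \<le> w n x * 1" using w01[of n x] by (intro mult_left_mono) auto
        then show "(f x * w n x)\<^sup>2 \<le> (f x)\<^sup>2 * w n x"
          unfolding power_mult_distrib by (intro mult_left_mono) (auto simp: power2_eq_square)
      qed
    qed (use w01 in auto)
    then have "S * sqrt (LINT x|lborel. (f x * w n x)\<^sup>2) \<le> S * sqrt A" by (intro mult_left_mono S) simp
    finally have "A \<le> S * sqrt A" using A0 by simp
    then have "sqrt A * sqrt A \<le> sqrt A * S" using A0 by (simp add: mult.commute)
    then have "sqrt A \<le> S" by (rule le_of_square_le) (use A0 S in simp_all)
    then have "(sqrt A)\<^sup>2 \<le> S\<^sup>2" using A0 by (intro power_mono) auto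
    then show "(LINT x|lborel. (f x)\<^sup>2 * w n x) \<le> S\<^sup>2" using A0 unfolding A_def by simp
  qed
  have lim: "(\<lambda>n. (f x)\<^sup>2 * w n x) \<longlonglongrightarrow> (f x)\<^sup>2" for x
  proof (rule tendsto_eventually)
    obtain N :: nat where N: "4/3 * \<bar>x\<bar> < real N" using reals_Archimedean2 by blast
    have "w n x = 1" if "N \<le> n" for n
      unfolding w_def
    proof (rule chi_one[OF lp])
      have "4/3 * \<bar>x\<bar> < real (Suc n)" using N that by simp
      then show "\<bar>inverse (real (Suc n)) * x\<bar> < 3/4" by (simp add: abs_mult field_simps)
    qed
    then show "\<forall>\<^sub>F n in sequentially. (f x)\<^sup>2 * w n x = (f x)\<^sup>2"
      by (intro eventually_sequentiallyI[of N]) simp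
  qed
  show "integrable lborel (\<lambda>x. (f x)\<^sup>2)" "(LINT x|lborel. (f x)\<^sup>2) \<le> S\<^sup>2"
    by (rule fatou_real[OF lim _ key tendsto_const]; use w01 in simp)+
qed

end

section \<open>Regularity of curves with Besov bounds\<close>

lemma AE_dense:
  assumes ae: "AE t in lborel. 0 < t \<longrightarrow> P t" and ab: "0 \<le> a" "a < (b::real)"
  shows "\<exists>t. a < t \<and> t < b \<and> P t"
proof (rule ccontr)
  assume "\<not> ?thesis"
  then have "AE t in lborel. t \<notin> {a<..<b}"
    using ae by (auto elim!: eventually_mono) (use ab in auto)
  then have "{a<..<b} \<in> null_sets lborel" by (subst AE_iff_null_sets) auto
  then have "emeasure lborel {a<..<b} = 0" by auto
  then show False using ab by simp
qed

lemma dist_of_real: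
  "dist_of (\<lambda>x. complex_of_real (f x)) (\<lambda>x. complex_of_real (\<theta> x)) = of_real (LINT x|lborel. f x * \<theta> x)"
  unfolding dist_of_def by (simp flip: of_real_mult)

lemma norm_of_real_sq: "(LINT x|lborel. (norm (complex_of_real (\<theta> x)))\<^sup>2) = (LINT x|lborel. (\<theta> x)\<^sup>2)"
  by simp

lemma seminorm_mono: assumes p: "\<psi> \<in> schwartz" and N: "N \<le> N'"
  shows "schwartz_seminorm N \<psi> \<le> schwartz_seminorm N' \<psi>" "0 \<le> schwartz_seminorm N \<psi>"
proof -
  have nn: "0 \<le> (SUP x. norm (x ^ j *\<^sub>R nderiv k \<psi> x))" for j k
  proof -
    have "bounded (range (\<lambda>x. x ^ j *\<^sub>R nderiv k \<psi> x))" using p by (simp add: schwartz_def)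
    then have "bdd_above (range (\<lambda>x. norm (x ^ j *\<^sub>R nderiv k \<psi> x)))"
      by (auto simp: bounded_iff intro: bdd_aboveI2)
    then have "norm (0 ^ j *\<^sub>R nderiv k \<psi> 0) \<le> (SUP x. norm (x ^ j *\<^sub>R nderiv k \<psi> x))"
      by (rule cSUP_upper[rotated]) simp
    then show ?thesis by (rule order_trans[OF norm_ge_zero])
  qed
  show "0 \<le> schwartz_seminorm N \<psi>" unfolding schwartz_seminorm_def by (intro sum_nonneg nn)
  have "(\<Sum>j\<le>N. \<Sum>k\<le>N. (SUP x. norm (x ^ j *\<^sub>R nderiv k \<psi> x))) \<le> (\<Sum>j\<le>N. \<Sum>k\<le>N'. (SUP x. norm (x ^ j *\<^sub>R nderiv k \<psi> x)))"
    by (intro sum_mono sum_mono2 nn) (use N in auto)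
  also have "\<dots> \<le> (\<Sum>j\<le>N'. \<Sum>k\<le>N'. (SUP x. norm (x ^ j *\<^sub>R nderiv k \<psi> x)))"
    by (intro sum_mono2 sum_nonneg nn) (use N in auto)
  finally show "schwartz_seminorm N \<psi> \<le> schwartz_seminorm N' \<psi>" unfolding schwartz_seminorm_def .
qed

lemma tempered_combination:
  assumes F: "tempered F" and G: "tempered G"
  shows "tempered (\<lambda>\<psi>. a * F \<psi> + b * G \<psi>)"
proof -
  obtain C N where C: "\<And>\<psi>. \<psi> \<in> schwartz \<Longrightarrow> norm (F \<psi>) \<le> C * schwartz_seminorm N \<psi>"
    using F unfolding tempered_def by blast
  obtain C' N' where C': "\<And>\<psi>. \<psi> \<in> schwartz \<Longrightarrow> norm (G \<psi>) \<le> C' * schwartz_seminorm N' \<psi>"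
    using G unfolding tempered_def by blast
  have "norm (a * F \<psi> + b * G \<psi>) \<le> (norm a * \<bar>C\<bar> + norm b * \<bar>C'\<bar>) * schwartz_seminorm (max N N') \<psi>"
    if p: "\<psi> \<in> schwartz" for \<psi>
  proof -
    have s: "C * schwartz_seminorm N \<psi> \<le> \<bar>C\<bar> * schwartz_seminorm (max N N') \<psi>"
      "C' * schwartz_seminorm N' \<psi> \<le> \<bar>C'\<bar> * schwartz_seminorm (max N N') \<psi>"
      by (rule mult_mono[OF _ seminorm_mono(1)[OF p] _ seminorm_mono(2)[OF p order_refl]]; simp)+
    have "norm (a * F \<psi> + b * G \<psi>) \<le> norm a * norm (F \<psi>) + norm b * norm (G \<psi>)"
      by (rule order_trans[OF norm_triangle_ineq]) (simp add: norm_mult)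
    also have "\<dots> \<le> norm a * (\<bar>C\<bar> * schwartz_seminorm (max N N') \<psi>) + norm b * (\<bar>C'\<bar> * schwartz_seminorm (max N N') \<psi>)"
      using C[OF p] C'[OF p] s by (intro add_mono mult_left_mono) auto
    finally show ?thesis by (simp add: distrib_right mult.assoc)
  qed
  moreover have "(\<forall>\<psi>\<in>schwartz. \<forall>\<eta>\<in>schwartz. \<forall>c d. a * F (\<lambda>x. c * \<psi> x + d * \<eta> x) + b * G (\<lambda>x. c * \<psi> x + d * \<eta> x)
      = c * (a * F \<psi> + b * G \<psi>) + d * (a * F \<eta> + b * G \<eta>))"
    by (auto simp: tempered_linear[OF F] tempered_linear[OF G] algebra_simps)
  ultimately show ?thesis unfolding tempered_def by blast
qed

context
  fixes phi chi :: "real \<Rightarrow> real"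
  assumes lp: "littlewood_paley phi chi"
begin

text \<open>For the derivative, integrate by parts to move it to the test function.\<close>

lemma H1_bound_of_blocks:
  assumes fd: "\<And>x. (f has_real_derivative f' x) (at x)" and fc: "continuous_on UNIV f'"
    and F: "tempered (dist_of (\<lambda>x. complex_of_real (f x)))" and M: "0 \<le> M"
    and N: "\<And>q. -1 \<le> q \<Longrightarrow> 0 \<le> N q \<and> dist_Lp_norm 2 (block (phi, chi) q (dist_of (\<lambda>x. complex_of_real (f x)))) \<le> ennreal (N q)"
    "\<And>n. (\<Sum>q\<in>{-1..<int n}. 2 powr (of_int q * (3/2)) * N q) \<le> M"
  shows "integrable lborel (\<lambda>x. (f x)\<^sup>2)" "(LINT x|lborel. (f x)\<^sup>2) \<le> (4 * M)\<^sup>2"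
    "integrable lborel (\<lambda>x. (f' x)\<^sup>2)" "(LINT x|lborel. (f' x)\<^sup>2) \<le> (11 * M)\<^sup>2"
proof -
  have f0: "continuous_on UNIV f"
    using fd by (auto intro!: continuous_at_imp_continuous_on DERIV_isCont)
  have 1: "\<bar>LINT x|lborel. f x * \<theta> x\<bar> \<le> 4 * M * sqrt (LINT x|lborel. (\<theta> x)\<^sup>2)"
    if "(\<lambda>x. complex_of_real (\<theta> x)) \<in> schwartz" for \<theta>
    using three_half_bounds(1)[OF lp F that N] unfolding dist_of_real norm_of_real_sq by simp
  from M have "0 \<le> 4 * M" by simp
  note d = dual_L2_bound[OF lp f0 this]
  show "integrable lborel (\<lambda>x. (f x)\<^sup>2)" by (rule d(1), rule 1, assumption)
  show "(LINT x|lborel. (f x)\<^sup>2) \<le> (4 * M)\<^sup>2" by (rule d(2), rule 1, assumption)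
  have 2: "\<bar>LINT x|lborel. f' x * \<theta> x\<bar> \<le> 11 * M * sqrt (LINT x|lborel. (\<theta> x)\<^sup>2)"
    if S: "(\<lambda>x. complex_of_real (\<theta> x)) \<in> schwartz" and z: "\<And>x. R < \<bar>x\<bar> \<Longrightarrow> \<theta> x = 0" for \<theta> R
  proof -
    define \<psi> where "\<psi> = (\<lambda>x. complex_of_real (\<theta> x))"
    have \<psi>: "\<psi> \<in> schwartz" using S by (simp add: \<psi>_def)
    have supp: "{x. \<psi> x \<noteq> 0} \<subseteq> {x. \<bar>x\<bar> \<le> R}" using z by (force simp: \<psi>_def)
    have d\<psi>: "(\<psi> has_vector_derivative nderiv 1 \<psi> x) (at x)" for x
      using nderiv_has_derivative[OF schwartz_smooth[OF \<psi>], of 0] by (simp add: nderiv_0)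
    note c = schwartz_continuous[OF \<psi>] schwartz_continuous[OF schwartz_nderiv[OF \<psi>, of 1]]
    have i: "integrable lborel (\<lambda>x. of_real (f x) * \<psi> x)" "integrable lborel (\<lambda>x. of_real (f' x) * \<psi> x)"
      "integrable lborel (\<lambda>x. of_real (f x) * nderiv 1 \<psi> x)"
      using z compact_support_bounded(2)[OF schwartz_smooth[OF \<psi>] supp, of _ 1]
      by (intro integrable_compact_support[where R = R] continuous_on_mult continuous_on_of_real f0 fc c; simp add: \<psi>_def)+
    have "(LINT x|lborel. of_real (f x) * nderiv 1 \<psi> x + of_real (f' x) * \<psi> x) = 0"
    proof (rule integral_derivative_eq_0[OF _ _ i(1)])
      show "((\<lambda>x. of_real (f x) * \<psi> x) has_vector_derivative of_real (f x) * nderiv 1 \<psi> x + of_real (f' x) * \<psi> x) (at x)" for x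
        by (intro has_vector_derivative_mult has_vector_derivative_of_real fd d\<psi>)
      show "continuous_on UNIV (\<lambda>x. of_real (f x) * nderiv 1 \<psi> x + of_real (f' x) * \<psi> x)"
        by (intro continuous_on_add continuous_on_mult continuous_on_of_real f0 fc c)
    qed (use i in simp)
    then have "(LINT x|lborel. of_real (f' x) * \<psi> x) = - dist_of (\<lambda>x. complex_of_real (f x)) (nderiv 1 \<psi>)"
      using i by (simp add: dist_of_def eq_neg_iff_add_eq_0 add.commute)
    then have "norm (LINT x|lborel. of_real (f' x) * \<psi> x) \<le> 16/3 * (2 * M) * sqrt (LINT x|lborel. (norm (\<psi> x))\<^sup>2)"
      using three_half_bounds(2)[OF lp F \<psi> N] by simp
    also have "\<dots> \<le> 11 * M * sqrt (LINT x|lborel. (norm (\<psi> x))\<^sup>2)"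
      using M by (intro mult_right_mono) auto
    finally show ?thesis using dist_of_real[of f' \<theta>] unfolding dist_of_def \<psi>_def norm_of_real_sq by simp
  qed
  from M have "0 \<le> 11 * M" by simp
  note d = dual_L2_bound[OF lp fc this]
  show "integrable lborel (\<lambda>x. (f' x)\<^sup>2)" by (rule d(1), rule 2, assumption, blast)
  show "(LINT x|lborel. (f' x)\<^sup>2) \<le> (11 * M)\<^sup>2" by (rule d(2), rule 2, assumption, blast)
qed

text \<open>The supremum in time is essential, so the bounds on the blocks hold for almost every time only. Every time is a limit
of such times, and Fatou's lemma transfers the \<open>L\<^sup>2\<close> bounds by continuity of the functions.\<close>

lemma H1_bound_of_cl_norm:
  assumes fd: "\<And>t x. 0 \<le> t \<Longrightarrow> (f t has_real_derivative f' t x) (at x)"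
    and c: "continuous_on ({0..} \<times> UNIV) (\<lambda>(t, x). f t x)" "continuous_on ({0..} \<times> UNIV) (\<lambda>(t, x). f' t x)"
    and F: "\<And>t. 0 \<le> t \<Longrightarrow> tempered (dist_of (\<lambda>x. complex_of_real (f t x)))"
    and b: "cl_norm (phi, chi) \<infinity> \<infinity> (3/2) 2 1 (\<lambda>t. dist_of (\<lambda>x. complex_of_real (f t x))) \<le> ennreal M" and M: "0 \<le> M"
    and t: "0 \<le> t"
  shows "f t \<in> cL2" "(LINT x|lborel. (f t x)\<^sup>2) \<le> (4 * M)\<^sup>2" "f' t \<in> cL2" "(LINT x|lborel. (f' t x)\<^sup>2) \<le> (11 * M)\<^sup>2"
proof -
  define D where "D = (\<lambda>q t. dist_Lp_norm 2 (block (phi, chi) q (dist_of (\<lambda>x. complex_of_real (f t x)))))"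
  define \<mu> where "\<mu> = restrict_space lborel {t::real. 0 < t \<and> ereal t < \<infinity>}"
  obtain N where N: "\<And>q. -1 \<le> q \<Longrightarrow> 0 \<le> N q \<and> Lp_norm \<infinity> \<mu> (D q) = ennreal (N q)"
    "\<And>n. (\<Sum>q\<in>{-1..<int n}. 2 powr (of_int q * (3/2)) * N q) \<le> M"
    using weighted_l1[OF b[unfolded cl_norm_def] M] unfolding D_def \<mu>_def by blast
  have "AE t in \<mu>. D q t \<le> ennreal (N q)" if q: "-1 \<le> q" for q
  proof -
    have "Lp_norm \<infinity> \<mu> (D q) < \<infinity>" using N(1)[OF q] by simp
    then have "Lp_norm \<infinity> \<mu> (D q) = esssup \<mu> (D q)" unfolding Lp_norm_def by (auto split: if_splits)
    then show ?thesis using esssup_AE[of "D q" \<mu>] N(1)[OF q] by simp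
  qed
  then have "AE t in \<mu>. \<forall>q. -1 \<le> q \<longrightarrow> D q t \<le> ennreal (N q)" by (subst AE_all_countable) auto
  then have ae: "AE t in lborel. 0 < t \<longrightarrow> (\<forall>q. -1 \<le> q \<longrightarrow> D q t \<le> ennreal (N q))"
    unfolding \<mu>_def by (subst (asm) AE_restrict_space_iff) auto
  have cx: "continuous_on UNIV (f t)" "continuous_on UNIV (f' t)" if "0 \<le> t" for t
  proof -
    have p: "continuous_on UNIV (Pair t)" by (intro continuous_intros)
    have r: "range (Pair t) \<subseteq> {0..} \<times> (UNIV :: real set)" using that by auto
    show "continuous_on UNIV (f t)" "continuous_on UNIV (f' t)"
      using continuous_on_compose2[OF c(1) p r] continuous_on_compose2[OF c(2) p r] by simp_all
  qed
  have "\<exists>s. t < s \<and> s < t + inverse (real (Suc n)) \<and> (\<forall>q. -1 \<le> q \<longrightarrow> D q s \<le> ennreal (N q))" for n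
    by (rule AE_dense[OF ae t]) simp
  then obtain r where r: "\<And>n. t < r n" "\<And>n. r n < t + inverse (real (Suc n))" "\<And>n q. -1 \<le> q \<Longrightarrow> D q (r n) \<le> ennreal (N q)"
    by metis
  have r0: "0 \<le> r n" for n using r(1)[of n] t by simp
  have rlim: "r \<longlonglongrightarrow> t"
  proof (rule tendsto_sandwich[OF _ _ tendsto_const])
    have "(\<lambda>n. t + inverse (real (Suc n))) \<longlonglongrightarrow> t + 0" by (intro tendsto_add tendsto_const LIMSEQ_inverse_real_of_nat)
    then show "(\<lambda>n. t + inverse (real (Suc n))) \<longlonglongrightarrow> t" by simp
  qed (use less_imp_le[OF r(1)] less_imp_le[OF r(2)] in \<open>auto intro!: always_eventually\<close>)
  have tx: "(\<lambda>n. h (r n) x) \<longlonglongrightarrow> h t x" if h: "continuous_on ({0..} \<times> UNIV) (\<lambda>(t, x). h t x)" for h :: "real \<Rightarrow> real \<Rightarrow> real" and x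
  proof -
    have "(\<lambda>n. (case (r n, x) of (t, x) \<Rightarrow> h t x)) \<longlonglongrightarrow> (case (t, x) of (t, x) \<Rightarrow> h t x)"
      by (rule continuous_on_tendsto_compose[OF h]) (use t r0 in \<open>auto intro!: tendsto_intros rlim\<close>)
    then show ?thesis by simp
  qed
  have bd: "integrable lborel (\<lambda>x. (f (r n) x)\<^sup>2)" "(LINT x|lborel. (f (r n) x)\<^sup>2) \<le> (4 * M)\<^sup>2"
    "integrable lborel (\<lambda>x. (f' (r n) x)\<^sup>2)" "(LINT x|lborel. (f' (r n) x)\<^sup>2) \<le> (11 * M)\<^sup>2" for n
    by (rule H1_bound_of_blocks[OF fd[OF r0[of n]] cx(2)[OF r0] F[OF r0] M _ N(2)];
        use N(1) r(3)[of _ n] in \<open>auto simp: D_def\<close>)+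
  have "integrable lborel (\<lambda>x. (f t x)\<^sup>2)" "(LINT x|lborel. (f t x)\<^sup>2) \<le> (4 * M)\<^sup>2"
    by (rule fatou_real[OF tendsto_power[OF tx[OF c(1)]] _ bd(1,2) tendsto_const]; simp)+
  moreover have "integrable lborel (\<lambda>x. (f' t x)\<^sup>2)" "(LINT x|lborel. (f' t x)\<^sup>2) \<le> (11 * M)\<^sup>2"
    by (rule fatou_real[OF tendsto_power[OF tx[OF c(2)]] _ bd(3,4) tendsto_const]; simp)+
  ultimately show "f t \<in> cL2" "(LINT x|lborel. (f t x)\<^sup>2) \<le> (4 * M)\<^sup>2" "f' t \<in> cL2" "(LINT x|lborel. (f' t x)\<^sup>2) \<le> (11 * M)\<^sup>2"
    using cx[OF t] by (auto simp: cL2_def)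
qed

text \<open>The difference quotients \<open>k s\<close> converge in the Besov space to a distribution \<open>G t\<close> that is not yet known to be
the function \<open>ft t\<close>. Subtracting two quotients eliminates it and shows that they are Cauchy in \<open>L\<^sup>2\<close>. As one of
them converges pointwise to \<open>ft t\<close>, Fatou's lemma bounds \<open>k s - ft t\<close>.\<close>

lemma L2_time_derivative:
  assumes f: "\<And>t. 0 \<le> t \<Longrightarrow> f t \<in> cL2" and ftc: "continuous_on UNIV (ft t)"
    and fd: "\<And>x. ((\<lambda>s. f s x) has_real_derivative ft t x) (at t within {0..})"
    and C1: "(\<lambda>t. dist_of (\<lambda>x. complex_of_real (f t x))) \<in> tilde_C1 (phi, chi) \<infinity> (1/2) 2 1"
    and t: "0 \<le> t"
  shows "ft t \<in> cL2" "((\<lambda>t. L2fun (f t)) has_vector_derivative L2fun (ft t)) (at t within {0..})"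
proof -
  define F where "F t = dist_of (\<lambda>x. complex_of_real (f t x))" for t
  have ivl: "time_ivl \<infinity> = {0..}" by (auto simp: time_ivl_def)
  obtain G where FC: "F \<in> C_besov (phi, chi) \<infinity> (1/2) 2 1" and GC: "G \<in> C_besov (phi, chi) \<infinity> (1/2) 2 1"
    and FG: "besov_derivative (phi, chi) \<infinity> (1/2) 2 1 F G"
    using C1 unfolding tilde_C1_def F_def[abs_def] by blast
  have Ft: "tempered (F t)" if "0 \<le> t" for t using FC that by (auto simp: C_besov_def besov_def ivl)
  have Gt: "tempered (G t)" using GC t by (auto simp: C_besov_def besov_def ivl)
  define H where "H s \<psi> = (F s \<psi> - F t \<psi>) / of_real (s - t) - G t \<psi>" for s \<psi>
  have Hlim: "((\<lambda>s. besov_norm (phi, chi) (1/2) 2 1 (H s)) \<longlongrightarrow> 0) (at t within {0..})"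
    using FG t unfolding besov_derivative_def ivl H_def[abs_def] by auto
  have Ht: "tempered (H s)" if s: "0 \<le> s" for s
  proof -
    have "tempered (\<lambda>\<psi>. 1 * (of_real (1 / (s - t)) * F s \<psi> + of_real (- 1 / (s - t)) * F t \<psi>) + (-1) * G t \<psi>)"
      by (rule tempered_combination[OF tempered_combination[OF Ft[OF s] Ft[OF t]] Gt])
    moreover have "H s = (\<lambda>\<psi>. 1 * (of_real (1 / (s - t)) * F s \<psi> + of_real (- 1 / (s - t)) * F t \<psi>) + (-1) * G t \<psi>)"
      by (auto simp: H_def fun_eq_iff diff_divide_distrib)
    ultimately show ?thesis by simp
  qed
  define k where "k s x = (f s x - f t x) / (s - t)" for s x
  have fc: "continuous_on UNIV (f s)" if "0 \<le> s" for s using f[OF that] by (simp add: cL2_def)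
  have kL: "k s \<in> cL2" if "0 \<le> s" for s
    using cL2_scale[OF cL2_diff[OF f[OF that] f[OF t]], of "1 / (s - t)"] by (simp add: k_def[abs_def])
  have kc: "continuous_on UNIV (k s)" if "0 \<le> s" for s using kL[OF that] by (simp add: cL2_def)
  have main: "\<exists>d>0. \<forall>s. 0 \<le> s \<and> s \<noteq> t \<and> \<bar>s - t\<bar> < d \<longrightarrow>
      integrable lborel (\<lambda>x. (k s x - ft t x)\<^sup>2) \<and> (LINT x|lborel. (k s x - ft t x)\<^sup>2) \<le> (4 * e)\<^sup>2" if e: "0 < e" for e
  proof -
    have "\<forall>\<^sub>F s in at t within {0..}. besov_norm (phi, chi) (1/2) 2 1 (H s) < ennreal e"
      by (rule order_tendstoD(2)[OF Hlim]) (use e in simp)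
    then obtain d where d: "0 < d" "\<And>s. 0 \<le> s \<Longrightarrow> s \<noteq> t \<Longrightarrow> \<bar>s - t\<bar> < d \<Longrightarrow> besov_norm (phi, chi) (1/2) 2 1 (H s) < ennreal e"
      unfolding eventually_at by (auto simp: dist_real_def)
    have diff: "integrable lborel (\<lambda>x. (k s x - k r x)\<^sup>2)" "(LINT x|lborel. (k s x - k r x)\<^sup>2) \<le> (4 * e)\<^sup>2"
      if s: "0 \<le> s" "s \<noteq> t" "\<bar>s - t\<bar> < d" and r: "0 \<le> r" "r \<noteq> t" "\<bar>r - t\<bar> < d" for s r
    proof -
      have hb: "norm (H s \<psi>) \<le> 2 * e * sqrt (LINT x|lborel. (norm (\<psi> x))\<^sup>2)"
        if "\<psi> \<in> schwartz" "0 \<le> s" "s \<noteq> t" "\<bar>s - t\<bar> < d" for \<psi> s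
        by (rule besov_half_bound[OF lp Ht]) (use that e less_imp_le[OF d(2)] in auto)
      have dl: "\<bar>LINT x|lborel. (k s x - k r x) * \<theta> x\<bar> \<le> 4 * e * sqrt (LINT x|lborel. (\<theta> x)\<^sup>2)"
        if S: "(\<lambda>x. complex_of_real (\<theta> x)) \<in> schwartz" and z: "\<And>x. R < \<bar>x\<bar> \<Longrightarrow> \<theta> x = 0" for \<theta> R
      proof -
        define \<psi> where "\<psi> = (\<lambda>x. complex_of_real (\<theta> x))"
        have \<theta>c: "continuous_on UNIV \<theta>" using continuous_on_Re[OF schwartz_continuous[OF S]] by simp
        have i: "integrable lborel (\<lambda>x. g x * \<theta> x)" if "continuous_on UNIV g" for g
          by (rule integrable_compact_support[where R = R]) (use z that \<theta>c in \<open>auto intro!: continuous_intros\<close>)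
        have Hk: "H s \<psi> = of_real (LINT x|lborel. k s x * \<theta> x) - G t \<psi>" if s: "0 \<le> s" for s
        proof -
          have "(LINT x|lborel. k s x * \<theta> x) = (LINT x|lborel. (f s x * \<theta> x - f t x * \<theta> x) / (s - t))"
            by (simp add: k_def left_diff_distrib)
          also have "\<dots> = ((LINT x|lborel. f s x * \<theta> x) - (LINT x|lborel. f t x * \<theta> x)) / (s - t)"
            using i[OF fc[OF s]] i[OF fc[OF t]] by simp
          finally show ?thesis unfolding H_def F_def \<psi>_def dist_of_real by simp
        qed
        have "complex_of_real (LINT x|lborel. (k s x - k r x) * \<theta> x) = H s \<psi> - H r \<psi>"
          unfolding Hk[OF s(1)] Hk[OF r(1)] using i[OF kc[OF s(1)]] i[OF kc[OF r(1)]]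
          by (simp add: left_diff_distrib)
        then have "\<bar>LINT x|lborel. (k s x - k r x) * \<theta> x\<bar> = norm (H s \<psi> - H r \<psi>)"
          by (metis norm_of_real real_norm_def)
        also have "\<dots> \<le> norm (H s \<psi>) + norm (H r \<psi>)" by (rule norm_triangle_ineq4)
        also have "\<dots> \<le> 2 * e * sqrt (LINT x|lborel. (norm (\<psi> x))\<^sup>2) + 2 * e * sqrt (LINT x|lborel. (norm (\<psi> x))\<^sup>2)"
          using S by (intro add_mono hb s r) (simp_all add: \<psi>_def)
        finally show ?thesis unfolding \<psi>_def norm_of_real_sq by simp
      qed
      have "continuous_on UNIV (\<lambda>x. k s x - k r x)" by (intro continuous_intros kc s r)
      note d = dual_L2_bound[OF lp this, of "4 * e"]
      show "integrable lborel (\<lambda>x. (k s x - k r x)\<^sup>2)"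
        by (rule d(1)) (use e in simp, rule dl, assumption, blast)
      show "(LINT x|lborel. (k s x - k r x)\<^sup>2) \<le> (4 * e)\<^sup>2"
        by (rule d(2)) (use e in simp, rule dl, assumption, blast)
    qed
    define r where "r n = t + d / 2 * inverse (real (Suc n))" for n
    have rn: "0 \<le> r n" "r n \<noteq> t" "\<bar>r n - t\<bar> < d" for n
    proof -
      have "0 < d / 2 * inverse (real (Suc n))" using d(1) by simp
      moreover have "d / 2 * inverse (real (Suc n)) \<le> d / 2 * 1"
        using d(1) by (intro mult_left_mono) (auto simp: inverse_le_1_iff)
      ultimately show "0 \<le> r n" "r n \<noteq> t" "\<bar>r n - t\<bar> < d" using t d(1) by (auto simp: r_def)
    qed
    have rlim: "r \<longlonglongrightarrow> t"
    proof -
      have "r \<longlonglongrightarrow> t + d / 2 * 0" unfolding r_def[abs_def]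
        by (intro tendsto_add tendsto_mult tendsto_const LIMSEQ_inverse_real_of_nat)
      then show ?thesis by simp
    qed
    have klim: "(\<lambda>n. k (r n) x) \<longlonglongrightarrow> ft t x" for x
    proof -
      have "((\<lambda>s. (f s x - f t x) / (s - t)) \<longlongrightarrow> ft t x) (at t within {0..})"
        using fd[of x] unfolding has_field_derivative_iff by simp
      moreover have "filterlim r (at t within {0..}) sequentially"
        unfolding filterlim_at using rlim rn by (auto intro!: always_eventually)
      ultimately show ?thesis unfolding k_def by (rule filterlim_compose)
    qed
    have "integrable lborel (\<lambda>x. (k s x - ft t x)\<^sup>2)" "(LINT x|lborel. (k s x - ft t x)\<^sup>2) \<le> (4 * e)\<^sup>2"
      if s: "0 \<le> s" "s \<noteq> t" "\<bar>s - t\<bar> < d" for s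
      by (rule fatou_real[OF tendsto_power[OF tendsto_diff[OF tendsto_const klim]] _ diff(1,2)[OF s rn] tendsto_const]; simp)+
    then show ?thesis using d(1) by blast
  qed
  show ftL: "ft t \<in> cL2"
  proof -
    obtain d where d: "0 < d" "\<And>s. 0 \<le> s \<and> s \<noteq> t \<and> \<bar>s - t\<bar> < d \<Longrightarrow> integrable lborel (\<lambda>x. (k s x - ft t x)\<^sup>2)"
      using main[of 1] by auto
    define s where "s = t + d / 2"
    have s: "0 \<le> s" "s \<noteq> t" "\<bar>s - t\<bar> < d" using t d(1) by (auto simp: s_def)
    have "(\<lambda>x. k s x - ft t x) \<in> cL2"
      using d(2)[of s] s kc[OF s(1)] ftc by (auto simp: cL2_def intro: continuous_intros)
    from cL2_diff[OF kL[OF s(1)] this] show ?thesis by simp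
  qed
  show "((\<lambda>t. L2fun (f t)) has_vector_derivative L2fun (ft t)) (at t within {0..})"
    unfolding has_vector_derivative_def has_derivative_within_alt
  proof (intro conjI bounded_linear_scaleR_left allI impI)
    fix e :: real assume e: "0 < e"
    obtain d where d: "0 < d" "\<And>s. 0 \<le> s \<and> s \<noteq> t \<and> \<bar>s - t\<bar> < d \<Longrightarrow> (LINT x|lborel. (k s x - ft t x)\<^sup>2) \<le> (4 * (e / 4))\<^sup>2"
      using main[of "e / 4"] e by auto
    have "norm (L2fun (f s) - L2fun (f t) - (s - t) *\<^sub>R L2fun (ft t)) \<le> e * norm (s - t)"
      if s: "s \<in> {0..}" "norm (s - t) < d" for s
    proof (cases "s = t")
      case False
      have "app (L2fun (f s) - L2fun (f t) - (s - t) *\<^sub>R L2fun (ft t)) x = (s - t) * (k s x - ft t x)" for x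
      proof -
        have "(s - t) * k s x = f s x - f t x" using False by (simp add: k_def)
        then show ?thesis using s t by (simp add: app_simps L2fun_inverse f ftL right_diff_distrib)
      qed
      then have "(norm (L2fun (f s) - L2fun (f t) - (s - t) *\<^sub>R L2fun (ft t)))\<^sup>2 = (s - t)\<^sup>2 * (LINT x|lborel. (k s x - ft t x)\<^sup>2)"
        by (simp add: norm_l2fun_sq power_mult_distrib)
      also have "\<dots> \<le> (s - t)\<^sup>2 * e\<^sup>2" using d(2)[of s] s False by (intro mult_left_mono) auto
      also have "\<dots> = (e * norm (s - t))\<^sup>2" by (simp add: power_mult_distrib)
      finally show ?thesis by (rule power2_le_imp_le) (use e in simp)
    qed simp
    then show "\<exists>d>0. \<forall>s\<in>{0..}. norm (s - t) < d \<longrightarrow> norm (L2fun (f s) - L2fun (f t) - (s - t) *\<^sub>R L2fun (ft t)) \<le> e * norm (s - t)"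
      using d(1) by blast
  qed
qed

end

section \<open>The nonlinearity\<close>

lemma deriv_smooth:
  fixes \<sigma> :: "real \<Rightarrow> real"
  assumes s: "smooth \<sigma>"
  shows "(\<sigma> has_real_derivative deriv \<sigma> x) (at x)" "(deriv \<sigma> has_real_derivative nderiv 2 \<sigma> x) (at x)"
    "continuous_on UNIV (nderiv 2 \<sigma>)"
proof -
  have n: "(nderiv k \<sigma> has_real_derivative nderiv (Suc k) \<sigma> x) (at x)" for k x
    using nderiv_has_derivative[OF s] by (simp add: has_real_derivative_iff_has_vector_derivative)
  have d: "deriv \<sigma> = nderiv 1 \<sigma>"
    using DERIV_imp_deriv[OF n[of 0]] by (auto simp: nderiv_0)
  show "(\<sigma> has_real_derivative deriv \<sigma> x) (at x)" "(deriv \<sigma> has_real_derivative nderiv 2 \<sigma> x) (at x)"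
    using n[of 0 x] n[of 1 x] unfolding d by (simp_all add: nderiv_0 numeral_2_eq_2)
  show "continuous_on UNIV (nderiv 2 \<sigma>)"
    using n[of 2] by (auto intro!: continuous_at_imp_continuous_on DERIV_isCont)
qed

lemma mvt_bound:
  fixes f :: "real \<Rightarrow> real"
  assumes d: "\<And>x. (f has_real_derivative f' x) (at x)" and b: "\<And>x. \<bar>x\<bar> \<le> r \<Longrightarrow> \<bar>f' x\<bar> \<le> K"
    and x: "\<bar>x\<bar> \<le> r" and y: "\<bar>y\<bar> \<le> r"
  shows "\<bar>f x - f y\<bar> \<le> K * \<bar>x - y\<bar>"
proof -
  have "norm (f x - f y) \<le> K * norm (x - y)"
  proof (rule field_differentiable_bound[of "{-r..r}"])
    show "(f has_field_derivative f' z) (at z within {-r..r})" for z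
      by (rule has_field_derivative_at_within[OF d])
  qed (use b x y in auto)
  then show ?thesis by simp
qed

text \<open>\<open>g\<close> is the stress \<open>\<sigma>(z / a)\<close> minus its linearization at \<open>0\<close>; it is quadratic at \<open>0\<close> because its derivative
\<open>h\<close> vanishes there. \<open>S\<close> is the potential energy of the stress, normalized to be close to \<open>z\<^sup>2 / 2\<close>.\<close>

lemma nonlinearity:
  fixes \<sigma> :: "real \<Rightarrow> real"
  assumes s: "smooth \<sigma>" and a: "0 < a" and a2: "a\<^sup>2 = deriv \<sigma> 0"
  obtains g h h' S :: "real \<Rightarrow> real" and B r :: real
  where "0 < B" "0 < r"
    "\<And>z. (g has_real_derivative h z) (at z)" "\<And>z. (h has_real_derivative h' z) (at z)" "continuous_on UNIV h'"
    "\<And>z. (S has_real_derivative z + g z / a) (at z)"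
    "\<And>z. deriv \<sigma> (z / a) / a = a + h z"
    "\<And>z. \<bar>z\<bar> \<le> r \<Longrightarrow> \<bar>h z\<bar> \<le> B * \<bar>z\<bar>" "\<And>z. \<bar>z\<bar> \<le> r \<Longrightarrow> \<bar>h z\<bar> \<le> B" "\<And>z. \<bar>z\<bar> \<le> r \<Longrightarrow> \<bar>h' z\<bar> \<le> B"
    "\<And>z. \<bar>z\<bar> \<le> r \<Longrightarrow> \<bar>g z\<bar> \<le> B * z\<^sup>2" "\<And>z. \<bar>z\<bar> \<le> r \<Longrightarrow> z\<^sup>2 / 4 \<le> S z \<and> S z \<le> z\<^sup>2"
proof -
  define g where "g = (\<lambda>z. \<sigma> (z / a) - \<sigma> 0 - a * z)"
  define h where "h = (\<lambda>z. deriv \<sigma> (z / a) / a - a)"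
  define h' where "h' = (\<lambda>z. nderiv 2 \<sigma> (z / a) / a\<^sup>2)"
  have gd: "(g has_real_derivative h z) (at z)" for z
    unfolding g_def h_def using a
    by (auto intro!: derivative_eq_intros DERIV_chain2[OF deriv_smooth(1)[OF s], where s = UNIV])
  have hd: "(h has_real_derivative h' z) (at z)" for z
    unfolding h_def h'_def using a
    by (auto intro!: derivative_eq_intros DERIV_chain2[OF deriv_smooth(2)[OF s], where s = UNIV] simp: power2_eq_square)
  have hc: "continuous_on UNIV h'"
    unfolding h'_def using a
    by (intro continuous_intros continuous_on_compose2[OF deriv_smooth(3)[OF s]]) auto
  have gc: "continuous_on UNIV (\<lambda>z. z + g z / a)"
  proof -
    have "continuous_on UNIV g" using gd by (auto intro!: continuous_at_imp_continuous_on DERIV_isCont)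
    then show ?thesis using a by (intro continuous_intros) auto
  qed
  then have "\<exists>S0. \<forall>x. (S0 has_vector_derivative x + g x / a) (at x)"
    using einterval_antiderivative[of "-\<infinity>" "\<infinity>" "\<lambda>z. z + g z / a"]
    by (auto simp: continuous_on_eq_continuous_at)
  then obtain S0 where S0: "\<And>x. (S0 has_real_derivative x + g x / a) (at x)"
    unfolding has_real_derivative_iff_has_vector_derivative by blast
  define S where "S = (\<lambda>z. S0 z - S0 0)"
  have Sd: "(S has_real_derivative z + g z / a) (at z)" for z
    unfolding S_def using DERIV_diff[OF S0[of z] DERIV_const] by simp
  have "compact (h' ` {-1..1})" by (intro compact_continuous_image continuous_on_subset[OF hc]) auto
  then obtain B0 where B0: "\<forall>x\<in>{-1..1}. \<bar>h' x\<bar> \<le> B0"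
    using compact_imp_bounded[of "h' ` {-1..1}"] unfolding bounded_iff by auto
  define B where "B = max B0 1"
  have B: "0 < B" by (simp add: B_def)
  have h'B: "\<bar>h' z\<bar> \<le> B" if "\<bar>z\<bar> \<le> 1" for z
  proof -
    have "\<bar>h' z\<bar> \<le> B0" using B0 that by (simp add: abs_le_iff)
    then show ?thesis by (simp add: B_def le_max_iff_disj)
  qed
  have h0: "h 0 = 0" using a a2 by (simp add: h_def power2_eq_square field_simps)
  have g0: "g 0 = 0" and S00: "S 0 = 0" by (simp_all add: g_def S_def)
  have hB: "\<bar>h z\<bar> \<le> B * \<bar>z\<bar>" if "\<bar>z\<bar> \<le> 1" for z
    using mvt_bound[OF hd h'B that, of 0] h0 by simp
  have gB: "\<bar>g z\<bar> \<le> B * z\<^sup>2" if z: "\<bar>z\<bar> \<le> 1" for z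
  proof -
    have "\<bar>g z - g 0\<bar> \<le> (B * \<bar>z\<bar>) * \<bar>z - 0\<bar>"
    proof (rule mvt_bound[OF gd, where r = "\<bar>z\<bar>"])
      show "\<bar>h x\<bar> \<le> B * \<bar>z\<bar>" if "\<bar>x\<bar> \<le> \<bar>z\<bar>" for x
        using hB[of x] that z mult_left_mono[OF that, of B] B by linarith
    qed auto
    then show ?thesis using g0 by (simp add: power2_eq_square mult.assoc)
  qed
  \<comment> \<open>On this interval \<open>\<bar>g z / a\<bar> \<le> \<bar>z\<bar> / 4\<close>, which makes \<open>S z\<close> differ from \<open>z\<^sup>2 / 2\<close> by at most
    \<open>z\<^sup>2 / 4\<close>.\<close>
  define r where "r = min 1 (a / (4 * B))"
  have r: "0 < r" "r \<le> 1" "r \<le> a / (4 * B)" using a B by (auto simp: r_def)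
  have SB: "z\<^sup>2 / 4 \<le> S z \<and> S z \<le> z\<^sup>2" if z: "\<bar>z\<bar> \<le> r" for z
  proof -
    have qd: "((\<lambda>z. S z - z\<^sup>2 / 2) has_real_derivative g z / a) (at z)" for z
      by (auto intro!: derivative_eq_intros Sd)
    have "\<bar>(S z - z\<^sup>2 / 2) - (S 0 - 0\<^sup>2 / 2)\<bar> \<le> (\<bar>z\<bar> / 4) * \<bar>z - 0\<bar>"
    proof (rule mvt_bound[OF qd, where r = "\<bar>z\<bar>"])
      fix x assume x: "\<bar>x\<bar> \<le> \<bar>z\<bar>"
      have "\<bar>g x\<bar> \<le> B * x\<^sup>2" using gB[of x] x z r by linarith
      also have "\<dots> = B * (\<bar>x\<bar> * \<bar>x\<bar>)" by (simp add: power2_eq_square)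
      also have "\<dots> \<le> B * (a / (4 * B) * \<bar>z\<bar>)" using x z r B by (intro mult_left_mono mult_mono) auto
      also have "\<dots> = a * (\<bar>z\<bar> / 4)" using B by simp
      finally show "\<bar>g x / a\<bar> \<le> \<bar>z\<bar> / 4" using a by (simp add: abs_divide pos_divide_le_eq mult.commute)
    qed auto
    then have "\<bar>S z - z\<^sup>2 / 2\<bar> \<le> z\<^sup>2 / 4" using S00 by (simp add: power2_eq_square)
    then show ?thesis unfolding abs_le_iff by auto
  qed
  show ?thesis
  proof (rule that[OF B r(1) gd hd hc Sd _ _ _ _ _ SB])
    show "deriv \<sigma> (z / a) / a = a + h z" for z by (simp add: h_def)
    fix z :: real assume z: "\<bar>z\<bar> \<le> r"
    then have z1: "\<bar>z\<bar> \<le> 1" using r by simp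
    show "\<bar>h z\<bar> \<le> B * \<bar>z\<bar>" "\<bar>h' z\<bar> \<le> B" "\<bar>g z\<bar> \<le> B * z\<^sup>2" by (rule hB[OF z1] h'B[OF z1] gB[OF z1])+
    show "\<bar>h z\<bar> \<le> B" using hB[OF z1] mult_left_mono[OF z1, of B] B by linarith
  qed auto
qed

text \<open>Multiplication by \<open>h(z)\<close> is bounded on \<open>H\<^sup>1\<close>, with small norm when \<open>z\<close> is small in \<open>H\<^sup>1\<close>, hence by duality also on
\<open>H\<^sup>-\<^sup>1\<close>. The duality is applied to the test function \<open>res 1 G\<close>, whose \<open>H\<^sup>1\<close> norm is the \<open>H\<^sup>-\<^sup>1\<close> norm of
\<open>G\<close>.\<close>

lemma G_H1_dual_bound:
  assumes z: "derives z zx" and G: "\<And>x. app G x = h (app z x) * app zx x"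
    and hd: "\<And>x. (h has_real_derivative h' x) (at x)" and h'c: "continuous_on UNIV h'"
    and hB: "\<And>x. \<bar>h (app z x)\<bar> \<le> B * k" and h'B: "\<And>x. \<bar>h' (app z x)\<bar> \<le> B" and B: "0 \<le> B" and k: "0 \<le> k"
  shows "norm (J G) \<le> B * (2 * k + norm zx) * norm (J zx)"
proof -
  let ?R = "res 1 G" and ?R' = "dres 1 G"
  have R: "derives ?R ?R'" by (rule derives_res) simp
  have JR: "norm ?R \<le> norm (J G)" "norm ?R' \<le> norm (J G)" by (rule norm_res_le_J norm_dres_le_J)+
  have Rsup: "\<bar>app ?R x\<bar> \<le> norm (J G)" for x
  proof (rule power2_le_imp_le[of "\<bar>app ?R x\<bar>", simplified power2_abs])
    have "0 \<le> (norm ?R - norm ?R')\<^sup>2" by simp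
    then have "2 * norm ?R * norm ?R' \<le> (norm ?R)\<^sup>2 + (norm ?R')\<^sup>2" by (simp add: power2_diff)
    also have "\<dots> = (norm (J G))\<^sup>2" unfolding J_def by (simp add: norm_Pair)
    finally show "(app ?R x)\<^sup>2 \<le> (norm (J G))\<^sup>2" using sup_bound[OF R, of x] by linarith
  qed simp
  have hc: "continuous_on UNIV h" using hd by (auto intro!: continuous_at_imp_continuous_on DERIV_isCont)
  have hzc: "continuous_on UNIV (\<lambda>x. h (app z x))" "continuous_on UNIV (\<lambda>x. h' (app z x))"
    by (rule continuous_on_compose2[OF hc continuous_app] continuous_on_compose2[OF h'c continuous_app]; simp)+
  define e where "e = (\<lambda>x. app ?R x * h (app z x))"
  define e1 where "e1 = (\<lambda>x. app ?R' x * h (app z x))"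
  define e2 where "e2 = (\<lambda>x. app ?R x * (h' (app z x) * app zx x))"
  have eb: "\<bar>e x\<bar> \<le> (B * k) * \<bar>app ?R x\<bar>" and e1b: "\<bar>e1 x\<bar> \<le> (B * k) * \<bar>app ?R' x\<bar>" for x
    unfolding e_def e1_def abs_mult mult.commute[of "B * k"] by (intro mult_left_mono hB; simp)+
  have e2b: "\<bar>e2 x\<bar> \<le> (norm (J G) * B) * \<bar>app zx x\<bar>" for x
  proof -
    have "\<bar>app ?R x\<bar> * (\<bar>h' (app z x)\<bar> * \<bar>app zx x\<bar>) \<le> norm (J G) * (B * \<bar>app zx x\<bar>)"
      by (intro mult_mono Rsup h'B) (use B in auto)
    then show ?thesis unfolding e2_def by (simp add: abs_mult mult.assoc)
  qed
  have mem: "e \<in> cL2" "e1 \<in> cL2" "e2 \<in> cL2"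
    by (rule cL2_bound[OF app_cL2 _ eb] cL2_bound[OF app_cL2 _ e1b] cL2_bound[OF app_cL2 _ e2b];
        unfold e_def e1_def e2_def; intro continuous_intros continuous_app hzc)+
  have nb: "norm (L2fun f) \<le> c * norm w" if f: "f \<in> cL2" and b: "\<And>x. \<bar>f x\<bar> \<le> c * \<bar>app w x\<bar>" and c: "0 \<le> c" for f c w
  proof (rule power2_le_imp_le)
    have "(norm (L2fun f))\<^sup>2 = (LINT x|lborel. (f x)\<^sup>2)" using f by (simp add: norm_l2fun_sq L2fun_inverse)
    also have "\<dots> \<le> (LINT x|lborel. c\<^sup>2 * (app w x)\<^sup>2)"
    proof (rule integral_mono)
      show "(f x)\<^sup>2 \<le> c\<^sup>2 * (app w x)\<^sup>2" for x
        using power_mono[OF b[of x], of 2] by (simp add: power_mult_distrib)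
      show "integrable lborel (\<lambda>x. c\<^sup>2 * (app w x)\<^sup>2)" using app_cL2[of w] by (simp add: cL2_def)
    qed (use f in \<open>simp add: cL2_def\<close>)
    also have "\<dots> = (c * norm w)\<^sup>2" by (simp add: norm_l2fun_sq power_mult_distrib)
    finally show "(norm (L2fun f))\<^sup>2 \<le> (c * norm w)\<^sup>2" .
  qed (use c in simp)
  have Bk: "0 \<le> B * k" using B k by simp
  have n: "norm (L2fun e) \<le> B * k * norm (J G)" "norm (L2fun e1) \<le> B * k * norm (J G)"
    "norm (L2fun e2) \<le> norm (J G) * B * norm zx"
  proof -
    show "norm (L2fun e) \<le> B * k * norm (J G)"
      by (rule order_trans[OF nb[OF mem(1) eb Bk] mult_left_mono[OF JR(1) Bk]])
    show "norm (L2fun e1) \<le> B * k * norm (J G)"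
      by (rule order_trans[OF nb[OF mem(2) e1b Bk] mult_left_mono[OF JR(2) Bk]])
    show "norm (L2fun e2) \<le> norm (J G) * B * norm zx"
      by (rule nb[OF mem(3) e2b]) (use B in simp)
  qed
  have ed: "derives (L2fun e) (L2fun e1 + L2fun e2)"
    unfolding derives_def app_simps
  proof
    fix x
    have "((\<lambda>x. h (app z x)) has_real_derivative h' (app z x) * app zx x) (at x)"
      by (rule DERIV_chain2[OF hd]) (use z in \<open>simp add: derives_def\<close>)
    then have "(e has_real_derivative (app ?R' x * h (app z x) + (h' (app z x) * app zx x) * app ?R x)) (at x)"
      unfolding e_def using R by (intro DERIV_mult) (simp_all add: derives_def)
    then show "(app (L2fun e) has_real_derivative app (L2fun e1) x + app (L2fun e2) x) (at x)"
      using mem by (simp add: L2fun_inverse e1_def e2_def mult.commute)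
  qed
  \<comment> \<open>\<open>z\<^sub>x = W - W'\<^sub>x\<close> with \<open>W = res 1 z\<^sub>x\<close> and \<open>W'\<close> its derivative, so that pairing \<open>e\<close> with \<open>z\<^sub>x\<close> only involves
    \<open>W\<close>, \<open>W'\<close> and one derivative of \<open>e\<close>.\<close>
  let ?W = "res 1 zx" and ?W' = "dres 1 zx"
  have W: "derives ?W' (?W - zx)" using derives_res(2)[of 1 zx] by simp
  have "(norm (J G))\<^sup>2 = inner ?R G" unfolding power2_norm_eq_inner by (rule inner_J)
  also have "\<dots> = inner (L2fun e) zx"
    using mem by (simp add: inner_l2fun_def L2fun_inverse e_def G mult.assoc)
  also have "\<dots> = inner (L2fun e) ?W - inner (L2fun e) (?W - zx)" by (simp add: inner_diff_right)
  also have "\<dots> = inner (L2fun e) ?W + inner (L2fun e1 + L2fun e2) ?W'"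
    using inner_derives[OF ed W] by simp
  also have "\<dots> \<le> norm (L2fun e) * norm ?W + norm (L2fun e1 + L2fun e2) * norm ?W'"
    by (intro add_mono norm_cauchy_schwarz)
  also have "\<dots> \<le> (B * k * norm (J G)) * norm (J zx) + (B * k * norm (J G) + norm (J G) * B * norm zx) * norm (J zx)"
  proof (intro add_mono mult_mono n norm_res_le_J norm_dres_le_J)
    show "norm (L2fun e1 + L2fun e2) \<le> B * k * norm (J G) + norm (J G) * B * norm zx"
      by (rule order_trans[OF norm_triangle_ineq add_mono[OF n(2,3)]])
  qed (use B k in auto)
  also have "\<dots> = norm (J G) * (B * (2 * k + norm zx) * norm (J zx))" by (simp add: algebra_simps)
  finally have "norm (J G) * norm (J G) \<le> norm (J G) * (B * (2 * k + norm zx) * norm (J zx))"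
    by (simp add: power2_eq_square)
  then show ?thesis by (rule le_of_square_le[OF _ norm_ge_zero]) (use B k in simp)
qed

text \<open>The second derivative of \<open>S\<close> is bounded on the range of \<open>Z\<close>, so the second-order Taylor estimate of \<open>S\<close> integrates to a
remainder that is quadratic in the \<open>L\<^sup>2\<close> distance.\<close>

lemma potential_energy_deriv:
  fixes Z :: "real \<Rightarrow> l2fun"
  assumes Zd: "(Z has_vector_derivative Z') (at t within {0..})"
    and Sd: "\<And>z. (S has_real_derivative p z) (at z)" and pd: "\<And>z. (p has_real_derivative p' z) (at z)"
    and pb: "\<And>z. \<bar>z\<bar> \<le> r \<Longrightarrow> \<bar>p' z\<bar> \<le> K" and K: "0 \<le> K"
    and Zb: "\<And>s x. 0 \<le> s \<Longrightarrow> \<bar>app (Z s) x\<bar> \<le> r"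
    and Sb: "\<And>z. \<bar>z\<bar> \<le> r \<Longrightarrow> \<bar>S z\<bar> \<le> z\<^sup>2"
    and P: "\<And>x. app P x = p (app (Z t) x)" and t: "0 \<le> t"
  shows "((\<lambda>s. LINT x|lborel. S (app (Z s) x)) has_real_derivative inner P Z') (at t within {0..})"
    and "integrable lborel (\<lambda>x. S (app (Z t) x))"
proof -
  have Sc: "continuous_on UNIV S" using Sd by (auto intro!: continuous_at_imp_continuous_on DERIV_isCont)
  have Si: "integrable lborel (\<lambda>x. S (app (Z s) x))" if "0 \<le> s" for s
  proof (rule Bochner_Integration.integrable_bound)
    show "integrable lborel (\<lambda>x. (app (Z s) x)\<^sup>2)" using app_cL2[of "Z s"] by (simp add: cL2_def)
    show "(\<lambda>x. S (app (Z s) x)) \<in> borel_measurable lborel"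
      using borel_measurable_continuous_onI[OF continuous_on_compose2[OF Sc continuous_app]] by simp
  qed (use Sb Zb that in auto)
  then show "integrable lborel (\<lambda>x. S (app (Z t) x))" using t by blast
  have taylor: "\<bar>S b - S c - p c * (b - c)\<bar> \<le> K * (b - c)\<^sup>2" if "\<bar>b\<bar> \<le> r" "\<bar>c\<bar> \<le> r" for b c
  proof -
    define T where "T = (\<lambda>x. S x - p c * x)"
    have Td: "(T has_real_derivative p x - p c) (at x)" for x
      unfolding T_def by (auto intro!: derivative_eq_intros Sd)
    have "norm (T b - T c) \<le> (K * \<bar>b - c\<bar>) * norm (b - c)"
    proof (rule field_differentiable_bound[of "closed_segment c b"])
      show "(T has_field_derivative p x - p c) (at x within closed_segment c b)" for x
        by (rule has_field_derivative_at_within[OF Td])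
      fix x assume x: "x \<in> closed_segment c b"
      then have xb: "\<bar>x - c\<bar> \<le> \<bar>b - c\<bar>" "\<bar>x\<bar> \<le> r"
        using that by (auto simp: closed_segment_eq_real_ivl split: if_splits)
      have "\<bar>p x - p c\<bar> \<le> K * \<bar>x - c\<bar>" by (rule mvt_bound[OF pd pb xb(2) that(2)])
      also have "\<dots> \<le> K * \<bar>b - c\<bar>" using xb K by (intro mult_left_mono) auto
      finally show "norm (p x - p c) \<le> K * \<bar>b - c\<bar>" by simp
    qed auto
    then show ?thesis unfolding T_def by (simp add: power2_eq_square algebra_simps)
  qed
  have le: "\<bar>(LINT x|lborel. S (app (Z s) x)) - (LINT x|lborel. S (app (Z t) x)) - inner P (Z s - Z t)\<bar> \<le> K * (norm (Z s - Z t))\<^sup>2"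
    if s: "0 \<le> s" for s
  proof -
    have i: "integrable lborel (\<lambda>x. app P x * app (Z s - Z t) x)" by (rule integrable_app)
    have "(LINT x|lborel. S (app (Z s) x)) - (LINT x|lborel. S (app (Z t) x)) - inner P (Z s - Z t)
        = (LINT x|lborel. S (app (Z s) x) - S (app (Z t) x) - app P x * app (Z s - Z t) x)"
      unfolding inner_l2fun_def using Si[OF s] Si[OF t] i by simp
    also have "norm \<dots> \<le> (LINT x|lborel. K * (app (Z s - Z t) x)\<^sup>2)"
    proof (rule order_trans[OF integral_norm_bound integral_mono_AE'])
      show "integrable lborel (\<lambda>x. K * (app (Z s - Z t) x)\<^sup>2)" using app_cL2[of "Z s - Z t"] by (simp add: cL2_def)
      show "AE x in lborel. norm (S (app (Z s) x) - S (app (Z t) x) - app P x * app (Z s - Z t) x) \<le> K * (app (Z s - Z t) x)\<^sup>2"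
        using taylor[OF Zb[OF s] Zb[OF t]] by (auto simp: P app_simps)
    qed (use K in simp)
    finally show ?thesis by (simp add: norm_l2fun_sq)
  qed
  define \<Phi> where "\<Phi> s = (LINT x|lborel. S (app (Z s) x)) - inner P (Z s)" for s
  have iP: "((\<lambda>s. inner P (Z s)) has_real_derivative inner P Z') (at t within {0..})"
    using inner_curve[OF has_vector_derivative_const Zd, of P] by simp
  have "(\<Phi> has_real_derivative 0) (at t within {0..})"
    unfolding has_field_derivative_iff
  proof (rule Lim_null_comparison)
    have zl: "((\<lambda>s. (1 / (s - t)) *\<^sub>R (Z s - Z t)) \<longlongrightarrow> Z') (at t within {0..})"
    proof (rule LIM_zero_cancel, rule tendsto_norm_zero_cancel)
      have "((\<lambda>s. (1 / norm (s - t)) *\<^sub>R (Z s - (Z t + (s - t) *\<^sub>R Z'))) \<longlongrightarrow> 0) (at t within {0..})"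
        using Zd unfolding has_vector_derivative_def has_derivative_within by blast
      from tendsto_norm_zero[OF this]
      show "((\<lambda>s. norm ((1 / (s - t)) *\<^sub>R (Z s - Z t) - Z')) \<longlongrightarrow> 0) (at t within {0..})"
      proof (rule Lim_transform_eventually)
        show "\<forall>\<^sub>F s in at t within {0..}. norm ((1 / norm (s - t)) *\<^sub>R (Z s - (Z t + (s - t) *\<^sub>R Z')))
            = norm ((1 / (s - t)) *\<^sub>R (Z s - Z t) - Z')"
          unfolding eventually_at_filter
        proof (intro always_eventually allI impI)
          fix s assume "s \<noteq> t"
          then have "(1 / (s - t)) *\<^sub>R (Z s - Z t) - Z' = (1 / (s - t)) *\<^sub>R (Z s - (Z t + (s - t) *\<^sub>R Z'))"
            by (simp add: scaleR_diff_right scaleR_add_right)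
          then show "norm ((1 / norm (s - t)) *\<^sub>R (Z s - (Z t + (s - t) *\<^sub>R Z'))) = norm ((1 / (s - t)) *\<^sub>R (Z s - Z t) - Z')"
            by simp
        qed
      qed
    qed
    show "((\<lambda>s. \<bar>s - t\<bar> * (K * (norm ((1 / (s - t)) *\<^sub>R (Z s - Z t)))\<^sup>2)) \<longlongrightarrow> 0) (at t within {0..})"
    proof -
      have "((\<lambda>s. \<bar>s - t\<bar> * (K * (norm ((1 / (s - t)) *\<^sub>R (Z s - Z t)))\<^sup>2)) \<longlongrightarrow> \<bar>t - t\<bar> * (K * (norm Z')\<^sup>2)) (at t within {0..})"
        by (intro tendsto_intros zl)
      then show ?thesis by simp
    qed
    show "\<forall>\<^sub>F s in at t within {0..}. norm ((\<Phi> s - \<Phi> t) / (s - t)) \<le> \<bar>s - t\<bar> * (K * (norm ((1 / (s - t)) *\<^sub>R (Z s - Z t)))\<^sup>2)"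
      unfolding eventually_at_filter
    proof (intro always_eventually allI impI)
      fix s assume s: "s \<noteq> t" "s \<in> {0..}"
      have "\<bar>\<Phi> s - \<Phi> t\<bar> \<le> K * (norm (Z s - Z t))\<^sup>2"
        using le[of s] s unfolding \<Phi>_def by (simp add: inner_diff_right algebra_simps)
      moreover have "\<bar>s - t\<bar> * (K * (norm ((1 / (s - t)) *\<^sub>R (Z s - Z t)))\<^sup>2) = K * (norm (Z s - Z t))\<^sup>2 / \<bar>s - t\<bar>"
      proof -
        have n: "norm ((1 / (s - t)) *\<^sub>R (Z s - Z t)) = norm (Z s - Z t) / \<bar>s - t\<bar>"
          unfolding norm_scaleR by simp
        have "w * (K * (n / w)\<^sup>2) = K * n\<^sup>2 / w" if "0 < w" for w n
          using that by (simp add: power2_eq_square)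
        then show ?thesis unfolding n using s by simp
      qed
      ultimately show "norm ((\<Phi> s - \<Phi> t) / (s - t)) \<le> \<bar>s - t\<bar> * (K * (norm ((1 / (s - t)) *\<^sub>R (Z s - Z t)))\<^sup>2)"
        by (simp add: divide_right_mono)
    qed
  qed
  from DERIV_add[OF this iP]
  show "((\<lambda>s. LINT x|lborel. S (app (Z s) x)) has_real_derivative inner P Z') (at t within {0..})"
    by (simp add: \<Phi>_def)
qed

section \<open>Small solutions as damped flows\<close>

lemma vector_4:
  "(vector [x,y,z,w] ::('a::zero)^4)$1 = x" "(vector [x,y,z,w] ::('a::zero)^4)$2 = y"
  "(vector [x,y,z,w] ::('a::zero)^4)$3 = z" "(vector [x,y,z,w] ::('a::zero)^4)$4 = w"
  unfolding vector_def by simp_all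

lemma system_components:
  fixes D X W :: "real ^ 4"
  assumes "D + matA \<sigma> a W *v X + matL \<gamma> *v W = 0"
  shows "D $ 1 = X $ 2 - W $ 4" "D $ 2 = X $ 1" "D $ 3 = a * X $ 4"
    "D $ 4 = deriv \<sigma> (W $ 3 / a) / a * X $ 3 + W $ 1 - \<gamma> * W $ 4"
proof -
  have "D $ i + (matA \<sigma> a W *v X) $ i + (matL \<gamma> *v W) $ i = 0" for i
    using assms by (metis vector_add_component zero_index)
  from this[of 1] this[of 2] this[of 3] this[of 4]
  show "D $ 1 = X $ 2 - W $ 4" "D $ 2 = X $ 1" "D $ 3 = a * X $ 4"
    "D $ 4 = deriv \<sigma> (W $ 3 / a) / a * X $ 3 + W $ 1 - \<gamma> * W $ 4"
    by (simp_all add: matA_def matL_def matrix_vector_mult_def sum_4 vector_4)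
qed

lemma component_derivatives:
  assumes C: "C1_halfplane U"
  shows "0 \<le> t \<Longrightarrow> ((\<lambda>x. U t x $ i) has_real_derivative dx U t x $ i) (at x)"
    and "0 \<le> t \<Longrightarrow> ((\<lambda>s. U s x $ i) has_real_derivative dt U t x $ i) (at t within {0..})"
    and "continuous_on ({0..} \<times> UNIV) (\<lambda>(t, x). U t x $ i)" "continuous_on ({0..} \<times> UNIV) (\<lambda>(t, x). dx U t x $ i)"
    and "0 \<le> t \<Longrightarrow> continuous_on UNIV (\<lambda>x. dt U t x $ i)"
proof -
  note bl = bounded_linear.has_vector_derivative[OF bounded_linear_vec_nth]
  show "((\<lambda>x. U t x $ i) has_real_derivative dx U t x $ i) (at x)" if "0 \<le> t"
  proof -
    have "(U t has_vector_derivative dx U t x) (at x)"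
      using C that by (simp add: C1_halfplane_def dx_def vector_derivative_works[symmetric])
    from bl[OF this] show ?thesis unfolding has_real_derivative_iff_has_vector_derivative .
  qed
  show "((\<lambda>s. U s x $ i) has_real_derivative dt U t x $ i) (at t within {0..})" if "0 \<le> t"
  proof -
    have "((\<lambda>s. U s x) has_vector_derivative dt U t x) (at t within {0..})"
      using C that by (simp add: C1_halfplane_def dt_def vector_derivative_works[symmetric])
    from bl[OF this] show ?thesis unfolding has_real_derivative_iff_has_vector_derivative .
  qed
  have c: "continuous_on ({0..} \<times> UNIV) (\<lambda>(t, x). h t x $ i)" if "continuous_on ({0..} \<times> UNIV) (\<lambda>(t, x). h t x)"
    for h :: "real \<Rightarrow> real \<Rightarrow> real ^ 'a"
    using continuous_on_component[OF that, of i] by (simp add: case_prod_beta')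
  show "continuous_on ({0..} \<times> UNIV) (\<lambda>(t, x). U t x $ i)" "continuous_on ({0..} \<times> UNIV) (\<lambda>(t, x). dx U t x $ i)"
    using C by (auto simp: C1_halfplane_def intro!: c)
  show "continuous_on UNIV (\<lambda>x. dt U t x $ i)" if "0 \<le> t"
  proof -
    have d: "continuous_on ({0..} \<times> UNIV) (\<lambda>(t, x). dt U t x $ i)"
      using C by (auto simp: C1_halfplane_def intro!: c)
    have "continuous_on UNIV (Pair t)" "range (Pair t) \<subseteq> {0..} \<times> (UNIV :: real set)"
      using that by (auto intro!: continuous_intros)
    from continuous_on_compose2[OF d this] show ?thesis by simp
  qed
qed

text \<open>A solution with data of size at most \<open>I\<close>, together with the data provided by \<open>nonlinearity\<close>. The first
smallness condition keeps the values of \<open>z\<close> in the interval where the bounds on the nonlinearity hold, the second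
makes the constant of \<open>G_H1_dual_bound\<close> at most \<open>e\<close>.\<close>

locale small_solution =
  fixes phi chi \<sigma> g h h' S :: "real \<Rightarrow> real" and \<gamma> a \<delta>0 C0 B r I e :: real and U0 :: "real \<Rightarrow> real ^ 4" and U :: "real \<Rightarrow> real \<Rightarrow> real ^ 4"
  assumes lp: "littlewood_paley phi chi" and \<gamma>: "0 < \<gamma>" and a: "0 < a" and C0: "0 < C0"
    and B: "0 < B" and r: "0 < r"
    and gd: "\<And>z. (g has_real_derivative h z) (at z)" and hd: "\<And>z. (h has_real_derivative h' z) (at z)"
    and h'c: "continuous_on UNIV h'"
    and Sd: "\<And>z. (S has_real_derivative z + g z / a) (at z)"
    and \<sigma>h: "\<And>z. deriv \<sigma> (z / a) / a = a + h z"
    and hB: "\<And>z. \<bar>z\<bar> \<le> r \<Longrightarrow> \<bar>h z\<bar> \<le> B * \<bar>z\<bar>" "\<And>z. \<bar>z\<bar> \<le> r \<Longrightarrow> \<bar>h z\<bar> \<le> B"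
    and h'B: "\<And>z. \<bar>z\<bar> \<le> r \<Longrightarrow> \<bar>h' z\<bar> \<le> B" and gB: "\<And>z. \<bar>z\<bar> \<le> r \<Longrightarrow> \<bar>g z\<bar> \<le> B * z\<^sup>2"
    and SB: "\<And>z. \<bar>z\<bar> \<le> r \<Longrightarrow> z\<^sup>2 / 4 \<le> S z \<and> S z \<le> z\<^sup>2"
    and sol: "small_data_solution (phi, chi) \<sigma> a \<gamma> \<delta>0 C0 U0 U"
    and I0: "I0_norm (phi, chi) U0 \<le> ennreal I" and I: "0 < I"
    and small: "10 * C0 * I \<le> r" "31 * B * C0 * I \<le> e"
begin

abbreviation "M \<equiv> C0 * I"

text \<open>The components of the solution and of its derivatives as elements of the inner product space. They are meaningful for
\<open>t \<ge> 0\<close>, by \<open>H1\<close> and \<open>time_deriv\<close>.\<close>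

definition Uc :: "4 \<Rightarrow> real \<Rightarrow> l2fun" where "Uc i t = L2fun (\<lambda>x. U t x $ i)"
definition Uc_x :: "4 \<Rightarrow> real \<Rightarrow> l2fun" where "Uc_x i t = L2fun (\<lambda>x. dx U t x $ i)"
definition Uc_t :: "4 \<Rightarrow> real \<Rightarrow> l2fun" where "Uc_t i t = L2fun (\<lambda>x. dt U t x $ i)"

lemma M: "0 < M" using C0 I by simp

lemma C1: "C1_halfplane U" and pde: "0 \<le> t \<Longrightarrow> dt U t x + matA \<sigma> a (U t x) *v dx U t x + matL \<gamma> *v U t x = 0"
  and U_init: "U 0 x = U0 x"
  using sol by (auto simp: small_data_solution_def classical_solution_def)

lemma coord_eq: "coord (U t) i = (\<lambda>x. complex_of_real (U t x $ i))"
  by (simp add: coord_def fun_eq_iff)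

lemma tempered_coord: "0 \<le> t \<Longrightarrow> tempered (dist_of (\<lambda>x. complex_of_real (U t x $ i)))"
  using sol unfolding small_data_solution_def solution_class_def tilde_C_def C_besov_def besov_def time_ivl_def coord_eq
  by auto

lemma C1_coord: "(\<lambda>t. dist_of (\<lambda>x. complex_of_real (U t x $ i))) \<in> tilde_C1 (phi, chi) \<infinity> (1/2) 2 1"
  using sol unfolding small_data_solution_def solution_class_def coord_eq by auto

lemma cl_coord: "cl_norm (phi, chi) \<infinity> \<infinity> (3/2) 2 1 (\<lambda>t. dist_of (\<lambda>x. complex_of_real (U t x $ i))) \<le> ennreal M"
proof -
  let ?c = "\<lambda>i. cl_norm (phi, chi) \<infinity> \<infinity> (3/2) 2 1 (\<lambda>t. dist_of (coord (U t) i))"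
  have "solution_estimate (phi, chi) C0 U0 U" using sol by (simp add: small_data_solution_def)
  then have est: "(\<Sum>i\<in>UNIV. ?c i)
        + cl_norm (phi, chi) 2 (1::real) (3/2) 2 1 (\<lambda>t. dist_of (coord (U t) 4))
        + (cl_norm (phi, chi) 2 (1::real) (1/2) 2 1 (\<lambda>t. dist_of (coord (U t) 1))
           + cl_norm (phi, chi) 2 (1::real) (1/2) 2 1 (\<lambda>t. dist_of (coord (dx U t) 3)))
        + cl_norm (phi, chi) 2 (1::real) (-1/2) 2 1 (\<lambda>t. dist_of (coord (dx U t) 2))
        \<le> ennreal C0 * besov_norm_vec (phi, chi) (3/2) 2 1 U0"
    unfolding solution_estimate_def by (elim allE[of _ "1::real"]) simp
  have "?c i \<le> (\<Sum>i\<in>UNIV. ?c i)" by (rule member_le_sum) auto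
  also have "\<dots> \<le> ennreal C0 * besov_norm_vec (phi, chi) (3/2) 2 1 U0"
    by (rule order_trans[OF _ est]) (simp add: add.assoc)
  also have "\<dots> \<le> ennreal C0 * I0_norm (phi, chi) U0" by (intro mult_left_mono) (auto simp: I0_norm_def)
  also have "\<dots> \<le> ennreal C0 * ennreal I" by (intro mult_left_mono I0) auto
  also have "\<dots> = ennreal M" using C0 I by (simp add: ennreal_mult)
  finally show ?thesis unfolding coord_eq .
qed

lemma H1: assumes t: "0 \<le> t"
  shows "app (Uc i t) = (\<lambda>x. U t x $ i)" "app (Uc_x i t) = (\<lambda>x. dx U t x $ i)"
    "norm (Uc i t) \<le> 4 * M" "norm (Uc_x i t) \<le> 11 * M" "derives (Uc i t) (Uc_x i t)"
proof -
  note cf = component_derivatives[OF C1]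
  note b = H1_bound_of_cl_norm[OF lp cf(1,3,4) tempered_coord cl_coord less_imp_le[OF M] t, of i]
  show 1: "app (Uc i t) = (\<lambda>x. U t x $ i)" "app (Uc_x i t) = (\<lambda>x. dx U t x $ i)"
    unfolding Uc_def Uc_x_def by (simp_all only: L2fun_inverse[OF b(1)] L2fun_inverse[OF b(3)])
  have "(norm (Uc i t))\<^sup>2 \<le> (4 * M)\<^sup>2" "(norm (Uc_x i t))\<^sup>2 \<le> (11 * M)\<^sup>2"
    using b(2,4) by (simp_all only: norm_l2fun_sq 1)
  then show "norm (Uc i t) \<le> 4 * M" "norm (Uc_x i t) \<le> 11 * M"
    using M by (auto intro: power2_le_imp_le)
  show "derives (Uc i t) (Uc_x i t)" unfolding derives_def 1 using cf(1)[OF t] by blast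
qed

lemma time_deriv: assumes t: "0 \<le> t"
  shows "app (Uc_t i t) = (\<lambda>x. dt U t x $ i)" "(Uc i has_vector_derivative Uc_t i t) (at t within {0..})"
proof -
  note cf = component_derivatives[OF C1]
  have f: "(\<lambda>x. U s x $ i) \<in> cL2" if "0 \<le> s" for s using H1(1)[OF that, of i] app_cL2[of "Uc i s"] by simp
  note d = L2_time_derivative[OF lp, where f = "\<lambda>t x. U t x $ i" and ft = "\<lambda>t x. dt U t x $ i" and t = t,
      OF f cf(5)[OF t] cf(2)[OF t] C1_coord t]
  show "app (Uc_t i t) = (\<lambda>x. dt U t x $ i)" unfolding Uc_t_def by (rule L2fun_inverse[OF d(1)])
  show "(Uc i has_vector_derivative Uc_t i t) (at t within {0..})"
    using d(2) unfolding Uc_def[abs_def] Uc_t_def .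
qed

lemma sup_z: assumes t: "0 \<le> t" shows "\<bar>app (Uc i t) x\<bar> \<le> 10 * M" "\<bar>app (Uc i t) x\<bar> \<le> r"
proof -
  have "(app (Uc i t) x)\<^sup>2 \<le> 2 * norm (Uc i t) * norm (Uc_x i t)" by (rule sup_bound[OF H1(5)[OF t]])
  also have "\<dots> \<le> 2 * (4 * M) * (11 * M)" using M by (intro mult_mono H1[OF t]) auto
  also have "\<dots> \<le> (10 * M)\<^sup>2" using C0 I by (simp add: power2_eq_square)
  finally show 1: "\<bar>app (Uc i t) x\<bar> \<le> 10 * M" using power2_le_imp_le[of "\<bar>app (Uc i t) x\<bar>" "10 * M"] M by simp
  then show "\<bar>app (Uc i t) x\<bar> \<le> r" using small(1) by (simp add: mult.assoc)
qed

definition gz :: "real \<Rightarrow> l2fun" where "gz t = L2fun (\<lambda>x. g (U t x $ 3))"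
definition Gz :: "real \<Rightarrow> l2fun" where "Gz t = L2fun (\<lambda>x. h (U t x $ 3) * dx U t x $ 3)"

lemma gz: assumes t: "0 \<le> t"
  shows "app (gz t) x = g (app (Uc 3 t) x)" "app (Gz t) x = h (app (Uc 3 t) x) * app (Uc_x 3 t) x"
    "derives (gz t) (Gz t)" "integrable lborel (\<lambda>x. \<bar>app (gz t) x\<bar>)" "(LINT x|lborel. \<bar>app (gz t) x\<bar>) \<le> B * (norm (Uc 3 t))\<^sup>2"
proof -
  have c: "continuous_on UNIV g" "continuous_on UNIV h"
    using gd hd by (auto intro!: continuous_at_imp_continuous_on DERIV_isCont)
  let ?z = "app (Uc 3 t)" and ?zx = "app (Uc_x 3 t)"
  have m1: "(\<lambda>x. g (?z x)) \<in> cL2"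
  proof (rule cL2_bound[OF app_cL2[of "Uc 3 t"]])
    show "continuous_on UNIV (\<lambda>x. g (?z x))" by (rule continuous_on_compose2[OF c(1) continuous_app]) simp
    show "\<bar>g (?z x)\<bar> \<le> (B * r) * \<bar>?z x\<bar>" for x
    proof -
      have "\<bar>g (?z x)\<bar> \<le> B * (\<bar>?z x\<bar> * \<bar>?z x\<bar>)" using gB[OF sup_z(2)[OF t]] by (simp add: power2_eq_square)
      also have "\<dots> \<le> B * (r * \<bar>?z x\<bar>)" using B by (intro mult_left_mono mult_right_mono sup_z(2)[OF t]) auto
      finally show ?thesis by simp
    qed
  qed
  have m2: "(\<lambda>x. h (?z x) * ?zx x) \<in> cL2"
  proof (rule cL2_bound[OF app_cL2[of "Uc_x 3 t"]])
    show "continuous_on UNIV (\<lambda>x. h (?z x) * ?zx x)"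
      by (intro continuous_on_mult continuous_on_compose2[OF c(2) continuous_app] continuous_app) simp
    show "\<bar>h (?z x) * ?zx x\<bar> \<le> B * \<bar>?zx x\<bar>" for x
      unfolding abs_mult by (intro mult_right_mono hB(2) sup_z(2)[OF t]) simp
  qed
  have g: "app (gz t) = (\<lambda>x. g (?z x))" "app (Gz t) = (\<lambda>x. h (?z x) * ?zx x)"
    using L2fun_inverse[OF m1] L2fun_inverse[OF m2] unfolding gz_def Gz_def H1[OF t] by simp_all
  then show "app (gz t) x = g (?z x)" "app (Gz t) x = h (?z x) * ?zx x" by simp_all
  show "derives (gz t) (Gz t)"
    unfolding derives_def g
    by (intro allI DERIV_chain2[OF gd]) (use H1(5)[OF t, of 3] in \<open>simp add: derives_def\<close>)
  have i: "integrable lborel (\<lambda>x. B * (?z x)\<^sup>2)" using app_cL2[of "Uc 3 t"] by (simp add: cL2_def)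
  show i': "integrable lborel (\<lambda>x. \<bar>app (gz t) x\<bar>)"
    by (rule Bochner_Integration.integrable_bound[OF i])
      (use gB[OF sup_z(2)[OF t]] B borel_measurable_abs[OF cL2_measurable[OF m1]] in \<open>auto simp: g abs_mult\<close>)
  have "(LINT x|lborel. \<bar>app (gz t) x\<bar>) \<le> (LINT x|lborel. B * (?z x)\<^sup>2)"
    by (rule integral_mono[OF i' i]) (use gB[OF sup_z(2)[OF t]] in \<open>simp add: g\<close>)
  then show "(LINT x|lborel. \<bar>app (gz t) x\<bar>) \<le> B * (norm (Uc 3 t))\<^sup>2" by (simp add: norm_l2fun_sq)
qed

lemma equations: assumes t: "0 \<le> t"
  shows "Uc_t 1 t = Uc_x 2 t - Uc 4 t" "Uc_t 2 t = Uc_x 1 t" "Uc_t 3 t = a *\<^sub>R Uc_x 4 t"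
    "Uc_t 4 t = a *\<^sub>R Uc_x 3 t + Uc 1 t - \<gamma> *\<^sub>R Uc 4 t + Gz t"
  by (rule app_eqI, use system_components[OF pde[OF t]] in
      \<open>simp add: app_simps time_deriv(1)[OF t] H1(1,2)[OF t] gz(2)[OF t] \<sigma>h algebra_simps\<close>)+

definition energy :: "real \<Rightarrow> real" where
  "energy t = ((norm (Uc 1 t))\<^sup>2 + (norm (Uc 2 t))\<^sup>2 + (norm (Uc 4 t))\<^sup>2) / 2 + (LINT x|lborel. S (app (Uc 3 t) x))"

lemma potential: assumes t: "0 \<le> t"
  shows "((\<lambda>s. LINT x|lborel. S (app (Uc 3 s) x)) has_real_derivative inner (Uc 3 t + (1/a) *\<^sub>R gz t) (Uc_t 3 t)) (at t within {0..})"
    "integrable lborel (\<lambda>x. S (app (Uc 3 t) x))"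
proof -
  have pd: "((\<lambda>z. z + g z / a) has_real_derivative 1 + h z / a) (at z)" for z
    using DERIV_add[OF DERIV_ident DERIV_cdivide[OF gd]] .
  have pb: "\<bar>1 + h z / a\<bar> \<le> 1 + B / a" if "\<bar>z\<bar> \<le> r" for z
  proof -
    have "\<bar>1 + h z / a\<bar> \<le> 1 + \<bar>h z\<bar> / a" using abs_triangle_ineq[of 1 "h z / a"] a by (simp add: abs_divide)
    moreover have "\<bar>h z\<bar> / a \<le> B / a" using hB(2)[OF that] a by (intro divide_right_mono) auto
    ultimately show ?thesis by linarith
  qed
  have Sb: "\<bar>S z\<bar> \<le> z\<^sup>2" if "\<bar>z\<bar> \<le> r" for z
  proof -
    have "0 \<le> z\<^sup>2 / 4" by simp
    then show ?thesis using SB[OF that] by (auto simp: abs_le_iff)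
  qed
  have K: "0 \<le> 1 + B / a" using B a by (simp add: add_nonneg_nonneg)
  have P: "app (Uc 3 t + (1/a) *\<^sub>R gz t) x = app (Uc 3 t) x + g (app (Uc 3 t) x) / a" for x
    by (simp add: app_simps gz(1)[OF t])
  show "((\<lambda>s. LINT x|lborel. S (app (Uc 3 s) x)) has_real_derivative inner (Uc 3 t + (1/a) *\<^sub>R gz t) (Uc_t 3 t)) (at t within {0..})"
    "integrable lborel (\<lambda>x. S (app (Uc 3 t) x))"
    by (rule potential_energy_deriv[OF time_deriv(2)[OF t] Sd pd pb K sup_z(2) Sb P t]; simp)+
qed

text \<open>All terms but the damping cancel: the linear ones by skew-symmetry, and those of the nonlinear flux because the
derivative of the potential energy is the stress.\<close>

lemma energy_deriv: assumes t: "0 \<le> t"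
  shows "(energy has_real_derivative - \<gamma> * (norm (Uc 4 t))\<^sup>2) (at t within {0..})"
proof -
  note c = inner_curve[OF time_deriv(2)[OF t] time_deriv(2)[OF t]]
  have "(energy has_real_derivative
      ((inner (Uc 1 t) (Uc_t 1 t) + inner (Uc_t 1 t) (Uc 1 t)) + (inner (Uc 2 t) (Uc_t 2 t) + inner (Uc_t 2 t) (Uc 2 t))
      + (inner (Uc 4 t) (Uc_t 4 t) + inner (Uc_t 4 t) (Uc 4 t))) / 2
      + inner (Uc 3 t + (1/a) *\<^sub>R gz t) (Uc_t 3 t)) (at t within {0..})"
    unfolding energy_def[abs_def] power2_norm_eq_inner
    by (intro DERIV_add DERIV_cdivide c potential t)
  moreover have "inner (Uc_x 2 t) (Uc 1 t) = - inner (Uc 2 t) (Uc_x 1 t)"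
    "inner (Uc_x 4 t) (Uc 3 t) = - inner (Uc 4 t) (Uc_x 3 t)"
    "inner (Uc_x 4 t) (gz t) = - inner (Uc 4 t) (Gz t)"
    by (intro inner_derives H1[OF t] gz[OF t])+
  ultimately show ?thesis
    unfolding equations[OF t] using a
    by (elim DERIV_cong) (simp add: inner_add_left inner_add_right inner_diff_left inner_diff_right inner_commute
        power2_norm_eq_inner add_divide_distrib diff_divide_distrib algebra_simps)
qed

lemma energy_bounds: assumes t: "0 \<le> t"
  shows "((norm (Uc 1 t))\<^sup>2 + (norm (Uc 2 t))\<^sup>2 + (norm (Uc 3 t))\<^sup>2 + (norm (Uc 4 t))\<^sup>2) / 4 \<le> energy t"
    "energy t \<le> (norm (Uc 1 t))\<^sup>2 + (norm (Uc 2 t))\<^sup>2 + (norm (Uc 3 t))\<^sup>2 + (norm (Uc 4 t))\<^sup>2"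
proof -
  have i: "integrable lborel (\<lambda>x. (app (Uc 3 t) x)\<^sup>2)" using app_cL2[of "Uc 3 t"] by (simp add: cL2_def)
  have "(LINT x|lborel. (app (Uc 3 t) x)\<^sup>2 / 4) \<le> (LINT x|lborel. S (app (Uc 3 t) x))"
    by (rule integral_mono) (use i potential(2)[OF t] SB[OF sup_z(2)[OF t]] in auto)
  moreover have "(LINT x|lborel. S (app (Uc 3 t) x)) \<le> (LINT x|lborel. (app (Uc 3 t) x)\<^sup>2)"
    by (rule integral_mono) (use i potential(2)[OF t] SB[OF sup_z(2)[OF t]] in auto)
  ultimately have "(norm (Uc 3 t))\<^sup>2 / 4 \<le> (LINT x|lborel. S (app (Uc 3 t) x))"
    "(LINT x|lborel. S (app (Uc 3 t) x)) \<le> (norm (Uc 3 t))\<^sup>2" by (simp_all add: norm_l2fun_sq)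
  moreover have "0 \<le> (norm (Uc 1 t))\<^sup>2" "0 \<le> (norm (Uc 2 t))\<^sup>2" "0 \<le> (norm (Uc 4 t))\<^sup>2" by simp_all
  ultimately show "((norm (Uc 1 t))\<^sup>2 + (norm (Uc 2 t))\<^sup>2 + (norm (Uc 3 t))\<^sup>2 + (norm (Uc 4 t))\<^sup>2) / 4 \<le> energy t"
    "energy t \<le> (norm (Uc 1 t))\<^sup>2 + (norm (Uc 2 t))\<^sup>2 + (norm (Uc 3 t))\<^sup>2 + (norm (Uc 4 t))\<^sup>2"
    unfolding energy_def add_divide_distrib by linarith+
qed

lemma Lp_norm_1_init: "integrable lborel (\<lambda>x. \<bar>app (Uc i 0) x\<bar>) \<and> (LINT x|lborel. \<bar>app (Uc i 0) x\<bar>) \<le> I"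
proof -
  have c0: "app (Uc i 0) x = U0 x $ i" for x using H1(1)[of 0 i] by (simp add: U_init)
  have m: "(\<lambda>x. U0 x $ i) \<in> borel_measurable lborel" using measurable_app[of "Uc i 0"] by (simp add: c0[abs_def])
  have "Lp_norm 1 lborel (\<lambda>x. ennreal \<bar>U0 x $ i\<bar>) = (\<integral>\<^sup>+x. ennreal \<bar>U0 x $ i\<bar> \<partial>lborel)"
    unfolding Lp_norm_def using m by (simp add: enn_powr_1)
  moreover have "Lp_norm 1 lborel (\<lambda>x. ennreal \<bar>U0 x $ i\<bar>) \<le> Lp_norm_vec 1 U0"
    unfolding Lp_norm_vec_def by (rule member_le_sum) auto
  moreover have "Lp_norm_vec 1 U0 \<le> ennreal I" using I0 unfolding I0_norm_def by (rule order_trans[rotated]) simp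
  ultimately have le: "(\<integral>\<^sup>+x. ennreal \<bar>U0 x $ i\<bar> \<partial>lborel) \<le> ennreal I" by simp
  have i: "integrable lborel (\<lambda>x. \<bar>U0 x $ i\<bar>)"
    by (rule integrableI_nonneg) (use m le_less_trans[OF le] in auto)
  then have "ennreal (LINT x|lborel. \<bar>U0 x $ i\<bar>) \<le> ennreal I" using le nn_integral_eq_integral[OF i] by simp
  then show ?thesis using i I by (simp add: c0 ennreal_le_iff)
qed

lemma is_flow: "flow a \<gamma> B (22 * C0) e I (Uc 1) (Uc 2) (Uc 3) (Uc 4) (Uc_x 1) (Uc_x 2) (Uc_x 3) (Uc_x 4) gz Gz energy"
proof (unfold_locales)
  show "0 < a" "0 < \<gamma>" "0 \<le> B" "0 < I" using a \<gamma> B I by auto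
  have "0 \<le> 31 * B * C0 * I" using B C0 I by simp
  then show "0 \<le> e" using small(2) by linarith
  fix t :: real assume t: "0 \<le> t"
  show "derives (Uc 1 t) (Uc_x 1 t)" "derives (Uc 2 t) (Uc_x 2 t)" "derives (Uc 3 t) (Uc_x 3 t)"
    "derives (Uc 4 t) (Uc_x 4 t)" "derives (gz t) (Gz t)" by (intro H1[OF t] gz[OF t])+
  show "(Uc 1 has_vector_derivative Uc_x 2 t - Uc 4 t) (at t within {0..})"
    "(Uc 2 has_vector_derivative Uc_x 1 t) (at t within {0..})"
    "(Uc 3 has_vector_derivative a *\<^sub>R Uc_x 4 t) (at t within {0..})"
    "(Uc 4 has_vector_derivative a *\<^sub>R Uc_x 3 t + Uc 1 t - \<gamma> *\<^sub>R Uc 4 t + Gz t) (at t within {0..})"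
    unfolding equations[OF t, symmetric] by (rule time_deriv(2)[OF t])+
  show "norm (J (Gz t)) \<le> e * norm (J (Uc_x 3 t))"
  proof -
    have "norm (J (Gz t)) \<le> B * (2 * (10 * M) + norm (Uc_x 3 t)) * norm (J (Uc_x 3 t))"
    proof (rule G_H1_dual_bound[OF H1(5)[OF t] gz(2)[OF t] hd h'c])
      show "\<bar>h (app (Uc 3 t) x)\<bar> \<le> B * (10 * M)" for x
        by (rule order_trans[OF hB(1)[OF sup_z(2)[OF t]]]) (use B sup_z(1)[OF t] in \<open>intro mult_left_mono; simp\<close>)
      show "\<bar>h' (app (Uc 3 t) x)\<bar> \<le> B" for x by (rule h'B[OF sup_z(2)[OF t]])
    qed (use B M in auto)
    also have "\<dots> \<le> e * norm (J (Uc_x 3 t))"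
    proof (rule mult_right_mono)
      have "B * (2 * (10 * M) + norm (Uc_x 3 t)) \<le> B * (2 * (10 * M) + 11 * M)"
        using B H1(4)[OF t, of 3] by (intro mult_left_mono) auto
      also have "\<dots> = 31 * B * C0 * I" by simp
      finally show "B * (2 * (10 * M) + norm (Uc_x 3 t)) \<le> e" using small(2) by linarith
    qed simp
    finally show ?thesis .
  qed
  show "integrable lborel (\<lambda>x. \<bar>app (gz t) x\<bar>)" "(LINT x|lborel. \<bar>app (gz t) x\<bar>) \<le> B * (norm (Uc 3 t))\<^sup>2"
    by (rule gz[OF t])+
  show "(energy has_real_derivative - \<gamma> * (norm (Uc 4 t))\<^sup>2) (at t within {0..})" by (rule energy_deriv[OF t])
  show "((norm (Uc 1 t))\<^sup>2 + (norm (Uc 2 t))\<^sup>2 + (norm (Uc 3 t))\<^sup>2 + (norm (Uc 4 t))\<^sup>2) / 4 \<le> energy t"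
    "energy t \<le> (norm (Uc 1 t))\<^sup>2 + (norm (Uc 2 t))\<^sup>2 + (norm (Uc 3 t))\<^sup>2 + (norm (Uc 4 t))\<^sup>2"
    by (rule energy_bounds[OF t])+
  have 1: "(norm (Uc i t))\<^sup>2 \<le> 16 * M\<^sup>2" for i
    using power_mono[OF H1(3)[OF t, of i] norm_ge_zero, of 2] by (simp add: power_mult_distrib)
  have 2: "(norm (Uc_x i t))\<^sup>2 \<le> 121 * M\<^sup>2" for i
    using power_mono[OF H1(4)[OF t, of i] norm_ge_zero, of 2] by (simp add: power_mult_distrib)
  have 3: "(22 * C0 * I)\<^sup>2 = 484 * M\<^sup>2" by (simp add: power_mult_distrib)
  have 4: "0 \<le> M\<^sup>2" by simp
  show "(norm (Uc 1 t))\<^sup>2 + (norm (Uc 2 t))\<^sup>2 + (norm (Uc 3 t))\<^sup>2 + (norm (Uc 4 t))\<^sup>2 \<le> (22 * C0 * I)\<^sup>2"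
    unfolding 3 using 1[of 1] 1[of 2] 1[of 3] 1[of 4] 4 by linarith
  show "(norm (Uc_x 1 t))\<^sup>2 + (norm (Uc_x 2 t))\<^sup>2 + (norm (Uc_x 3 t))\<^sup>2 + (norm (Uc_x 4 t))\<^sup>2 \<le> (22 * C0 * I)\<^sup>2"
    unfolding 3 using 2[of 1] 2[of 2] 2[of 3] 2[of 4] 4 by linarith
next
  fix w assume "w \<in> {Uc 1, Uc 2, Uc 3, Uc 4}"
  then show "integrable lborel (\<lambda>x. \<bar>app (w 0) x\<bar>) \<and> (LINT x|lborel. \<bar>app (w 0) x\<bar>) \<le> I"
    using Lp_norm_1_init by auto
qed

lemma L2_norm_vec: assumes t: "0 \<le> t"
  shows "Lp_norm_vec 2 (U t) = ennreal (norm (Uc 1 t) + norm (Uc 2 t) + norm (Uc 3 t) + norm (Uc 4 t))"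
proof -
  have "Lp_norm 2 lborel (\<lambda>x. ennreal \<bar>U t x $ i\<bar>) = ennreal (norm (Uc i t))" for i
  proof -
    have c: "app (Uc i t) x = U t x $ i" for x using H1(1)[OF t] by simp
    have "Lp_norm 2 lborel (\<lambda>x. ennreal \<bar>app (Uc i t) x\<bar>) = ennreal (sqrt (LINT x|lborel. \<bar>app (Uc i t) x\<bar>\<^sup>2))"
      by (rule Lp_norm_2(1)) (use app_cL2[of "Uc i t"] in \<open>auto simp: cL2_def\<close>)
    also have "(LINT x|lborel. \<bar>app (Uc i t) x\<bar>\<^sup>2) = (norm (Uc i t))\<^sup>2" by (simp add: norm_l2fun_sq)
    finally show ?thesis by (simp add: c)
  qed
  then show ?thesis unfolding Lp_norm_vec_def sum_4 by (simp add: ennreal_plus)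
qed

end

section \<open>The decay estimate\<close>

theorem corollary1p1:
  fixes phi chi \<sigma> :: "real \<Rightarrow> real" and \<gamma> a \<delta>0 C0 :: real
  assumes "littlewood_paley phi chi"
    and "smooth \<sigma>" and "\<And>\<eta>. deriv \<sigma> \<eta> > 0" and "\<gamma> > 0"
    and "a = sqrt (deriv \<sigma> 0)" and "a \<noteq> 1"
    and "\<delta>0 > 0" and "C0 > 0"
  shows "\<exists>\<delta> C. 0 < \<delta> \<and> \<delta> \<le> \<delta>0 \<and> 0 < C \<and>
    (\<forall>U0 :: real \<Rightarrow> real ^ 4.
       in_besov_vec (phi, chi) (3/2) 2 1 U0 \<longrightarrow> Lp_norm_vec 1 U0 < \<infinity> \<longrightarrow>
       I0_norm (phi, chi) U0 \<le> ennreal \<delta> \<longrightarrow>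
       (\<forall>U. small_data_solution (phi, chi) \<sigma> a \<gamma> \<delta>0 C0 U0 U \<longrightarrow>
          (\<forall>t\<ge>0. Lp_norm_vec 2 (U t)
              \<le> ennreal C * I0_norm (phi, chi) U0 * ennreal ((1 + t) powr (-1/4)))))"
proof -
  have a: "0 < a" "a\<^sup>2 = deriv \<sigma> 0" using assms(3)[of 0] by (simp_all add: assms(5))
  obtain g h h' S B r where nl: "0 < B" "0 < r"
    "\<And>z. (g has_real_derivative h z) (at z)" "\<And>z. (h has_real_derivative h' z) (at z)" "continuous_on UNIV h'"
    "\<And>z. (S has_real_derivative z + g z / a) (at z)"
    "\<And>z. deriv \<sigma> (z / a) / a = a + h z"
    "\<And>z. \<bar>z\<bar> \<le> r \<Longrightarrow> \<bar>h z\<bar> \<le> B * \<bar>z\<bar>" "\<And>z. \<bar>z\<bar> \<le> r \<Longrightarrow> \<bar>h z\<bar> \<le> B" "\<And>z. \<bar>z\<bar> \<le> r \<Longrightarrow> \<bar>h' z\<bar> \<le> B"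
    "\<And>z. \<bar>z\<bar> \<le> r \<Longrightarrow> \<bar>g z\<bar> \<le> B * z\<^sup>2" "\<And>z. \<bar>z\<bar> \<le> r \<Longrightarrow> z\<^sup>2 / 4 \<le> S z \<and> S z \<le> z\<^sup>2"
    by (rule nonlinearity[OF assms(2) a]) (rule that)
  obtain l e c where lec: "0 < l" "0 < e" "0 < c" "c \<le> 1" "l * (2 + 3 * a) \<le> 1 / 8"
    and lyap: "\<And>X V Z W P Q. 0 \<le> X \<Longrightarrow> 0 \<le> V \<Longrightarrow> 0 \<le> Z \<Longrightarrow> 0 \<le> W \<Longrightarrow>
       P \<ge> a\<^sup>2 * Z\<^sup>2 + V\<^sup>2 - \<bar>1 - 2 * a\<^sup>2\<bar> * (W * X) - e * Z * (V + a * Z) - \<gamma> * X * (V + a * Z) - (1 + a\<^sup>2) * X\<^sup>2 \<Longrightarrow>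
       Q \<ge> W\<^sup>2 - X * W - V\<^sup>2 \<Longrightarrow>
       - \<gamma> * X\<^sup>2 - l * P - l / 4 * Q \<le> - c * (X\<^sup>2 + V\<^sup>2 + Z\<^sup>2 + W\<^sup>2)"
    using lyapunov_constants[OF a(1) assms(4)] by blast
  define L where "L = 24 * (10 + (22 * C0)\<^sup>2)"
  define k where "k = c / 12"
  define A where "A = sqrt (8 * L / sqrt k)"
  define \<delta> where "\<delta> = Min {\<delta>0, r / (10 * C0), e / (31 * B * C0), k / (16 * B * L)}"
  have L: "0 < L" unfolding L_def by (simp add: add_pos_nonneg)
  have k: "0 < k" "k \<le> 1" using lec by (simp_all add: k_def)
  have A: "0 < A" "A\<^sup>2 = 8 * L / sqrt k" using L k by (simp_all add: A_def)
  have \<delta>: "0 < \<delta>" using assms(7,8) nl(1,2) lec k L by (simp add: \<delta>_def)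
  have \<delta>_le: "\<delta> \<le> \<delta>0" "\<delta> \<le> r / (10 * C0)" "\<delta> \<le> e / (31 * B * C0)" "\<delta> \<le> k / (16 * B * L)"
    unfolding \<delta>_def by (intro Min_le; simp)+
  \<comment> \<open>The bound is proved for every admissible \<open>I > 0\<close> above the norm of the data, as that norm may be zero.\<close>
  have pointwise: "Lp_norm_vec 2 (U t) \<le> ennreal (4 * A * I * (1 + t) powr (-1/4))"
    if U: "small_data_solution (phi, chi) \<sigma> a \<gamma> \<delta>0 C0 U0 U" and t: "0 \<le> t"
      and I: "0 < I" "I \<le> \<delta>" "I0_norm (phi, chi) U0 \<le> ennreal I" for U0 U t I
  proof -
    have smallness: "10 * C0 * I \<le> r" "31 * B * C0 * I \<le> e" "16 * B * L * I \<le> k"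
      using order_trans[OF I(2) \<delta>_le(2)] order_trans[OF I(2) \<delta>_le(3)] order_trans[OF I(2) \<delta>_le(4)] assms(8) nl(1) L
      by (simp_all add: pos_le_divide_eq mult_ac)
    interpret small_solution phi chi \<sigma> g h h' S \<gamma> a \<delta>0 C0 B r I e U0 U
      by (rule small_solution.intro) (fact assms a nl U I smallness)+
    interpret F: flow a \<gamma> B "22 * C0" e I "Uc 1" "Uc 2" "Uc 3" "Uc 4" "Uc_x 1" "Uc_x 2" "Uc_x 3" "Uc_x 4" gz Gz energy
      by (rule is_flow)
    have "F.N2 t \<le> 8 * L * I\<^sup>2 / sqrt (1 + k * t)"
      unfolding L_def k_def
      by (rule F.decay[OF lec(1,5,3) lyap _ t]) (use smallness(3) in \<open>simp_all add: L_def k_def\<close>)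
    also have "\<dots> \<le> 8 * L * I\<^sup>2 / (sqrt k * sqrt (1 + t))"
    proof (rule divide_left_mono)
      \<comment> \<open>This is where \<open>k \<le> 1\<close> is used, to pass from \<open>1 + k t\<close> to \<open>1 + t\<close>.\<close>
      have "k * (1 + t) \<le> 1 + k * t" using k by (simp add: distrib_left)
      then show "sqrt k * sqrt (1 + t) \<le> sqrt (1 + k * t)" by (simp add: real_sqrt_mult[symmetric])
    qed (use L k t in \<open>auto intro!: mult_pos_pos add_pos_nonneg\<close>)
    also have "\<dots> = (A * I * (1 + t) powr (-1/4))\<^sup>2"
    proof -
      have "((1 + t) powr (-1/4))\<^sup>2 = (1 + t) powr (- (1/2))" using t by (simp add: power2_eq_square powr_add[symmetric])
      also have "\<dots> = 1 / sqrt (1 + t)" using t by (simp add: powr_minus_divide powr_half_sqrt)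
      finally show ?thesis by (simp add: power_mult_distrib A(2))
    qed
    finally have N: "F.N2 t \<le> (A * I * (1 + t) powr (-1/4))\<^sup>2" .
    have D: "0 \<le> A * I * (1 + t) powr (-1/4)" using A I by simp
    have sq: "0 \<le> (norm (Uc i t))\<^sup>2" for i by simp
    have "norm (Uc 1 t) \<le> A * I * (1 + t) powr (-1/4)" "norm (Uc 2 t) \<le> A * I * (1 + t) powr (-1/4)"
      "norm (Uc 3 t) \<le> A * I * (1 + t) powr (-1/4)" "norm (Uc 4 t) \<le> A * I * (1 + t) powr (-1/4)"
      by (rule power2_le_imp_le[OF order_trans[OF _ N] D],
          use sq[of 1] sq[of 2] sq[of 3] sq[of 4] in \<open>simp add: F.N2_def\<close>)+
    then have "norm (Uc 1 t) + norm (Uc 2 t) + norm (Uc 3 t) + norm (Uc 4 t) \<le> 4 * A * I * (1 + t) powr (-1/4)"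
      by linarith
    then show ?thesis unfolding L2_norm_vec[OF t] by (rule ennreal_leI)
  qed
  show ?thesis
  proof (rule exI[of _ \<delta>], rule exI[of _ "4 * A"], intro conjI allI impI)
    show "0 < \<delta>" "\<delta> \<le> \<delta>0" "0 < 4 * A" using \<delta> \<delta>_le A by auto
    fix U0 U t
    assume I0: "I0_norm (phi, chi) U0 \<le> ennreal \<delta>" and U: "small_data_solution (phi, chi) \<sigma> a \<gamma> \<delta>0 C0 U0 U"
      and t: "(0::real) \<le> t"
    have "I0_norm (phi, chi) U0 < \<infinity>" using I0 by (rule le_less_trans) simp
    then obtain i where i: "I0_norm (phi, chi) U0 = ennreal i" "0 \<le> i" by (cases "I0_norm (phi, chi) U0") auto
    have i\<delta>: "i \<le> \<delta>" using I0 \<delta> by (simp add: i ennreal_le_iff)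
    define D where "D = 4 * A * (1 + t) powr (-1/4)"
    have D: "0 < D" using A t by (simp add: D_def)
    have "Lp_norm_vec 2 (U t) \<le> ennreal (D * i)"
    proof (cases "i = 0")
      case False
      then show ?thesis using pointwise[OF U t, of i] i i\<delta> by (simp add: D_def mult_ac)
    next
      case True
      \<comment> \<open>For zero data the bound holds for every small \<open>I\<close>, so the solution vanishes.\<close>
      have "Lp_norm_vec 2 (U t) \<le> 0 + ennreal \<epsilon>" if \<epsilon>: "0 < \<epsilon>" for \<epsilon>
      proof -
        let ?I = "min \<delta> (\<epsilon> / D)"
        have "Lp_norm_vec 2 (U t) \<le> ennreal (D * ?I)"
          using pointwise[OF U t, of ?I] \<delta> \<epsilon> D by (simp add: i True D_def mult_ac)
        also have "\<dots> \<le> ennreal (D * (\<epsilon> / D))" using D by (intro ennreal_leI mult_left_mono) auto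
        finally show ?thesis using D by simp
      qed
      then have "Lp_norm_vec 2 (U t) \<le> 0" by (rule ennreal_le_epsilon)
      then show ?thesis by simp
    qed
    also have "\<dots> = ennreal (4 * A) * I0_norm (phi, chi) U0 * ennreal ((1 + t) powr (-1/4))"
      unfolding i D_def using A i(2) by (simp add: ennreal_mult[symmetric] mult_ac)
    finally show "Lp_norm_vec 2 (U t) \<le> ennreal (4 * A) * I0_norm (phi, chi) U0 * ennreal ((1 + t) powr (-1/4))" .
  qed
qed

end
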